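(* Let $f\in C^2_c(\mathbb{R}^m\times\mathbb{B}^m,\mathcal{H}_k(\mathbb{R}))$, that is, $f\in C^2(\mathbb{R}^m\times\mathbb{B}^m,\mathcal{H}_k(\mathbb{R}))$ and $f$ has compact support with respect to $\boldsymbol{x}$, and set $$\Phi(\boldsymbol{y},\boldsymbol{v})=\int_{\mathbb{R}^m}\int_{\mathbb{S}^{m-1}}H_k(\boldsymbol{x},\boldsymbol{y},\boldsymbol{u},\boldsymbol{v})\,f(\boldsymbol{x},\boldsymbol{u})\,dS(\boldsymbol{u})\,d\boldsymbol{x},$$ where $H_k$ is the fundamental solution of the bosonic Laplacian $\mathcal{D}_k$. Then: (1) $\Phi\in C^2(\mathbb{R}^m\times\mathbb{B}^m,\mathcal{H}_k(\mathbb{R}))$; (2) $\mathcal{D}_k\Phi=f$ in $\mathbb{R}^m\times\mathbb{B}^m$.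
   Context: $\mathbb{B}^m$ is the unit ball and $\mathbb{S}^{m-1}$ the unit sphere of $\mathbb{R}^m$; $dS$ is the surface measure on $\mathbb{S}^{m-1}$. $\mathcal{H}_k(\mathbb{R})$ is the space of real-valued harmonic polynomials on $\mathbb{R}^m$, homogeneous of degree $k$. $C^2(\mathbb{R}^m\times\mathbb{B}^m,\mathcal{H}_k(\mathbb{R}))$ is the space of $C^2$ functions $f(\boldsymbol{x},\boldsymbol{u})$ on $\mathbb{R}^m\times\mathbb{B}^m$ such that for each fixed $\boldsymbol{x}$ the function $\boldsymbol{u}\mapsto f(\boldsymbol{x},\boldsymbol{u})$ is (the restriction of) an element of $\mathcal{H}_k(\mathbb{R})$; being polynomial in $\boldsymbol{u}$, $f$ is defined for all $\boldsymbol{u}\in\mathbb{R}^m$. The bosonic Laplacian acting on functions of $(\boldsymbol{x},\boldsymbol{u})$ with values in $\mathcal{H}_k(\mathbb{R})$ is $$\mathcal{D}_k=\Delta_{\boldsymbol{x}}-\frac{4\langle \boldsymbol{u},D_{\boldsymbol{x}}\rangle\langle D_{\boldsymbol{u}},D_{\boldsymbol{x}}\rangle}{m+2k-2}+\frac{4|\boldsymbol{u}|^2\langle D_{\boldsymbol{u}},D_{\boldsymbol{x}}\rangle^2}{(m+2k-2)(m+2k-4)},$$ where $\langle \boldsymbol{u},D_{\boldsymbol{x}}\rangle=\sum_{j=1}^m u_j\partial_{x_j}$ and $\langle D_{\boldsymbol{u}},D_{\boldsymbol{x}}\rangle=\sum_{j=1}^m\partial_{u_j}\partial_{x_j}$.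 Applied to $\Phi(\boldsymbol{y},\boldsymbol{v})$, it acts in the variables $(\boldsymbol{y},\boldsymbol{v})$, which take the roles of $(\boldsymbol{x},\boldsymbol{u})$. The fundamental solution of $\mathcal{D}_k$ is $$H_k(\boldsymbol{x},\boldsymbol{y},\boldsymbol{u},\boldsymbol{v})=c_{m,k}\,|\boldsymbol{y}-\boldsymbol{x}|^{2-m}\,Z_k\!\left(\frac{(\boldsymbol{y}-\boldsymbol{x})\boldsymbol{u}(\boldsymbol{y}-\boldsymbol{x})}{|\boldsymbol{y}-\boldsymbol{x}|^2},\boldsymbol{v}\right),$$ where $c_{m,k}$ is the normalizing constant (depending only on $m$ and $k$) of the fundamental solution, $Z_k(\boldsymbol{u},\boldsymbol{v})$ is the reproducing kernel of $\mathcal{H}_k(\mathbb{R})$, i.e. $h(\boldsymbol{v})=\int_{\mathbb{S}^{m-1}}Z_k(\boldsymbol{u},\boldsymbol{v})h(\boldsymbol{u})\,dS(\boldsymbol{u})$ for all $h\in\mathcal{H}_k(\mathbb{R})$, and products of vectors are taken in the Clifford algebra with $e_ie_j+e_je_i=-2\delta_{ij}$, so that for $\boldsymbol{a}\neq0$, $\frac{\boldsymbol{a}\boldsymbol{u}\boldsymbol{a}}{|\boldsymbol{a}|^2}=\boldsymbol{u}-2\frac{\langle\boldsymbol{a},\boldsymbol{u}\rangle}{|\boldsymbol{a}|^2}\boldsymbol{a}$.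
   Formalization: Assumes m ≥ 3 and excludes m = 4 with k ≥ 1: for m = 2, and for m = 4 with k ≥ 1, no normalizing constant makes H_k a fundamental solution of D_k (D_kΦ vanishes or D_k is undefined). The constant c_{m,k} is given explicitly. *)

theory Defs
  imports "HOL-Analysis.Analysis"
begin

text \<open>
  Throughout, the space R^m is an arbitrary Euclidean space \<open>'a\<close> with \<open>m = DIM('a)\<close>; its
  orthonormal basis \<open>Basis\<close> provides the coordinates. A function of \<open>(x, u)\<close> that is a polynomial
  in \<open>u\<close> is represented as a curried total function, i.e. already extended polynomially from the
  unit ball to all \<open>u\<close>.
\<close>

definition partial_deriv :: "'a::euclidean_space \<Rightarrow> ('a \<Rightarrow> real) \<Rightarrow> 'a \<Rightarrow> real" where
  "partial_deriv b g x = deriv (\<lambda>t. g (x + t *\<^sub>R b)) 0"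

definition laplacian :: "('a::euclidean_space \<Rightarrow> real) \<Rightarrow> 'a \<Rightarrow> real" where
  "laplacian g x = (\<Sum>b\<in>Basis. partial_deriv b (partial_deriv b g) x)"

definition harmonic_polys :: "nat \<Rightarrow> ('a::euclidean_space \<Rightarrow> real) set" where
  "harmonic_polys k =
     {h. real_polynomial_function h \<and> (\<forall>t u. h (t *\<^sub>R u) = t ^ k * h u) \<and> (\<forall>u. laplacian h u = 0)}"

text \<open>\<open>g\<close> is twice continuously (Frechet) differentiable on the open set \<open>U\<close>.\<close>

definition C2_on :: "'b::real_normed_vector set \<Rightarrow> ('b \<Rightarrow> real) \<Rightarrow> bool" where
  "C2_on U g \<longleftrightarrow>
     (\<exists>(g' :: 'b \<Rightarrow> 'b \<Rightarrow>\<^sub>L real) (g'' :: 'b \<Rightarrow> 'b \<Rightarrow>\<^sub>L ('b \<Rightarrow>\<^sub>L real)).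
        (\<forall>x\<in>U. (g has_derivative blinfun_apply (g' x)) (at x)) \<and>
        (\<forall>x\<in>U. (g' has_derivative blinfun_apply (g'' x)) (at x)) \<and>
        continuous_on U g'')"

definition C2_harmonic :: "nat \<Rightarrow> ('a::euclidean_space \<Rightarrow> 'a \<Rightarrow> real) set" where
  "C2_harmonic k =
     {f. C2_on (UNIV \<times> ball 0 1) (\<lambda>(x, u). f x u) \<and> (\<forall>x. f x \<in> harmonic_polys k)}"

definition C2c_harmonic :: "nat \<Rightarrow> ('a::euclidean_space \<Rightarrow> 'a \<Rightarrow> real) set" where
  "C2c_harmonic k =
     {f \<in> C2_harmonic k. compact (closure {x. \<exists>u\<in>ball 0 1. f x u \<noteq> 0})}"


definition u_dot_Dx :: "('a::euclidean_space \<Rightarrow> 'a \<Rightarrow> real) \<Rightarrow> 'a \<Rightarrow> 'a \<Rightarrow> real" where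
  "u_dot_Dx F x u = (\<Sum>b\<in>Basis. (u \<bullet> b) * partial_deriv b (\<lambda>x'. F x' u) x)"

definition Du_dot_Dx :: "('a::euclidean_space \<Rightarrow> 'a \<Rightarrow> real) \<Rightarrow> 'a \<Rightarrow> 'a \<Rightarrow> real" where
  "Du_dot_Dx F x u =
     (\<Sum>b\<in>Basis. partial_deriv b (\<lambda>u'. partial_deriv b (\<lambda>x'. F x' u') x) u)"

text \<open>
  The last denominator vanishes for \<open>m = 4\<close>, \<open>k = 0\<close>; there the numerator vanishes as well
  (\<open>F\<close> does not depend on \<open>u\<close>) and the convention \<open>0 / 0 = 0\<close> gives the Laplacian, as for
  every other \<open>m\<close> with \<open>k = 0\<close>.
\<close>

definition bosonic_laplacian ::
  "nat \<Rightarrow> ('a::euclidean_space \<Rightarrow> 'a \<Rightarrow> real) \<Rightarrow> 'a \<Rightarrow> 'a \<Rightarrow> real" where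
  "bosonic_laplacian k F x u =
     (let m = real DIM('a) in
        laplacian (\<lambda>x'. F x' u) x
        - 4 * u_dot_Dx (Du_dot_Dx F) x u / (m + 2 * real k - 2)
        + 4 * (norm u)\<^sup>2 * Du_dot_Dx (Du_dot_Dx F) x u
            / ((m + 2 * real k - 2) * (m + 2 * real k - 4)))"


text \<open>
  The (unnormalized) surface measure \<open>dS\<close> on the unit sphere, as a Borel measure on the whole space
  concentrated on \<open>sphere 0 1\<close>, by the polar coordinates formula: the measure of \<open>A\<close> is \<open>m\<close> times the
  volume of the cone \<open>{r a | a \<in> A, 0 < r \<le> 1}\<close>. Note that \<open>sgn x = x /\<^sub>R norm x\<close>.
\<close>

definition surface_measure :: "'a::euclidean_space measure" where
  "surface_measure =
     scale_measure (ennreal (real DIM('a)))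
       (distr (restrict_space lborel (cball 0 1 - {0})) borel sgn)"

definition reproducing_kernel :: "nat \<Rightarrow> 'a::euclidean_space \<Rightarrow> 'a \<Rightarrow> real" where
  "reproducing_kernel k u v =
     (THE z. z \<in> harmonic_polys k \<and>
        (\<forall>h\<in>harmonic_polys k. h v = (LINT w|surface_measure. z w * h w))) u"

text \<open>The Clifford product \<open>a u a / |a|\<^sup>2\<close> of vectors, i.e. the reflection in the hyperplane
  orthogonal to \<open>a\<close>.\<close>

definition clifford_reflect :: "'a::euclidean_space \<Rightarrow> 'a \<Rightarrow> 'a" where
  "clifford_reflect a u = u - (2 * (a \<bullet> u) / (norm a)\<^sup>2) *\<^sub>R a"

text \<open>
  With \<open>\<omega> = 2 \<pi>\<^bsup>m/2\<^esup> / \<Gamma>(m/2)\<close> the area of the unit sphere, the normalizing constant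
  \<open>(m+2k-4) / ((m-2) (4-m) \<omega>) = (m+2k-4) \<Gamma>(m/2-1) / (4 (4-m) \<pi>\<^bsup>m/2\<^esup>)\<close> makes the bosonic Laplacian of
  the kernel below the Dirac delta. For \<open>k = 0\<close> the factors \<open>m - 4\<close> cancel, leaving the constant of
  the fundamental solution of the Laplacian, also for \<open>m = 4\<close>. For \<open>m = 4\<close>, \<open>k \<ge> 1\<close> there is no such
  constant: the bosonic Laplacian is not elliptic (for \<open>k = 1\<close> it is \<open>\<Delta> - grad div\<close>).
\<close>

definition fundamental_const :: "'a::euclidean_space itself \<Rightarrow> nat \<Rightarrow> real" where
  "fundamental_const _ k =
     (let m = real DIM('a); \<omega> = measure (surface_measure :: 'a measure) UNIV in
        if k = 0 then 1 / ((2 - m) * \<omega>)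
        else (m + 2 * real k - 4) / ((m - 2) * (4 - m) * \<omega>))"

definition fundamental_solution ::
  "nat \<Rightarrow> 'a::euclidean_space \<Rightarrow> 'a \<Rightarrow> 'a \<Rightarrow> 'a \<Rightarrow> real" where
  "fundamental_solution k x y u v =
     fundamental_const TYPE('a) k * norm (y - x) powi (2 - int DIM('a))
       * reproducing_kernel k (clifford_reflect (y - x) u) v"

definition bosonic_potential ::
  "nat \<Rightarrow> ('a::euclidean_space \<Rightarrow> 'a \<Rightarrow> real) \<Rightarrow> 'a \<Rightarrow> 'a \<Rightarrow> real" where
  "bosonic_potential k f y v =
     (LINT x|lborel. LINT u|surface_measure. fundamental_solution k x y u v * f x u)"

end

theory Submission
  imports Defs
begin

text \<open>
  The reproducing kernel turns the inner integral into \<open>c |z|\<^bsup>2-m\<^esup> f (y - z) (R v)\<close>, where \<open>z = y - x\<close>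
  and \<open>R\<close> is the reflection along \<open>z\<close>. Expanding \<open>f\<close> in a basis of the harmonic polynomials, it
  suffices to study convolutions with \<open>|z|\<^bsup>-N\<^esup> h (srefl z v)\<close>, where \<open>N = m + 2k - 2\<close> and
  \<open>srefl z v = |z|\<^sup>2 R v\<close> is polynomial in \<open>z\<close>; the kernel is locally integrable, so all derivatives
  in \<open>y\<close> may be moved to \<open>f\<close>.

  For the equation, write \<open>|z|\<^bsup>-N\<^esup>\<close> as a Gamma integral of \<open>t\<^bsup>N/2-1\<^esup> exp (- t |z|\<^sup>2)\<close>. For fixed \<open>t\<close> one
  may integrate by parts, and the bosonic Laplacian of the Gaussian kernel turns out to be a
  \<open>t\<close>-derivative; hence the \<open>t\<close>-integral reduces to its boundary terms, a Gaussian approximate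
  identity for \<open>t \<rightarrow> \<infinity>\<close> and \<open>0\<close> for \<open>t \<rightarrow> 0\<close>. The mass of the approximate identity is a combination
  of Gaussian integrals of \<open>h (srefl z v)\<close> and its derivatives, which integration by parts
  reduces, by induction on the degree, to a multiple of \<open>h v\<close>.
\<close>

section \<open>Lebesgue measure and Gaussian integrals\<close>

text \<open>Second derivatives of the fundamental solution have degree -m in z and are in general
  not locally integrable, so derivatives can pass to the kernel only after a regularisation. For
  fixed t > 0 the Gaussian factor provides one that is smooth at the origin: no small ball is cut
  out and no surface terms arise. The expansion in harmonic polynomials is chosen with the values at
  points u of the unit ball as coefficients. The coefficients of f are then the slices f(., u),
  which are C2 with a common bounded support. With N = m + 2k - 2, let q and V be the Gaussian
  integrals of \<open>h (srefl z v)\<close> and \<open>v \<bullet> grad h (srefl z v)\<close>. The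
  mass is 4 V - 4 q, and integration by parts gives 2 k q = (N - 2) V. For k > 0 this means V - q =
  (4 - m) q / (N - 2), the origin of the factor (m + 2k - 4) / (4 - m) in the constant and of the
  exclusion of m = 4, k > 0, where the mass vanishes.\<close>

lemma nn_integral_lborel_translation:
  fixes f :: "'a::euclidean_space \<Rightarrow> ennreal"
  assumes [measurable]: "f \<in> borel_measurable borel"
  shows "(\<integral>\<^sup>+x. f (c + x) \<partial>lborel) = (\<integral>\<^sup>+x. f x \<partial>lborel)"
  by (subst (2) lborel_distr_plus[symmetric, of c]) (simp add: nn_integral_distr)

text \<open>Uniqueness of translation-invariant measures: the image of \<open>lborel\<close> is translation-invariant, and
  comparing the two on \<open>A\<close> against the rotation-invariant set \<open>ball 0 1\<close> by Fubini gives equality.\<close>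

lemma lborel_distr_orthogonal:
  fixes R :: "'a::euclidean_space \<Rightarrow> 'a"
  assumes R: "orthogonal_transformation R"
  shows "distr lborel borel R = lborel"
proof (rule measure_eqI)
  have lin: "linear R" using R by (simp add: orthogonal_transformation_linear)
  then have [measurable]: "R \<in> borel_measurable borel"
    by (intro borel_measurable_continuous_onI linear_continuous_on linear_conv_bounded_linear[THEN iffD1])
  define T where "T = inv R"
  have RT: "R (T y) = y" for y
    unfolding T_def using orthogonal_transformation_surj[OF R] by (rule surj_f_inv_f)
  fix A :: "'a set" assume "A \<in> sets (distr lborel borel R)"
  then have A[measurable]: "A \<in> sets borel" by simp
  define B :: "'a set" where "B = ball 0 1"
  have B[measurable]: "B \<in> sets borel" by (simp add: B_def)
  have mB: "emeasure lborel B > 0" "emeasure lborel B < \<infinity>"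
    unfolding B_def by (auto simp: emeasure_ball)
  have "emeasure (distr lborel borel R) A * emeasure lborel B
      = (\<integral>\<^sup>+x. indicator A (R x) \<partial>lborel) * emeasure lborel B"
  proof -
    have "emeasure (distr lborel borel R) A = (\<integral>\<^sup>+x. indicator A x \<partial>distr lborel borel R)" by simp
    also have "\<dots> = (\<integral>\<^sup>+x. indicator A (R x) \<partial>lborel)" by (rule nn_integral_distr) simp_all
    finally show ?thesis by simp
  qed
  also have "\<dots> = (\<integral>\<^sup>+y. (\<integral>\<^sup>+x. indicator A (R x) \<partial>lborel) * indicator B y \<partial>lborel)"
    by (simp add: nn_integral_cmult)
  also have "\<dots> = (\<integral>\<^sup>+y. (\<integral>\<^sup>+x. indicator A (R x + y) * indicator B y \<partial>lborel) \<partial>lborel)"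
  proof (rule nn_integral_cong)
    fix y :: 'a
    have "(\<integral>\<^sup>+x. indicator A (R x) \<partial>lborel) = (\<integral>\<^sup>+x. indicator A (R (T y + x)) \<partial>lborel)"
      by (rule nn_integral_lborel_translation[symmetric]) simp
    also have "\<dots> = (\<integral>\<^sup>+x. indicator A (R x + y) \<partial>lborel)"
      by (simp add: linear_add[OF lin] RT add.commute)
    finally show "(\<integral>\<^sup>+x. indicator A (R x) \<partial>lborel) * indicator B y
        = (\<integral>\<^sup>+x. indicator A (R x + y) * indicator B y \<partial>lborel)"
      by (simp add: nn_integral_multc)
  qed
  also have "\<dots> = (\<integral>\<^sup>+x. (\<integral>\<^sup>+y. indicator A (R x + y) * indicator B y \<partial>lborel) \<partial>lborel)"
    by (rule lborel_pair.Fubini') measurable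
  also have "\<dots> = (\<integral>\<^sup>+x. (\<integral>\<^sup>+y. indicator A y * indicator B (y - R x) \<partial>lborel) \<partial>lborel)"
  proof (rule nn_integral_cong)
    fix x :: 'a
    show "(\<integral>\<^sup>+y. indicator A (R x + y) * indicator B y \<partial>lborel)
       = (\<integral>\<^sup>+y. indicator A y * indicator B (y - R x) \<partial>lborel)"
      using nn_integral_lborel_translation[of "\<lambda>y. indicator A y * indicator B (y - R x)" "R x"] by simp
  qed
  also have "\<dots> = (\<integral>\<^sup>+y. (\<integral>\<^sup>+x. indicator A y * indicator B (y - R x) \<partial>lborel) \<partial>lborel)"
    by (rule lborel_pair.Fubini') measurable
  also have "\<dots> = (\<integral>\<^sup>+y. indicator A y * emeasure lborel B \<partial>lborel)"
  proof (rule nn_integral_cong)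
    fix y :: 'a
    have "indicator B (y - R x) = (indicator B (- T y + x) :: ennreal)" for x
    proof -
      have "y - R x = - R (- T y + x)" by (simp add: linear_add[OF lin] linear_neg[OF lin] linear_diff[OF lin] RT)
      then have "norm (y - R x) = norm (- T y + x)"
        using orthogonal_transformation_norm[OF R, of "- T y + x"] by (simp only: norm_minus_cancel)
      then show ?thesis by (simp add: B_def indicator_def)
    qed
    then have "(\<integral>\<^sup>+x. indicator B (y - R x) \<partial>lborel) = (\<integral>\<^sup>+x. indicator B (- T y + x) \<partial>(lborel :: 'a measure))"
      by (simp only:)
    also have "\<dots> = emeasure lborel B"
      by (subst nn_integral_lborel_translation) (simp_all)
    finally show "(\<integral>\<^sup>+x. indicator A y * indicator B (y - R x) \<partial>lborel) = indicator A y * emeasure lborel B"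
      by (subst nn_integral_cmult) simp_all
  qed
  also have "\<dots> = emeasure lborel A * emeasure lborel B"
    by (simp add: nn_integral_multc)
  finally show "emeasure (distr lborel borel R) A = emeasure lborel A"
    using mB by (metis infinity_ennreal_def mult_divide_eq_ennreal not_gr_zero top.not_eq_extremum)
qed simp

lemma
  fixes f :: "'a::euclidean_space \<Rightarrow> real"
  assumes c: "c \<noteq> 0" and [measurable]: "f \<in> borel_measurable borel"
  shows integral_lborel_scaleR: "(LINT x|lborel. f x) = \<bar>c\<bar> ^ DIM('a) * (LINT x|lborel. f (c *\<^sub>R x))"
    and integrable_lborel_scaleR_iff: "integrable lborel (\<lambda>x. f (c *\<^sub>R x)) \<longleftrightarrow> integrable lborel f"
proof -
  have *: "lborel = density (distr lborel borel (\<lambda>x::'a. c *\<^sub>R x)) (\<lambda>_. \<bar>c\<bar> ^ DIM('a))"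
    using lborel_affine[OF c, of "0::'a"] by simp
  show "(LINT x|lborel. f x) = \<bar>c\<bar> ^ DIM('a) * (LINT x|lborel. f (c *\<^sub>R x))"
    by (subst *, subst integral_density) (auto simp: integral_distr)
  show "integrable lborel (\<lambda>x. f (c *\<^sub>R x)) \<longleftrightarrow> integrable lborel f"
    using c by (subst (2) *, subst integrable_density) (auto simp: integrable_distr_eq)
qed

section \<open>Radial integrals: the Gaussian and the power |z|^(2-m)\<close>

lemma borel_measurable_layer_cake_norm:
  assumes [measurable]: "w \<in> borel_measurable borel"
  shows "(\<lambda>z::'a::euclidean_space. \<integral>\<^sup>+t. w t * indicator {(norm z)\<^sup>2..} t \<partial>lborel) \<in> borel_measurable lborel"
proof -
  have "(\<lambda>z::'a. \<integral>\<^sup>+t. w t * indicator {x. (norm (fst x))\<^sup>2 \<le> snd x} (z, t) \<partial>lborel) \<in> borel_measurable lborel"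
    by measurable
  also have "(\<lambda>z::'a. \<integral>\<^sup>+t. w t * indicator {x. (norm (fst x))\<^sup>2 \<le> snd x} (z, t) \<partial>lborel)
      = (\<lambda>z. \<integral>\<^sup>+t. w t * indicator {(norm z)\<^sup>2..} t \<partial>lborel)"
    by (intro ext nn_integral_cong) (auto simp: indicator_def)
  finally show ?thesis .
qed

text \<open>Fubini in (z, t): for t \<ge> 0 the section of {|z|^2 \<le> t} is the ball of radius
  sqrt t. This stands in for polar coordinates once a radial function is written as an integral of
  \<open>w\<close> from |z|^2 onwards.\<close>

lemma nn_integral_layer_cake_norm:
  assumes [measurable]: "w \<in> borel_measurable borel"
  shows "(\<integral>\<^sup>+z. (\<integral>\<^sup>+t. w t * indicator {(norm z)\<^sup>2..} t \<partial>lborel) \<partial>(lborel :: 'a::euclidean_space measure))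
    = (\<integral>\<^sup>+t. w t * ennreal (indicator {0..} t * (unit_ball_vol DIM('a) * sqrt t ^ DIM('a))) \<partial>lborel)"
proof -
  have "(\<integral>\<^sup>+z. (\<integral>\<^sup>+t. w t * indicator {(norm z)\<^sup>2..} t \<partial>lborel) \<partial>(lborel :: 'a measure))
     = (\<integral>\<^sup>+z. (\<integral>\<^sup>+t. w t * indicator {x. (norm (fst x))\<^sup>2 \<le> snd x} (z, t) \<partial>lborel) \<partial>(lborel :: 'a measure))"
    by (intro nn_integral_cong) (auto simp: indicator_def)
  also have "\<dots> = (\<integral>\<^sup>+t. (\<integral>\<^sup>+z. w t * indicator {x. (norm (fst x))\<^sup>2 \<le> snd x} (z, t) \<partial>(lborel :: 'a measure)) \<partial>lborel)"
    by (rule lborel_pair.Fubini'[symmetric]) measurable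
  also have "\<dots> = (\<integral>\<^sup>+t. w t * ennreal (indicator {0..} t * (unit_ball_vol DIM('a) * sqrt t ^ DIM('a))) \<partial>lborel)"
  proof (rule nn_integral_cong)
    fix t :: real
    have "(\<integral>\<^sup>+z. indicator {x. (norm (fst x))\<^sup>2 \<le> snd x} (z, t) \<partial>(lborel :: 'a measure))
       = (\<integral>\<^sup>+z. indicator (if t \<ge> 0 then cball 0 (sqrt t) else {}) z \<partial>(lborel :: 'a measure))"
      by (intro nn_integral_cong)
         (auto simp: indicator_def real_le_rsqrt intro: order_trans[OF zero_le_power2] dest: real_le_lsqrt sqrt_le_D power_mono[where n=2])
    also have "\<dots> = emeasure lborel (if t \<ge> 0 then cball 0 (sqrt t) else {} :: 'a set)"
      by (subst nn_integral_indicator) auto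
    also have "\<dots> = ennreal (indicator {0..} t * (unit_ball_vol DIM('a) * sqrt t ^ DIM('a)))"
      by (simp add: emeasure_cball)
    finally show "(\<integral>\<^sup>+z. w t * indicator {x. (norm (fst x))\<^sup>2 \<le> snd x} (z, t) \<partial>(lborel :: 'a measure))
        = w t * ennreal (indicator {0..} t * (unit_ball_vol DIM('a) * sqrt t ^ DIM('a)))"
      by (subst nn_integral_cmult) simp_all
  qed
  finally show ?thesis .
qed

lemma sqrt_power_eq_powr: "t \<ge> 0 \<Longrightarrow> n > 0 \<Longrightarrow> sqrt t ^ n = t powr (real n / 2)"
  by (cases "t = 0") (simp_all add: powr_half_sqrt[symmetric] powr_powr flip: powr_realpow)

text \<open>exp (- |z|^2) is the integral of exp (- t) over t \<ge> |z|^2, and the ball volumes turn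
  this into a Gamma integral. The value is kept in terms of \<open>unit_ball_vol\<close>, which
  later cancels against the area of the sphere in \<open>fundamental_const\<close>.\<close>

lemma has_bochner_integral_gaussian:
  "has_bochner_integral (lborel :: 'a::euclidean_space measure) (\<lambda>z. exp (- (norm z)\<^sup>2))
     (unit_ball_vol DIM('a) * Gamma (DIM('a) / 2 + 1))"
proof (rule has_bochner_integral_nn_integral)
  let ?m = "DIM('a)"
  have "(\<integral>\<^sup>+z. ennreal (exp (- (norm z)\<^sup>2)) \<partial>(lborel :: 'a measure))
     = (\<integral>\<^sup>+z. (\<integral>\<^sup>+t. ennreal (exp (- t)) * indicator {(norm z)\<^sup>2..} t \<partial>lborel) \<partial>(lborel :: 'a measure))"
  proof (rule nn_integral_cong)
    fix z :: 'a
    have "(\<integral>\<^sup>+t. ennreal (exp (- t)) * indicator {(norm z)\<^sup>2..} t \<partial>lborel) = ennreal (0 - (- exp (- (norm z)\<^sup>2)))"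
    proof (rule nn_integral_FTC_atLeast)
      show "((\<lambda>t::real. - exp (- t)) \<longlongrightarrow> 0) at_top"
        using tendsto_minus[OF filterlim_compose[OF exp_at_bot filterlim_uminus_at_bot_at_top]] by simp
    qed (auto intro!: derivative_eq_intros)
    then show "ennreal (exp (- (norm z)\<^sup>2)) = (\<integral>\<^sup>+t. ennreal (exp (- t)) * indicator {(norm z)\<^sup>2..} t \<partial>lborel)" by simp
  qed
  also have "\<dots> = (\<integral>\<^sup>+t. ennreal (exp (- t)) * ennreal (indicator {0..} t * (unit_ball_vol ?m * sqrt t ^ ?m)) \<partial>lborel)"
    by (rule nn_integral_layer_cake_norm) measurable
  also have "\<dots> = (\<integral>\<^sup>+t. ennreal (unit_ball_vol ?m) * ennreal (indicator {0..} t * (t powr (?m / 2 + 1 - 1) / exp t)) \<partial>lborel)"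
    by (intro nn_integral_cong)
       (auto simp: indicator_def sqrt_power_eq_powr exp_minus field_simps simp flip: ennreal_mult'' )
  also have "\<dots> = ennreal (unit_ball_vol ?m) * ennreal (Gamma (?m / 2 + 1))"
  proof -
    have "(\<integral>\<^sup>+t. ennreal (indicator {0..} t * (t powr (?m / 2 + 1 - 1) / exp t)) \<partial>lborel) = ennreal (Gamma (?m / 2 + 1))"
      by (rule nn_integral_has_integral_lborel) (use Gamma_integral_real[of "?m/2 + 1"] in \<open>auto simp: has_integral_restrict_UNIV[of "{0..}", symmetric] indicator_def of_bool_def if_distrib if_distribR cong: if_cong\<close>)
    then show ?thesis by (subst nn_integral_cmult) auto
  qed
  also have "\<dots> = ennreal (unit_ball_vol ?m * Gamma (?m / 2 + 1))"
    by (simp add: ennreal_mult'')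
  finally show "(\<integral>\<^sup>+z. ennreal (exp (- (norm z)\<^sup>2)) \<partial>(lborel :: 'a measure)) = ennreal (unit_ball_vol ?m * Gamma (?m / 2 + 1))" .
qed (auto intro!: mult_nonneg_nonneg Gamma_real_nonneg less_imp_le[OF Gamma_real_pos])

lemma integrable_gaussian:
  assumes "a > 0"
  shows "integrable (lborel :: 'a::euclidean_space measure) (\<lambda>z. exp (- a * (norm z)\<^sup>2))"
proof -
  have "integrable (lborel :: 'a measure) (\<lambda>z. exp (- (norm (sqrt a *\<^sub>R z))\<^sup>2))"
    using integrable_lborel_scaleR_iff[of "sqrt a" "\<lambda>z::'a. exp (- (norm z)\<^sup>2)"] assms
      has_bochner_integral_gaussian[where 'a='a]
    by (auto simp: has_bochner_integral_iff)
  then show ?thesis using assms by (simp add: power_mult_distrib)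
qed

text \<open>|z|^(2-m) - c^(2-m) is the integral of (m/2 - 1) t^(-m/2) over |z|^2 \<le> t \<le> c^2.
  The volume of the ball of radius sqrt t cancels the power of t, so only a constant is integrated
  over a bounded interval.\<close>

lemma integrable_norm_powr_cball:
  fixes r :: real
  assumes "DIM('a::euclidean_space) \<ge> 3"
  shows "integrable (lborel :: 'a measure) (\<lambda>z. indicator (cball 0 r) z * norm z powr (2 - real DIM('a)))"
proof (rule integrableI_bounded)
  let ?m = "real DIM('a)"
  have m: "?m \<ge> 3" using assms by simp
  define c where "c = \<bar>r\<bar> + 1"
  have c: "c > 0" "r \<le> c" by (auto simp: c_def)
  define w where "w t = ennreal ((?m/2 - 1) * t powr (- ?m / 2)) * indicator {0<..c\<^sup>2} t" for t
  have [measurable]: "w \<in> borel_measurable borel" unfolding w_def by measurable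
  have fin: "(\<integral>\<^sup>+z. ennreal (c powr (2 - ?m)) * indicator (cball 0 c) z \<partial>(lborel :: 'a measure)) < \<infinity>"
    by (simp add: nn_integral_cmult_indicator ennreal_mult_less_top emeasure_cball c less_imp_le)
  have "(\<integral>\<^sup>+z. (\<integral>\<^sup>+t. w t * indicator {(norm z)\<^sup>2..} t \<partial>lborel) \<partial>(lborel :: 'a measure))
     = (\<integral>\<^sup>+t. w t * ennreal (indicator {0..} t * (unit_ball_vol DIM('a) * sqrt t ^ DIM('a))) \<partial>lborel)"
    by (rule nn_integral_layer_cake_norm) measurable
  also have "\<dots> = (\<integral>\<^sup>+t. ennreal ((?m/2 - 1) * unit_ball_vol DIM('a)) * indicator {0<..c\<^sup>2} t \<partial>lborel)"
    using m unfolding w_def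
    by (intro nn_integral_cong)
       (auto simp: indicator_def sqrt_power_eq_powr powr_minus field_simps simp flip: ennreal_mult'' )
  also have "\<dots> < \<infinity>"
    by (simp add: nn_integral_cmult_indicator ennreal_mult_less_top)
  finally have fin2: "(\<integral>\<^sup>+z. (\<integral>\<^sup>+t. w t * indicator {(norm z)\<^sup>2..} t \<partial>lborel) \<partial>(lborel :: 'a measure)) < \<infinity>" .
  have "(\<integral>\<^sup>+z. ennreal (norm (indicator (cball 0 r) z * norm z powr (2 - ?m))) \<partial>(lborel :: 'a measure))
     \<le> (\<integral>\<^sup>+z. ennreal (c powr (2 - ?m)) * indicator (cball 0 c) z +
         (\<integral>\<^sup>+t. w t * indicator {(norm z)\<^sup>2..} t \<partial>lborel) \<partial>(lborel :: 'a measure))"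
  proof (rule nn_integral_mono)
    fix z :: 'a
    show "ennreal (norm (indicator (cball 0 r) z * norm z powr (2 - ?m)))
      \<le> ennreal (c powr (2 - ?m)) * indicator (cball 0 c) z +
         (\<integral>\<^sup>+t. w t * indicator {(norm z)\<^sup>2..} t \<partial>lborel)"
    proof (cases "z = 0 \<or> z \<notin> cball 0 r")
      case False
      then have z: "norm z > 0" "norm z \<le> c" using c by auto
      have "(\<integral>\<^sup>+t. w t * indicator {(norm z)\<^sup>2..} t \<partial>lborel)
          = (\<integral>\<^sup>+t. ennreal ((?m/2 - 1) * t powr (- ?m / 2)) * indicator {(norm z)\<^sup>2..c\<^sup>2} t \<partial>lborel)"
        using z unfolding w_def by (intro nn_integral_cong) (auto simp: indicator_def not_less dest: order.trans[of "(norm z)\<^sup>2" _ 0])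
      also have "\<dots> = ennreal (- ((c\<^sup>2) powr (1 - ?m/2)) - (- (((norm z)\<^sup>2) powr (1 - ?m/2))))"
      proof (rule nn_integral_FTC_Icc)
        fix t assume "t \<in> {(norm z)\<^sup>2..c\<^sup>2}"
        moreover have "(norm z)\<^sup>2 > 0" using z(1) by (rule zero_less_power)
        ultimately have "t > 0" by (simp only: atLeastAtMost_iff) linarith
        then show "((\<lambda>t. - (t powr (1 - ?m/2))) has_real_derivative ((?m/2 - 1) * t powr (- ?m / 2))) (at t)"
          by (auto intro!: derivative_eq_intros simp: field_simps)
        show "0 \<le> (?m/2 - 1) * t powr (- ?m / 2)" using m by simp
      qed (use z in \<open>auto intro: power_mono\<close>)
      also have "\<dots> = ennreal (norm z powr (2 - ?m) - c powr (2 - ?m))"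
      proof -
        have "(x\<^sup>2) powr (1 - ?m/2) = x powr (2 - ?m)" if "x > 0" for x :: real
          using that by (simp add: powr_powr algebra_simps flip: powr_numeral)
        then show ?thesis using z c by simp
      qed
      finally have "(\<integral>\<^sup>+t. w t * indicator {(norm z)\<^sup>2..} t \<partial>lborel)
          = ennreal (norm z powr (2 - ?m) - c powr (2 - ?m))" .
      moreover have "norm z powr (2 - ?m) \<ge> c powr (2 - ?m)"
        using z m by (intro powr_mono2') auto
      moreover have "norm (indicator (cball 0 r) z * norm z powr (2 - ?m)) = norm z powr (2 - ?m)"
        "(indicator (cball 0 c) z :: ennreal) = 1"
        using False z by auto
      moreover have "ennreal (c powr (2 - ?m)) + ennreal (norm z powr (2 - ?m) - c powr (2 - ?m)) = ennreal (norm z powr (2 - ?m))"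
        using \<open>norm z powr (2 - ?m) \<ge> c powr (2 - ?m)\<close> by (subst ennreal_plus[symmetric]) auto
      ultimately show ?thesis by (simp only: mult_1_right order_refl)
    next
      \<comment> \<open>At the origin \<open>0 powr a = 0\<close> for every exponent, so this case
        joins the points outside the ball.\<close>
      case True
      then have "norm (indicator (cball 0 r) z * norm z powr (2 - ?m)) = 0" by (auto simp: indicator_def)
      then show ?thesis by (simp only: ennreal_0 zero_le)
    qed
  qed
  also have "\<dots> = (\<integral>\<^sup>+z. ennreal (c powr (2 - ?m)) * indicator (cball 0 c) z \<partial>(lborel :: 'a measure)) +
      (\<integral>\<^sup>+z. (\<integral>\<^sup>+t. w t * indicator {(norm z)\<^sup>2..} t \<partial>lborel) \<partial>(lborel :: 'a measure))"
  proof (rule nn_integral_add)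
    show "(\<lambda>z::'a. \<integral>\<^sup>+t. w t * indicator {(norm z)\<^sup>2..} t \<partial>lborel) \<in> borel_measurable lborel"
      by (rule borel_measurable_layer_cake_norm) measurable
    show "(\<lambda>z::'a. ennreal (c powr (2 - ?m)) * indicator (cball 0 c) z) \<in> borel_measurable lborel"
      by (intro borel_measurable_times_ennreal borel_measurable_const borel_measurable_indicator) simp
  qed
  also have "\<dots> < \<infinity>" using fin fin2 by (simp only: ennreal_add_less_top infinity_ennreal_def)
  finally show "(\<integral>\<^sup>+z. ennreal (norm (indicator (cball 0 r) z * norm z powr (2 - ?m))) \<partial>(lborel :: 'a measure)) < \<infinity>" .
  show "(\<lambda>z::'a. indicator (cball 0 r) z * norm z powr (2 - ?m)) \<in> borel_measurable lborel"
    by (intro borel_measurable_times borel_measurable_indicator powr_real_measurable) simp_all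
qed

section \<open>Convolution with locally integrable kernels\<close>

lemma has_derivative_at_direction:
  fixes f :: "'a::real_normed_vector \<Rightarrow> real"
  assumes "\<And>x. (f has_derivative f' x) (at x)"
  shows "((\<lambda>t. f (x + t *\<^sub>R b)) has_real_derivative f' (x + t *\<^sub>R b) b) (at t)"
proof -
  have "((\<lambda>t. x + t *\<^sub>R b) has_derivative (\<lambda>t. t *\<^sub>R b)) (at t)"
    by (auto intro!: derivative_eq_intros)
  from has_derivative_compose[OF this assms]
  have "((\<lambda>t. f (x + t *\<^sub>R b)) has_derivative (\<lambda>s. f' (x + t *\<^sub>R b) (s *\<^sub>R b))) (at t)" .
  moreover have "f' (x + t *\<^sub>R b) (s *\<^sub>R b) = f' (x + t *\<^sub>R b) b * s" for s
    using linear_scale[OF has_derivative_linear[OF assms]] by simp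
  ultimately show ?thesis by (simp add: has_field_derivative_def)
qed

lemma mean_value_direction:
  fixes f :: "'a::real_normed_vector \<Rightarrow> real"
  assumes "\<And>x. (f has_derivative f' x) (at x)" "h > 0"
  obtains t where "0 < t" "t < h" "f (x + h *\<^sub>R b) - f x = h * f' (x + t *\<^sub>R b) b"
proof -
  obtain t where "t > 0" "t < h" "f (x + h *\<^sub>R b) - f (x + 0 *\<^sub>R b) = (h - 0) * f' (x + t *\<^sub>R b) b"
    using MVT2[OF assms(2), of "\<lambda>t. f (x + t *\<^sub>R b)" "\<lambda>t. f' (x + t *\<^sub>R b) b"]
      has_derivative_at_direction[OF assms(1)] by blast
  with that show thesis by simp
qed

lemma
  fixes f :: "'a::euclidean_space \<Rightarrow> real"
  assumes [measurable]: "f \<in> borel_measurable borel"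
  shows integral_lborel_translation: "(LINT x|lborel. f (c + x)) = (LINT x|lborel. f x)"
    and integrable_lborel_translation_iff: "integrable lborel (\<lambda>x. f (c + x)) \<longleftrightarrow> integrable lborel f"
  by (subst (2) lborel_distr_plus[symmetric, of c], simp add: integral_distr integrable_distr_eq)+

text \<open>The difference quotients of F have integral 0 by translation invariance. Each of them is
  a value of the derivative on the segment from z to z + b, so a bound along this segment suffices
  for dominated convergence. Stated without compact support, the lemma also covers Gaussian
  weights.\<close>

lemma integral_directional_derivative_eq_0:
  fixes F :: "'a::euclidean_space \<Rightarrow> real"
  assumes F: "\<And>x. (F has_derivative F' x) (at x)" and int: "integrable lborel F"
    and w: "integrable lborel w" and le: "\<And>z t. \<bar>t\<bar> \<le> 1 \<Longrightarrow> \<bar>F' (z + t *\<^sub>R b) b\<bar> \<le> w z"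
  shows "integrable lborel (\<lambda>z. F' z b)" and "(LINT z|lborel. F' z b) = 0"
proof -
  have "continuous_on UNIV F"
    using F by (intro has_derivative_continuous_on) auto
  then have [measurable]: "F \<in> borel_measurable borel" by (rule borel_measurable_continuous_onI)
  define h where "h n = 1 / (real n + 1)" for n :: nat
  define q where "q n z = (F (h n *\<^sub>R b + z) - F z) / h n" for n z
  have h: "h n > 0" "h n \<le> 1" for n by (auto simp: h_def)
  have [measurable]: "q n \<in> borel_measurable borel" for n unfolding q_def by measurable
  have bound: "norm (q n z) \<le> w z" for n z
  proof -
    obtain t where t: "0 < t" "t < h n" "F (z + h n *\<^sub>R b) - F z = h n * F' (z + t *\<^sub>R b) b"
      using mean_value_direction[OF F h(1)] .
    then have "q n z = F' (z + t *\<^sub>R b) b" using h(1)[of n] by (simp add: q_def add.commute)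
    moreover have "\<bar>t\<bar> \<le> 1" using t h(2)[of n] by simp
    ultimately show ?thesis using le by simp
  qed
  have lim: "(\<lambda>n. q n z) \<longlonglongrightarrow> F' z b" for z
  proof -
    have "((\<lambda>t. (F (z + t *\<^sub>R b) - F z) / t) \<longlongrightarrow> F' z b) (at 0)"
      using has_derivative_at_direction[OF F, of z b 0] by (simp add: DERIV_def)
    moreover have "filterlim h (at 0) sequentially"
      unfolding h_def filterlim_at using h(1) LIMSEQ_inverse_real_of_nat
      by (auto simp: inverse_eq_divide add.commute)
    ultimately show ?thesis
      unfolding q_def by (auto dest: filterlim_compose simp: add.commute)
  qed
  have meas: "(\<lambda>z. F' z b) \<in> borel_measurable lborel"
    by (rule borel_measurable_LIMSEQ_real[OF lim]) measurable
  note dc = meas _ w AE_I2[OF lim] AE_I2[OF bound]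
  show "integrable lborel (\<lambda>z. F' z b)" by (rule integrable_dominated_convergence[OF dc]) simp
  have "(\<lambda>n. LINT z|lborel. q n z) \<longlonglongrightarrow> (LINT z|lborel. F' z b)"
    by (rule integral_dominated_convergence[OF dc]) simp
  moreover have "(LINT z|lborel. q n z) = 0" for n
  proof -
    have "(LINT z|lborel. q n z) = (LINT z|lborel. F (h n *\<^sub>R b + z) - F z) / h n"
      unfolding q_def by (rule integral_divide_zero)
    also have "(LINT z|lborel. F (h n *\<^sub>R b + z) - F z) = (LINT z|lborel. F (h n *\<^sub>R b + z)) - (LINT z|lborel. F z)"
      using int integrable_lborel_translation_iff[of F "h n *\<^sub>R b"] by (intro Bochner_Integration.integral_diff) auto
    also have "(LINT z|lborel. F (h n *\<^sub>R b + z)) = (LINT z|lborel. F z)"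
      by (rule integral_lborel_translation[of F "h n *\<^sub>R b"]) measurable
    finally show ?thesis by simp
  qed
  ultimately have "(\<lambda>n. 0) \<longlonglongrightarrow> (LINT z|lborel. F' z b)" by simp
  from LIMSEQ_unique[OF tendsto_const this] show "(LINT z|lborel. F' z b) = 0" by simp
qed

section \<open>Regularity of convolutions with a locally integrable kernel\<close>

definition locally_integrable :: "('a::euclidean_space \<Rightarrow> real) \<Rightarrow> bool" where
  "locally_integrable k \<longleftrightarrow> k \<in> borel_measurable borel \<and>
     (\<forall>r. integrable lborel (\<lambda>z. indicator (cball 0 r) z * k z))"

lemma locally_integrableD:
  assumes "locally_integrable k"
  shows "k \<in> borel_measurable borel" "integrable lborel (\<lambda>z. indicator (cball 0 r) z * k z)"
  using assms by (auto simp: locally_integrable_def)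

lemma locally_integrable_continuous:
  fixes k :: "'a::euclidean_space \<Rightarrow> real"
  assumes "continuous_on UNIV k"
  shows "locally_integrable k"
  unfolding locally_integrable_def
  using borel_integrable_compact[of "cball 0 r" k for r] assms
  by (auto intro: borel_measurable_continuous_onI continuous_on_subset)

lemma bounded_of_support:
  fixes p :: "'a::euclidean_space \<Rightarrow> real"
  assumes "continuous_on UNIV p" "\<And>x. norm x > r \<Longrightarrow> p x = 0"
  obtains C where "C > 0" "\<And>x. \<bar>p x\<bar> \<le> C"
proof -
  have "bounded (p ` cball 0 r)"
    by (intro compact_imp_bounded compact_continuous_image continuous_on_subset[OF assms(1)]) auto
  then obtain C where C: "C > 0" "\<And>x. norm x \<le> r \<Longrightarrow> \<bar>p x\<bar> \<le> C"
    by (force simp: bounded_pos)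
  have "\<bar>p x\<bar> \<le> C" for x using C assms(2)[of x] by (cases "norm x \<le> r") auto
  with C that show thesis by blast
qed

lemma integrable_locally_mult:
  fixes k p :: "'a::euclidean_space \<Rightarrow> real"
  assumes k: "locally_integrable k" and p: "continuous_on UNIV p" "\<And>x. norm x > r \<Longrightarrow> p x = 0"
  shows "integrable lborel (\<lambda>z. k z * p (y - z))"
proof -
  note [measurable] = locally_integrableD(1)[OF k] borel_measurable_continuous_onI[OF p(1)]
  obtain C where C: "C > 0" "\<And>x. \<bar>p x\<bar> \<le> C" using bounded_of_support[OF p] by metis
  show ?thesis
  proof (rule Bochner_Integration.integrable_bound)
    show "integrable lborel (\<lambda>z. C * (indicator (cball 0 (norm y + \<bar>r\<bar>)) z * k z))"
      by (intro integrable_mult_right locally_integrableD[OF k])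
    show "AE z in lborel. norm (k z * p (y - z)) \<le> norm (C * (indicator (cball 0 (norm y + \<bar>r\<bar>)) z * k z))"
    proof (rule AE_I2)
      fix z
      show "norm (k z * p (y - z)) \<le> norm (C * (indicator (cball 0 (norm y + \<bar>r\<bar>)) z * k z))"
      proof (cases "norm z \<le> norm y + \<bar>r\<bar>")
        case True
        then show ?thesis using C by (simp add: abs_mult mult.commute[of "\<bar>k z\<bar>"] mult_right_mono)
      next
        case False
        then have "norm (y - z) > r" using norm_triangle_ineq2[of z y] by (simp add: norm_minus_commute)
        then show ?thesis using p(2) by simp
      qed
    qed
  qed measurable
qed

text \<open>Intended for increments and Taylor remainders p: their supports stay in a fixed ball, so
  the integral on the right is a constant while e becomes small.\<close>

lemma convolution_estimate:
  fixes k p :: "'a::euclidean_space \<Rightarrow> real"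
  assumes k: "locally_integrable k" and p: "p \<in> borel_measurable borel"
    "\<And>x. norm x > r \<Longrightarrow> p x = 0" "\<And>x. \<bar>p x\<bar> \<le> e"
  shows "\<bar>LINT z|lborel. k z * p (y - z)\<bar> \<le> e * (LINT z|lborel. indicator (cball 0 (norm y + \<bar>r\<bar>)) z * \<bar>k z\<bar>)"
proof -
  note [measurable] = locally_integrableD(1)[OF k] p(1)
  have e: "e \<ge> 0" using p(3)[of 0] by simp
  have "integrable lborel (\<lambda>z. norm (indicator (cball 0 (norm y + \<bar>r\<bar>)) z * k z))"
    by (rule integrable_norm[OF locally_integrableD(2)[OF k]])
  then have int: "integrable lborel (\<lambda>z. e * (indicator (cball 0 (norm y + \<bar>r\<bar>)) z * \<bar>k z\<bar>))"
    by (auto simp: abs_mult intro: integrable_mult_right)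
  have "\<bar>LINT z|lborel. k z * p (y - z)\<bar> \<le> (LINT z|lborel. e * (indicator (cball 0 (norm y + \<bar>r\<bar>)) z * \<bar>k z\<bar>))"
  proof (rule integral_abs_bound_integral[OF _ int])
    have le: "\<bar>k z * p (y - z)\<bar> \<le> e * (indicator (cball 0 (norm y + \<bar>r\<bar>)) z * \<bar>k z\<bar>)" for z
    proof (cases "norm z \<le> norm y + \<bar>r\<bar>")
      case True
      then show ?thesis using p(3) by (simp add: abs_mult mult.commute[of "\<bar>k z\<bar>"] mult_right_mono)
    next
      case False
      then have "norm (y - z) > r" using norm_triangle_ineq2[of z y] by (simp add: norm_minus_commute)
      then show ?thesis using p(2) e by simp
    qed
    then show "\<And>z. \<bar>k z * p (y - z)\<bar> \<le> e * (indicator (cball 0 (norm y + \<bar>r\<bar>)) z * \<bar>k z\<bar>)" .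
    show "integrable lborel (\<lambda>z. k z * p (y - z))"
      by (rule Bochner_Integration.integrable_bound[OF int])
         (use le e in \<open>auto simp: abs_mult\<close>)
  qed
  then show ?thesis by simp
qed

lemma continuous_on_convolution:
  fixes k p :: "'a::euclidean_space \<Rightarrow> real"
  assumes k: "locally_integrable k" and p: "continuous_on UNIV p" "\<And>x. norm x > r \<Longrightarrow> p x = 0"
  shows "continuous_on UNIV (\<lambda>y. LINT z|lborel. k z * p (y - z))"
proof -
  have [measurable]: "p \<in> borel_measurable borel" by (rule borel_measurable_continuous_onI[OF p(1)])
  have "isCont (\<lambda>y. LINT z|lborel. k z * p (y - z)) y" for y
    unfolding continuous_at_eps_delta
  proof (intro allI impI)
    fix e :: real assume e: "e > 0"
    \<comment> \<open>Shifts of length below 1 keep the increments supported in radius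
      \<open>\<bar>r\<bar> + 1\<close> and their arguments in radius
      \<open>\<bar>r\<bar> + 2\<close>. The nested absolute value is the form produced by
      \<open>convolution_estimate\<close>.\<close>
    define K where "K = (LINT z|lborel. indicator (cball 0 (norm y + \<bar>\<bar>r\<bar> + 1\<bar>)) z * \<bar>k z\<bar>)"
    have K: "K \<ge> 0" unfolding K_def by (intro Bochner_Integration.integral_nonneg) auto
    define e' where "e' = e / (K + 1)"
    have e': "e' > 0" using e K by (simp add: e'_def)
    have "uniformly_continuous_on (cball 0 (\<bar>r\<bar> + 2)) p"
      by (intro compact_uniformly_continuous continuous_on_subset[OF p(1)]) auto
    then obtain d where d: "d > 0" "\<And>x x'. x \<in> cball 0 (\<bar>r\<bar> + 2) \<Longrightarrow> x' \<in> cball 0 (\<bar>r\<bar> + 2) \<Longrightarrow> dist x' x < d \<Longrightarrow> dist (p x') (p x) < e'"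
      unfolding uniformly_continuous_on_def using e' by metis
    show "\<exists>d>0. \<forall>y'. dist y' y < d \<longrightarrow> dist (LINT z|lborel. k z * p (y' - z)) (LINT z|lborel. k z * p (y - z)) < e"
    proof (intro exI conjI allI impI)
      show "min d 1 > 0" using d by simp
      fix y' assume y': "dist y' y < min d 1"
      define D where "D x = p (x + (y' - y)) - p x" for x
      have D0: "D x = 0" if "norm x > \<bar>r\<bar> + 1" for x
      proof -
        have "norm x \<le> norm (x + (y' - y)) + norm (y' - y)"
          using norm_triangle_ineq4[of "x + (y' - y)" "y' - y"] by simp
        then have "norm (x + (y' - y)) > r" "norm x > r" using y' that by (auto simp: dist_norm)
        then show ?thesis using p(2) by (simp add: D_def)
      qed
      have De: "\<bar>D x\<bar> \<le> e'" for x
      proof (cases "norm x > \<bar>r\<bar> + 1")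
        case False
        have "norm (y' - y) < 1" using y' by (simp add: dist_norm)
        then have "x + (y' - y) \<in> cball 0 (\<bar>r\<bar> + 2)" "x \<in> cball 0 (\<bar>r\<bar> + 2)"
          unfolding mem_cball_0 using False norm_triangle_ineq[of x "y' - y"] by linarith+
        then have "dist (p (x + (y' - y))) (p x) < e'" using y' by (intro d) (auto simp: dist_norm)
        then show ?thesis by (simp add: D_def dist_real_def)
      qed (use D0 e' in auto)
      have meas: "D \<in> borel_measurable borel" unfolding D_def by measurable
      have "(LINT z|lborel. k z * p (y' - z)) - (LINT z|lborel. k z * p (y - z)) = (LINT z|lborel. k z * D (y - z))"
        by (subst Bochner_Integration.integral_diff[symmetric])
           (auto simp: D_def algebra_simps intro!: integrable_locally_mult[OF k p])
      also have "\<bar>\<dots>\<bar> \<le> e' * K"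
        unfolding K_def by (rule convolution_estimate[OF k meas D0 De])
      also have "\<dots> < e" using e K by (simp add: e'_def field_simps)
      finally show "dist (LINT z|lborel. k z * p (y' - z)) (LINT z|lborel. k z * p (y - z)) < e"
        by (simp add: dist_real_def)
    qed
  qed
  then show ?thesis by (simp add: continuous_on_eq_continuous_at)
qed

text \<open>All derivatives fall on g. The Taylor remainder of g is uniformly of size o(|h|) because
  its partial derivatives are uniformly continuous on a ball, and
  \<open>convolution_estimate\<close> carries this over to the convolution.\<close>

lemma has_derivative_convolution:
  fixes k g :: "'a::euclidean_space \<Rightarrow> real"
  assumes k: "locally_integrable k" and g: "\<And>x. (g has_derivative g' x) (at x)"
    and g': "\<And>b. b \<in> Basis \<Longrightarrow> continuous_on UNIV (\<lambda>x. g' x b)"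
    and supp: "\<And>x. norm x > r \<Longrightarrow> g x = 0" "\<And>x d. norm x > r \<Longrightarrow> g' x d = 0"
  shows "((\<lambda>y. LINT z|lborel. k z * g (y - z)) has_derivative (\<lambda>d. LINT z|lborel. k z * g' (y - z) d)) (at y)"
proof -
  have lin: "linear (g' x)" for x using g has_derivative_linear by blast
  have expand: "g' x d = (\<Sum>b\<in>Basis. (d \<bullet> b) * g' x b)" for x d
    using linear_sum[OF lin, of x "\<lambda>b. (d \<bullet> b) *\<^sub>R b" Basis] by (simp add: euclidean_representation linear_scale[OF lin])
  have cont': "continuous_on UNIV (\<lambda>x. g' x d)" for d
    by (subst expand) (intro continuous_intros g')
  have cont: "continuous_on UNIV g"
    using g by (intro has_derivative_continuous_on) auto
  note [measurable] = borel_measurable_continuous_onI[OF cont] borel_measurable_continuous_onI[OF cont']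
  have int: "integrable lborel (\<lambda>z. k z * g (y - z))" for y
    using integrable_locally_mult[OF k cont supp(1)] .
  have int': "integrable lborel (\<lambda>z. k z * g' (y - z) d)" for y d
    using integrable_locally_mult[OF k cont' supp(2)] .
  show ?thesis
    unfolding has_derivative_at_alt
  proof (intro conjI allI impI)
    have "linear (\<lambda>d. LINT z|lborel. k z * g' (y - z) d)"
      using int' by (intro linearI) (simp_all add: linear_add[OF lin] linear_scale[OF lin] algebra_simps)
    then show "bounded_linear (\<lambda>d. LINT z|lborel. k z * g' (y - z) d)"
      by (simp add: linear_conv_bounded_linear)
    fix e :: real assume e: "e > 0"
    define K where "K = (LINT z|lborel. indicator (cball 0 (norm y + \<bar>\<bar>r\<bar> + 1\<bar>)) z * \<bar>k z\<bar>)"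
    have K: "K \<ge> 0" unfolding K_def by (intro Bochner_Integration.integral_nonneg) auto
    \<comment> \<open>The remainder is summed over the coordinates, hence the division by the
      dimension.\<close>
    define e' where "e' = e / (K + 1) / DIM('a)"
    have e': "e' > 0" using e K by (simp add: e'_def)
    have "\<exists>d>0. \<forall>x\<in>cball 0 (\<bar>r\<bar> + 2). \<forall>x'\<in>cball 0 (\<bar>r\<bar> + 2). dist x' x < d \<longrightarrow> dist (g' x' b) (g' x b) < e'"
      if "b \<in> Basis" for b
    proof -
      have "uniformly_continuous_on (cball 0 (\<bar>r\<bar> + 2)) (\<lambda>x. g' x b)"
        by (intro compact_uniformly_continuous continuous_on_subset[OF cont']) auto
      then show ?thesis unfolding uniformly_continuous_on_def using e' by metis
    qed
    then obtain d where d: "\<And>b. b \<in> Basis \<Longrightarrow> d b > 0"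
      "\<And>b x x'. b \<in> Basis \<Longrightarrow> x \<in> cball 0 (\<bar>r\<bar> + 2) \<Longrightarrow> x' \<in> cball 0 (\<bar>r\<bar> + 2) \<Longrightarrow> dist x' x < d b \<Longrightarrow> dist (g' x' b) (g' x b) < e'"
      by metis
    define d0 where "d0 = Min (insert 1 (d ` Basis))"
    have d0: "d0 > 0" "d0 \<le> 1" "\<And>b. b \<in> Basis \<Longrightarrow> d0 \<le> d b"
      using d(1) Min_le[of "insert 1 (d ` Basis)"] by (simp_all add: d0_def del: Min_insert)
    show "\<exists>d>0. \<forall>y'. norm (y' - y) < d \<longrightarrow> norm ((LINT z|lborel. k z * g (y' - z)) - (LINT z|lborel. k z * g (y - z))
            - (LINT z|lborel. k z * g' (y - z) (y' - y))) \<le> e * norm (y' - y)"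
    proof (intro exI conjI allI impI)
      show "d0 > 0" using d0 by simp
      fix y' assume y': "norm (y' - y) < d0"
      define h where "h = y' - y"
      have h: "norm h < d0" using y' by (simp add: h_def)
      define D where "D x = g (x + h) - g x - g' x h" for x
      have D0: "D x = 0" if "norm x > \<bar>r\<bar> + 1" for x
      proof -
        have "norm x \<le> norm (x + h) + norm h"
          using norm_triangle_ineq4[of "x + h" h] by simp
        then have "norm (x + h) > r" "norm x > r" using h d0 that by auto
        then show ?thesis using supp by (simp add: D_def)
      qed
      have De: "\<bar>D x\<bar> \<le> e / (K + 1) * norm h" for x
      proof (cases "norm x > \<bar>r\<bar> + 1")
        case False
        obtain t where t: "0 < t" "t < 1" "g (x + 1 *\<^sub>R h) - g x = 1 * g' (x + t *\<^sub>R h) h"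
          using mean_value_direction[OF g zero_less_one] .
        have th: "norm (t *\<^sub>R h) \<le> norm h" using t by (simp add: mult_left_le_one_le)
        have in_ball: "x + t *\<^sub>R h \<in> cball 0 (\<bar>r\<bar> + 2)" "x \<in> cball 0 (\<bar>r\<bar> + 2)"
          unfolding mem_cball_0 using False h th d0(2) norm_triangle_ineq[of x "t *\<^sub>R h"] by linarith+
        have "D x = (\<Sum>b\<in>Basis. (h \<bullet> b) * (g' (x + t *\<^sub>R h) b - g' x b))"
          using t(3) unfolding expand[of "x + t *\<^sub>R h" h] D_def expand[of x h]
          by (simp add: right_diff_distrib sum_subtractf)
        also have "\<bar>\<dots>\<bar> \<le> (\<Sum>b\<in>(Basis :: 'a set). norm h * e')"
        proof (intro order_trans[OF sum_abs] sum_mono)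
          fix b :: 'a assume b: "b \<in> Basis"
          have "dist (g' (x + t *\<^sub>R h) b) (g' x b) < e'"
            using th h d0(3)[OF b] by (intro d(2)[OF b] in_ball) (simp add: dist_norm)
          then show "\<bar>(h \<bullet> b) * (g' (x + t *\<^sub>R h) b - g' x b)\<bar> \<le> norm h * e'"
            using Basis_le_norm[OF b, of h] by (auto simp: abs_mult dist_real_def intro!: mult_mono)
        qed
        also have "\<dots> = e / (K + 1) * norm h" by (simp add: e'_def)
        finally show ?thesis .
      qed (use D0 e K in auto)
      have meas: "D \<in> borel_measurable borel" unfolding D_def by measurable
      have "(LINT z|lborel. k z * g (y' - z)) - (LINT z|lborel. k z * g (y - z)) - (LINT z|lborel. k z * g' (y - z) (y' - y))
           = (LINT z|lborel. k z * D (y - z))"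
        using int int' by (simp add: D_def h_def right_diff_distrib)
      also have "norm \<dots> \<le> e / (K + 1) * norm h * K"
        unfolding K_def real_norm_def by (rule convolution_estimate[OF k meas D0 De[unfolded K_def]])
      also have "\<dots> \<le> e * norm h" using e K by (simp add: field_simps mult_left_mono)
      finally show "norm ((LINT z|lborel. k z * g (y' - z)) - (LINT z|lborel. k z * g (y - z))
            - (LINT z|lborel. k z * g' (y - z) (y' - y))) \<le> e * norm (y' - y)" by (simp add: h_def)
    qed
  qed
qed

text \<open>The product \<open>k z * g (y - z)\<close> vanishes outside a ball, so its derivative
  along b integrates to 0. The reflection in \<open>y - z\<close> supplies the sign that makes the
  two sides equal.\<close>

lemma convolution_integration_by_parts:
  fixes k g :: "'a::euclidean_space \<Rightarrow> real"
  assumes k: "\<And>x. (k has_derivative k' x) (at x)" and k': "continuous_on UNIV (\<lambda>x. k' x b)"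
    and g: "\<And>x. (g has_derivative g' x) (at x)" and g': "continuous_on UNIV (\<lambda>x. g' x b)"
    and supp: "\<And>x. norm x > r \<Longrightarrow> g x = 0" "\<And>x. norm x > r \<Longrightarrow> g' x b = 0"
  shows "(LINT z|lborel. k z * g' (y - z) b) = (LINT z|lborel. k' z b * g (y - z))"
proof -
  have cont: "continuous_on UNIV g" "continuous_on UNIV k"
    using g k by (auto intro!: has_derivative_continuous_on)
  define F where "F z = k z * g (y - z)" for z
  define F' where "F' z d = k z * g' (y - z) (- d) + k' z d * g (y - z)" for z d
  have ling: "linear (g' x)" for x using g has_derivative_linear by blast
  have F: "(F has_derivative F' z) (at z)" for z
  proof -
    have "((\<lambda>z. y - z) has_derivative (\<lambda>d. - d)) (at z)" by (auto intro!: derivative_eq_intros)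
    from has_derivative_mult[OF k has_derivative_compose[OF this g]]
    show ?thesis unfolding F_def F'_def .
  qed
  have int1: "integrable lborel (\<lambda>z. k z * g' (y - z) b)"
    using integrable_locally_mult[OF locally_integrable_continuous[OF cont(2)] g' supp(2)] .
  have int2: "integrable lborel (\<lambda>z. k' z b * g (y - z))"
    using integrable_locally_mult[OF locally_integrable_continuous[OF k'] cont(1) supp(1)] .
  have F'b: "F' z b = k' z b * g (y - z) - k z * g' (y - z) b" for z
    by (simp add: F'_def linear_neg[OF ling])
  have contF: "continuous_on UNIV (\<lambda>z. F' z b)"
    unfolding F'b by (intro continuous_intros k' cont continuous_on_compose2[OF cont(1)] continuous_on_compose2[OF g']) auto
  define s where "s = norm y + \<bar>r\<bar>"
  have suppF: "F' z b = 0" if "norm z > s" for z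
  proof -
    have "norm (y - z) > r" using that norm_triangle_ineq2[of z y] by (simp add: s_def norm_minus_commute)
    then show ?thesis by (simp add: F'b supp)
  qed
  obtain C where C: "C > 0" "\<And>z. \<bar>F' z b\<bar> \<le> C" using bounded_of_support[OF contF suppF] by metis
  have "(LINT z|lborel. F' z b) = 0"
  proof (rule integral_directional_derivative_eq_0[OF F])
    show "integrable lborel F"
      unfolding F_def using integrable_locally_mult[OF locally_integrable_continuous[OF cont(2)] cont(1) supp(1)] .
    \<comment> \<open>The bound must hold along the whole segment of directions
      \<open>t *\<^sub>R b\<close>, so the supporting ball is enlarged by
      \<open>norm b\<close>.\<close>
    have "emeasure lborel (cball (0::'a) (s + norm b)) < \<infinity>" by (rule emeasure_lborel_cball_finite)
    then show "integrable lborel (\<lambda>z::'a. C * indicator (cball 0 (s + norm b)) z)"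
      by (intro integrable_mult_right integrable_real_indicator) auto
    fix z :: 'a and t :: real assume t: "\<bar>t\<bar> \<le> 1"
    show "\<bar>F' (z + t *\<^sub>R b) b\<bar> \<le> C * indicator (cball 0 (s + norm b)) z"
    proof (cases "norm z \<le> s + norm b")
      case False
      have "norm (t *\<^sub>R b) \<le> norm b" using t by (simp add: mult_left_le_one_le)
      then have "norm (z + t *\<^sub>R b) > s" using False norm_triangle_ineq2[of z "- (t *\<^sub>R b)"] by simp
      then show ?thesis using suppF C by simp
    qed (use C in auto)
  qed
  then show ?thesis using int1 int2 by (simp add: F'b)
qed

section \<open>Harmonic polynomials\<close>

text \<open>The Frechet derivative gives linearity in the direction and the chain rule at once; on
  polynomials it agrees with the partial derivatives of the problem
  (\<open>partial_deriv_eq_dir_deriv\<close>).\<close>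

definition dir_deriv :: "'a::euclidean_space \<Rightarrow> ('a \<Rightarrow> real) \<Rightarrow> 'a \<Rightarrow> real" where
  "dir_deriv c h x = frechet_derivative h (at x) c"

definition grad :: "('a::euclidean_space \<Rightarrow> real) \<Rightarrow> 'a \<Rightarrow> 'a" where
  "grad h x = (\<Sum>b\<in>Basis. dir_deriv b h x *\<^sub>R b)"

text \<open>The Hessian as an operator on vectors, ready to be composed with reflections;
  \<open>inner_hess\<close> recovers the bilinear form.\<close>

definition hess :: "('a::euclidean_space \<Rightarrow> real) \<Rightarrow> 'a \<Rightarrow> 'a \<Rightarrow> 'a" where
  "hess h x d = (\<Sum>b\<in>Basis. dir_deriv d (dir_deriv b h) x *\<^sub>R b)"

lemma dir_deriv_eqI: "(h has_derivative h') (at x) \<Longrightarrow> dir_deriv c h x = h' c"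
  using frechet_derivative_at[of h h' x] by (simp add: dir_deriv_def)

lemma has_derivative_dir_deriv:
  assumes "real_polynomial_function h"
  shows "(h has_derivative (\<lambda>d. dir_deriv d h x)) (at x)"
  using differentiable_at_real_polynomial_function[OF assms, of x UNIV]
  by (simp add: dir_deriv_def frechet_derivative_works)

lemma linear_dir_deriv: "real_polynomial_function h \<Longrightarrow> linear (\<lambda>d. dir_deriv d h x)"
  using has_derivative_dir_deriv has_derivative_linear by blast

lemma dir_deriv_linear: "bounded_linear f \<Longrightarrow> dir_deriv c f x = f c"
  using dir_deriv_eqI bounded_linear_imp_has_derivative by blast

lemma dir_deriv_const: "dir_deriv c (\<lambda>x. a) x = 0"
  by (rule dir_deriv_eqI[OF has_derivative_const])

lemma dir_deriv_add:
  assumes "real_polynomial_function f" "real_polynomial_function g"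
  shows "dir_deriv c (\<lambda>x. f x + g x) x = dir_deriv c f x + dir_deriv c g x"
  by (rule dir_deriv_eqI[OF has_derivative_add[OF assms[THEN has_derivative_dir_deriv]]])

lemma dir_deriv_mult:
  assumes "real_polynomial_function f" "real_polynomial_function g"
  shows "dir_deriv c (\<lambda>x. f x * g x) x = f x * dir_deriv c g x + dir_deriv c f x * g x"
  by (rule dir_deriv_eqI[OF has_derivative_mult[OF assms[THEN has_derivative_dir_deriv]]])

lemma real_polynomial_function_dir_deriv [intro]:
  assumes "real_polynomial_function h"
  shows "real_polynomial_function (dir_deriv c h)"
  using assms
proof induction
  case (linear f)
  then have "dir_deriv c f = (\<lambda>x. f c)" by (auto simp: dir_deriv_linear)
  then show ?case by auto
next
  case (const a)
  have "dir_deriv c (\<lambda>x. a) = (\<lambda>x::'a. 0)" by (auto simp: dir_deriv_const)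
  then show ?case by auto
next
  case (add f g)
  then have "dir_deriv c (\<lambda>x. f x + g x) = (\<lambda>x. dir_deriv c f x + dir_deriv c g x)"
    by (auto simp: dir_deriv_add)
  then show ?case using add by auto
next
  case (mult f g)
  then have "dir_deriv c (\<lambda>x. f x * g x) = (\<lambda>x. f x * dir_deriv c g x + dir_deriv c f x * g x)"
    by (auto simp: dir_deriv_mult)
  then show ?case using mult by auto
qed

text \<open>Structural induction replaces the analytic theorem on mixed derivatives: on a product,
  both orders expand by the Leibniz rule into the same four terms.\<close>

lemma dir_deriv_commute:
  assumes "real_polynomial_function h"
  shows "dir_deriv c (dir_deriv d h) = dir_deriv d (dir_deriv c h)"
  using assms
proof induction
  case (linear f)
  then have "dir_deriv c f = (\<lambda>x. f c)" for c by (auto simp: dir_deriv_linear)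
  then show ?case by (simp add: dir_deriv_const fun_eq_iff)
next
  case (const a)
  have "dir_deriv c (\<lambda>x. a) = (\<lambda>x::'a. 0)" for c by (auto simp: dir_deriv_const)
  then show ?case by (simp add: dir_deriv_const fun_eq_iff)
next
  case (add f g)
  then have "dir_deriv c (\<lambda>x. f x + g x) = (\<lambda>x. dir_deriv c f x + dir_deriv c g x)" for c
    by (auto simp: dir_deriv_add)
  then show ?case using add by (simp add: fun_eq_iff dir_deriv_add real_polynomial_function_dir_deriv)
next
  case (mult f g)
  then have "dir_deriv c (\<lambda>x. f x * g x) = (\<lambda>x. f x * dir_deriv c g x + dir_deriv c f x * g x)" for c
    by (auto simp: dir_deriv_mult)
  then show ?case using mult
    by (simp add: fun_eq_iff dir_deriv_add dir_deriv_mult real_polynomial_function_dir_deriv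
        real_polynomial_function.intros algebra_simps)
qed

lemma inner_grad:
  assumes "real_polynomial_function h"
  shows "grad h x \<bullet> d = dir_deriv d h x"
proof -
  have "dir_deriv d h x = dir_deriv (\<Sum>b\<in>Basis. (d \<bullet> b) *\<^sub>R b) h x"
    by (simp only: euclidean_representation)
  also have "\<dots> = (\<Sum>b\<in>Basis. (d \<bullet> b) * dir_deriv b h x)"
    by (simp only: linear_sum[OF linear_dir_deriv[OF assms]] linear_scale[OF linear_dir_deriv[OF assms]] real_scaleR_def)
  also have "\<dots> = grad h x \<bullet> d"
    by (simp add: grad_def inner_sum_left inner_commute[of d] mult.commute)
  finally show ?thesis by simp
qed

lemma has_derivative_grad_inner:
  assumes "real_polynomial_function h"
  shows "(h has_derivative (\<lambda>d. grad h x \<bullet> d)) (at x)"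
  using has_derivative_dir_deriv[OF assms, of x] by (simp add: inner_grad[OF assms])

lemma has_derivative_grad:
  assumes "real_polynomial_function h"
  shows "(grad h has_derivative hess h x) (at x)"
  unfolding grad_def[abs_def] hess_def
  by (intro has_derivative_sum has_derivative_scaleR_left has_derivative_dir_deriv
      real_polynomial_function_dir_deriv assms)

lemma linear_hess: "real_polynomial_function h \<Longrightarrow> linear (hess h x)"
  using has_derivative_grad has_derivative_linear by blast

lemma inner_hess:
  assumes "real_polynomial_function h"
  shows "hess h x d \<bullet> e = dir_deriv d (dir_deriv e h) x"
proof -
  have "hess h x d \<bullet> e = grad (dir_deriv d h) x \<bullet> e"
    by (simp add: hess_def grad_def dir_deriv_commute[OF assms, of d])
  also have "\<dots> = dir_deriv e (dir_deriv d h) x"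
    by (intro inner_grad real_polynomial_function_dir_deriv assms)
  finally show ?thesis by (simp add: dir_deriv_commute[OF assms, of d])
qed

lemma hess_symmetric:
  assumes "real_polynomial_function h"
  shows "hess h x d \<bullet> e = d \<bullet> hess h x e"
  by (simp add: inner_hess[OF assms] inner_commute[of d] dir_deriv_commute[OF assms, of d])

lemma grad_dir_deriv:
  assumes "real_polynomial_function h"
  shows "grad (dir_deriv c h) x = hess h x c"
  by (simp add: hess_def grad_def dir_deriv_commute[OF assms, of c])

lemma continuous_on_real_polynomial_function:
  "real_polynomial_function h \<Longrightarrow> continuous_on S h"
  by (simp add: real_polynomial_function_eq continuous_on_polymonial_function)

lemma hess_eq_sum:
  assumes "real_polynomial_function h"
  shows "hess h x d = (\<Sum>b\<in>Basis. (d \<bullet> b) *\<^sub>R hess h x b)"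
  using linear_sum[OF linear_hess[OF assms, of x], of "\<lambda>b. (d \<bullet> b) *\<^sub>R b" Basis]
  by (simp add: euclidean_representation linear_scale[OF linear_hess[OF assms]])

lemma real_polynomial_function_composition:
  assumes "real_polynomial_function h" "\<And>b. b \<in> Basis \<Longrightarrow> real_polynomial_function (\<lambda>x. g x \<bullet> b)"
  shows "real_polynomial_function (\<lambda>x. h (g x))"
  using real_polynomial_function_compose[OF _ assms(1), of g] assms(2)
  by (simp add: polynomial_function_iff_Basis_inner o_def)

lemma real_polynomial_function_grad_inner:
  "real_polynomial_function h \<Longrightarrow> real_polynomial_function (\<lambda>x. grad h x \<bullet> d)"
  using real_polynomial_function_dir_deriv[of h d] by (simp add: inner_grad)

lemma partial_deriv_eqI:
  assumes "\<And>x. (g has_derivative g' x) (at x)"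
  shows "partial_deriv b g x = g' x b"
  unfolding partial_deriv_def
  using DERIV_imp_deriv[OF has_derivative_at_direction[OF assms, of x b 0]] by simp

lemma partial_deriv_eq_dir_deriv:
  "real_polynomial_function h \<Longrightarrow> partial_deriv b h = dir_deriv b h"
  using partial_deriv_eqI[OF has_derivative_dir_deriv] by blast

lemma laplacian_real_polynomial_function:
  assumes "real_polynomial_function h"
  shows "laplacian h x = (\<Sum>b\<in>Basis. dir_deriv b (dir_deriv b h) x)"
  by (simp add: laplacian_def partial_deriv_eq_dir_deriv assms real_polynomial_function_dir_deriv)

section \<open>Homogeneity, Euler identities and the trace condition\<close>

lemma
  assumes "h \<in> harmonic_polys k"
  shows harmonic_polys_poly: "real_polynomial_function h"
    and harmonic_polys_homogeneous: "h (t *\<^sub>R u) = t ^ k * h u"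
    and harmonic_polys_trace: "(\<Sum>b\<in>Basis. dir_deriv b (dir_deriv b h) x) = 0"
  using assms by (auto simp: harmonic_polys_def laplacian_real_polynomial_function)

text \<open>Homogeneity differentiated in u. Keeping the factor t on the left avoids the exponent k
  - 1 and includes t = 0.\<close>

lemma dir_deriv_scaled:
  assumes "h \<in> harmonic_polys k"
  shows "t * dir_deriv c h (t *\<^sub>R u) = t ^ k * dir_deriv c h u"
proof -
  note p = harmonic_polys_poly[OF assms]
  have "((\<lambda>u. t *\<^sub>R u) has_derivative (\<lambda>d. t *\<^sub>R d)) (at u)"
    by (auto intro!: derivative_eq_intros)
  from has_derivative_compose[OF this has_derivative_dir_deriv[OF p]]
  have "((\<lambda>u. h (t *\<^sub>R u)) has_derivative (\<lambda>d. dir_deriv (t *\<^sub>R d) h (t *\<^sub>R u))) (at u)" .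
  moreover have "((\<lambda>u. t ^ k * h u) has_derivative (\<lambda>d. t ^ k * dir_deriv d h u)) (at u)"
    by (rule has_derivative_mult_right[OF has_derivative_dir_deriv[OF p]])
  ultimately have "(\<lambda>d. dir_deriv (t *\<^sub>R d) h (t *\<^sub>R u)) = (\<lambda>d. t ^ k * dir_deriv d h u)"
    by (auto simp: harmonic_polys_homogeneous[OF assms] intro: has_derivative_unique)
  from fun_cong[OF this, of c] show ?thesis
    by (simp add: linear_scale[OF linear_dir_deriv[OF p]])
qed

text \<open>At t = 0 the scaling law has left side 0, while \<open>0 ^ 0 = 1\<close> leaves the bare
  derivative on the right.\<close>

lemma dir_deriv_degree_0:
  assumes "h \<in> harmonic_polys 0"
  shows "dir_deriv c h u = 0"
  using dir_deriv_scaled[OF assms, of 0 c u] by simp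

text \<open>With truncated subtraction the derivative of a constant lands in degree \<open>0\<close>, which is
  harmless because it vanishes.\<close>

lemma dir_deriv_harmonic:
  assumes h: "h \<in> harmonic_polys k"
  shows "dir_deriv c h \<in> harmonic_polys (k - 1)"
proof -
  note p = harmonic_polys_poly[OF h]
  note pp = real_polynomial_function_dir_deriv[OF p]
  have hom: "dir_deriv c h (t *\<^sub>R u) = t ^ (k - 1) * dir_deriv c h u" for t u
  proof (cases "k = 0")
    case True
    then show ?thesis using h by (simp add: dir_deriv_degree_0)
  next
    case False
    then have eq: "dir_deriv c h (t *\<^sub>R u) = t ^ (k - 1) * dir_deriv c h u" if "t \<noteq> 0" for t
      using dir_deriv_scaled[OF h, of t c u] that by (cases k) auto
    \<comment> \<open>Division by t settles only t \<noteq> 0. The difference \<open>p1\<close> of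
      the two sides is continuous and vanishes off 0, hence also at 0.\<close>
    define p1 where "p1 t = dir_deriv c h (t *\<^sub>R u) - t ^ (k - 1) * dir_deriv c h u" for t
    have "isCont (\<lambda>t. dir_deriv c h (t *\<^sub>R u)) t" for t
      using has_derivative_at_direction[of "dir_deriv c h" _ 0 u t, OF has_derivative_dir_deriv[OF pp]]
        DERIV_isCont by auto
    then have "isCont p1 0" unfolding p1_def by (intro continuous_intros)
    moreover have "(p1 \<longlongrightarrow> 0) (at 0)"
      by (rule Lim_transform_eventually[OF tendsto_const])
         (auto simp: p1_def eq eventually_at_filter)
    ultimately have "p1 0 = 0" using LIM_unique[of p1 "p1 0" 0 0] by (simp add: isCont_def)
    then show ?thesis using eq by (cases "t = 0") (auto simp: p1_def)
  qed
  have "(\<Sum>b\<in>Basis. dir_deriv b (dir_deriv b (dir_deriv c h)) x) = 0" for x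
  proof -
    have "dir_deriv b (dir_deriv b (dir_deriv c h)) = dir_deriv c (dir_deriv b (dir_deriv b h))" for b
      by (simp only: dir_deriv_commute[OF p, of b c] dir_deriv_commute[OF real_polynomial_function_dir_deriv[OF p], of b c])
    then have "(\<Sum>b\<in>Basis. dir_deriv b (dir_deriv b (dir_deriv c h)) x)
        = (\<Sum>b\<in>Basis. dir_deriv c (dir_deriv b (dir_deriv b h)) x)" by simp
    also have "\<dots> = dir_deriv c (\<lambda>x. \<Sum>b\<in>Basis. dir_deriv b (dir_deriv b h) x) x"
      by (rule dir_deriv_eqI[symmetric], rule has_derivative_sum)
         (intro has_derivative_dir_deriv real_polynomial_function_dir_deriv p)
    also have "\<dots> = 0" by (simp add: harmonic_polys_trace[OF h] dir_deriv_const)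
    finally show ?thesis .
  qed
  with hom pp show ?thesis
    by (auto simp: harmonic_polys_def laplacian_real_polynomial_function)
qed

text \<open>Differentiate t \<mapsto> h (t u) at t = 1 directly and by homogeneity.\<close>

lemma euler_harmonic:
  assumes "h \<in> harmonic_polys k"
  shows "dir_deriv u h u = real k * h u"
proof -
  note p = harmonic_polys_poly[OF assms]
  have "((\<lambda>t. h (0 + t *\<^sub>R u)) has_real_derivative dir_deriv u h (0 + 1 *\<^sub>R u)) (at 1)"
    by (rule has_derivative_at_direction[OF has_derivative_dir_deriv[OF p]])
  moreover have "((\<lambda>t. t ^ k * h u) has_real_derivative real k * h u) (at 1)"
    by (auto intro!: derivative_eq_intros)
  ultimately show ?thesis
    by (auto simp: harmonic_polys_homogeneous[OF assms] intro: DERIV_unique)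
qed

text \<open>Euler's identity for the components of the gradient, of degree k - 1. The subtraction is
  in the reals, which is correct for k = 0 too because the gradient is then 0.\<close>

lemma euler_grad:
  assumes "h \<in> harmonic_polys k"
  shows "hess h u u = (real k - 1) *\<^sub>R grad h u"
proof (rule euclidean_eqI)
  fix b :: 'a assume "b \<in> Basis"
  note p = harmonic_polys_poly[OF assms]
  have "dir_deriv u (dir_deriv b h) u = real (k - 1) * dir_deriv b h u"
    by (rule euler_harmonic[OF dir_deriv_harmonic[OF assms]])
  then show "hess h u u \<bullet> b = ((real k - 1) *\<^sub>R grad h u) \<bullet> b"
    using dir_deriv_degree_0[of h b u] assms
    by (cases k) (simp_all add: inner_hess[OF p] inner_grad[OF p])
qed

lemma hess_trace:
  assumes "h \<in> harmonic_polys k"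
  shows "(\<Sum>b\<in>Basis. hess h x b \<bullet> b) = 0"
  using harmonic_polys_trace[OF assms, of x] by (simp add: inner_hess[OF harmonic_polys_poly[OF assms]])

section \<open>Harmonic polynomials under linear combinations and self-adjoint substitutions\<close>

lemma harmonic_polys_add:
  assumes "f \<in> harmonic_polys k" "g \<in> harmonic_polys k"
  shows "(\<lambda>x. f x + g x) \<in> harmonic_polys k"
proof -
  note p = assms[THEN harmonic_polys_poly]
  have "dir_deriv b (\<lambda>x. f x + g x) = (\<lambda>x. dir_deriv b f x + dir_deriv b g x)" for b
    using p by (auto simp: dir_deriv_add)
  then have "(\<Sum>b\<in>Basis. dir_deriv b (dir_deriv b (\<lambda>x. f x + g x)) x) = 0" for x
    using p assms[THEN harmonic_polys_trace]
    by (simp add: dir_deriv_add real_polynomial_function_dir_deriv sum.distrib)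
  then show ?thesis using p assms[THEN harmonic_polys_homogeneous]
    by (auto simp: harmonic_polys_def laplacian_real_polynomial_function algebra_simps real_polynomial_function.intros)
qed

lemma harmonic_polys_cmult:
  assumes "f \<in> harmonic_polys k"
  shows "(\<lambda>x. c * f x) \<in> harmonic_polys k"
proof -
  note p = harmonic_polys_poly[OF assms]
  have "dir_deriv b (\<lambda>x. c * f x) = (\<lambda>x. c * dir_deriv b f x)" if "real_polynomial_function f" for b and f :: "'a \<Rightarrow> real"
    by (rule ext, rule dir_deriv_eqI[OF has_derivative_mult_right[OF has_derivative_dir_deriv[OF that]]])
  then have "(\<Sum>b\<in>Basis. dir_deriv b (dir_deriv b (\<lambda>x. c * f x)) x) = 0" for x
    using p harmonic_polys_trace[OF assms]
    by (simp add: real_polynomial_function_dir_deriv sum_distrib_left[symmetric])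
  moreover have "real_polynomial_function (\<lambda>x. c * f x)" using p by auto
  ultimately show ?thesis using p harmonic_polys_homogeneous[OF assms]
    by (auto simp: harmonic_polys_def laplacian_real_polynomial_function algebra_simps)
qed

lemma harmonic_polys_0: "(\<lambda>x. 0) \<in> harmonic_polys k"
proof -
  have "dir_deriv c (\<lambda>x. 0) = (\<lambda>x::'a. 0)" for c by (auto simp: dir_deriv_const)
  moreover have "real_polynomial_function (\<lambda>x::'a. 0)" by auto
  ultimately show ?thesis
    by (simp add: harmonic_polys_def laplacian_real_polynomial_function)
qed

lemma harmonic_polys_sum:
  assumes "\<And>i. i \<in> I \<Longrightarrow> f i \<in> harmonic_polys k"
  shows "(\<lambda>x. \<Sum>i\<in>I. c i * f i x) \<in> harmonic_polys k"
  using assms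
proof (induction I rule: infinite_finite_induct)
  case (insert i I)
  then have "(\<lambda>x. c i * f i x + (\<Sum>i\<in>I. c i * f i x)) \<in> harmonic_polys k"
    by (intro harmonic_polys_add harmonic_polys_cmult) auto
  then show ?case using insert by simp
qed (simp_all add: harmonic_polys_0)

lemma
  assumes h: "real_polynomial_function h" and L: "linear L" and adj: "\<And>x y. L x \<bullet> y = x \<bullet> L y"
  shows grad_compose_selfadjoint: "grad (\<lambda>x. h (L x)) x = L (grad h (L x))"
    and hess_compose_selfadjoint: "hess (\<lambda>x. h (L x)) x d = L (hess h (L x) (L d))"
    and real_polynomial_function_compose_linear: "real_polynomial_function (\<lambda>x. h (L x))"
proof -
  have bl: "bounded_linear L" using L by (simp add: linear_conv_bounded_linear)
  show poly: "real_polynomial_function (\<lambda>x. h (L x))"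
    by (rule real_polynomial_function_composition[OF h])
       (auto intro!: real_polynomial_function.intros(1) bounded_linear_intros bl)
  have grad: "grad (\<lambda>x. h (L x)) x = L (grad h (L x))" for x
  proof -
    have "((\<lambda>x. h (L x)) has_derivative (\<lambda>d. grad h (L x) \<bullet> L d)) (at x)"
      by (rule has_derivative_compose[OF bounded_linear_imp_has_derivative[OF bl] has_derivative_grad_inner[OF h]])
    then have "dir_deriv d (\<lambda>x. h (L x)) x = L (grad h (L x)) \<bullet> d" for d
      by (simp add: dir_deriv_eqI adj)
    then have "grad (\<lambda>x. h (L x)) x \<bullet> d = L (grad h (L x)) \<bullet> d" for d
      by (simp only: inner_grad[OF poly])
    then show ?thesis by (blast intro: euclidean_eqI)
  qed
  show "grad (\<lambda>x. h (L x)) x = L (grad h (L x))" by (rule grad)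
  have "((\<lambda>x. L (grad h (L x))) has_derivative (\<lambda>d. L (hess h (L x) (L d)))) (at x)"
    by (intro bounded_linear.has_derivative[OF bl] has_derivative_compose[OF bounded_linear_imp_has_derivative[OF bl]]
        has_derivative_grad[OF h])
  moreover have "((\<lambda>x. L (grad h (L x))) has_derivative hess (\<lambda>x. h (L x)) x) (at x)"
    using has_derivative_grad[OF poly] by (simp add: grad[symmetric])
  ultimately show "hess (\<lambda>x. h (L x)) x d = L (hess h (L x) (L d))"
    by (metis has_derivative_unique)
qed

text \<open>With A the Hessian, the Laplacian of the composite is the trace of L A L, which equals
  the trace of A L^2 and hence c times the trace of A, that is 0. The case c = 1 is a reflection, c
  = |z|^4 the scaled reflection \<open>srefl z\<close>.\<close>

lemma harmonic_compose_selfadjoint: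
  assumes h: "h \<in> harmonic_polys k" and L: "linear L" and adj: "\<And>x y. L x \<bullet> y = x \<bullet> L y"
    and sq: "\<And>x. L (L x) = c *\<^sub>R x"
  shows "(\<lambda>x. h (L x)) \<in> harmonic_polys k"
proof -
  note p = harmonic_polys_poly[OF h]
  note pL = real_polynomial_function_compose_linear[OF p L adj]
  have "(\<Sum>b\<in>Basis. hess (\<lambda>x. h (L x)) x b \<bullet> b) = 0" for x
  proof -
    define A where "A = hess h (L x)"
    have A: "linear A" unfolding A_def by (rule linear_hess[OF p])
    have ex: "L b = (\<Sum>e\<in>Basis. (b \<bullet> L e) *\<^sub>R e)" for b
      using euclidean_representation[of "L b"] by (simp add: adj)
    have "(\<Sum>b\<in>Basis. hess (\<lambda>x. h (L x)) x b \<bullet> b) = (\<Sum>b\<in>Basis. A (L b) \<bullet> L b)"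
      by (simp add: hess_compose_selfadjoint[OF p L adj] A_def adj)
    also have "\<dots> = (\<Sum>b\<in>Basis. \<Sum>e\<in>Basis. (b \<bullet> L e) * (A e \<bullet> L b))"
      by (subst ex) (simp add: linear_sum[OF A] linear_scale[OF A] inner_sum_left)
    also have "\<dots> = (\<Sum>e\<in>Basis. \<Sum>b\<in>Basis. (L e \<bullet> b) * (L (A e) \<bullet> b))"
    proof (subst sum.swap, intro sum.cong refl)
      fix b e :: 'a
      show "(b \<bullet> L e) * (A e \<bullet> L b) = (L e \<bullet> b) * (L (A e) \<bullet> b)"
        by (simp only: adj[of "A e" b] inner_commute[of b])
    qed
    also have "\<dots> = (\<Sum>e\<in>Basis. L e \<bullet> L (A e))"
      by (subst (3) euclidean_inner) (simp add: mult.commute)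
    also have "\<dots> = c * (\<Sum>e\<in>Basis. A e \<bullet> e)"
      by (simp add: adj sq sum_distrib_left inner_commute)
    also have "\<dots> = 0" using hess_trace[OF h] by (simp add: A_def)
    finally show ?thesis .
  qed
  then have "(\<Sum>b\<in>Basis. dir_deriv b (dir_deriv b (\<lambda>x. h (L x))) x) = 0" for x
    by (simp add: inner_hess[OF pL])
  then show ?thesis
    using pL harmonic_polys_homogeneous[OF h]
    by (auto simp: harmonic_polys_def laplacian_real_polynomial_function[OF pL] linear_scale[OF L])
qed

section \<open>Interpolation\<close>

text \<open>Lagrange interpolation: evaluations at suitable points of a separating set form a dual basis.
  The induction splits off a function \<open>g\<close> with \<open>g u0 \<noteq> 0\<close> and passes to the functions vanishing at
  \<open>u0\<close>.\<close>

lemma interpolation_basis: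
  fixes V :: "('x \<Rightarrow> real) set" and \<phi> :: "'i \<Rightarrow> 'x \<Rightarrow> real"
  assumes "finite I" "\<And>h. h \<in> V \<Longrightarrow> \<exists>c. \<forall>x. h x = (\<Sum>i\<in>I. c i * \<phi> i x)"
    and "\<And>f g. f \<in> V \<Longrightarrow> g \<in> V \<Longrightarrow> (\<lambda>x. f x + g x) \<in> V"
    and "\<And>f a. f \<in> V \<Longrightarrow> (\<lambda>x. a * f x) \<in> V"
    and "\<And>h x. h \<in> V \<Longrightarrow> (\<And>u. u \<in> S \<Longrightarrow> h u = 0) \<Longrightarrow> h x = 0"
  shows "\<exists>U e. finite U \<and> U \<subseteq> S \<and> (\<forall>u\<in>U. e u \<in> V) \<and> (\<forall>h\<in>V. \<forall>x. h x = (\<Sum>u\<in>U. h u * e u x))"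
  using assms
proof (induction "card I" arbitrary: I V \<phi> rule: less_induct)
  case less
  note span = less.prems(2) and add = less.prems(3) and scale = less.prems(4) and sep = less.prems(5)
  show ?case
  proof (cases "\<exists>g\<in>V. \<exists>x. g x \<noteq> 0")
    case False
    then show ?thesis by (intro exI[of _ "{}"]) auto
  next
    case True
    then obtain g where g: "g \<in> V" "\<exists>x. g x \<noteq> 0" by blast
    then obtain u0 where u0: "u0 \<in> S" "g u0 \<noteq> 0" using sep by blast
    obtain c where c: "\<And>x. g x = (\<Sum>i\<in>I. c i * \<phi> i x)" using span[OF g(1)] by blast
    have "\<exists>i\<in>I. c i \<noteq> 0" using u0(2) c[of u0] by (metis (no_types, lifting) mult_zero_left sum.neutral)
    then obtain i0 where i0: "i0 \<in> I" "c i0 \<noteq> 0" by blast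
    define V0 where "V0 = {h \<in> V. h u0 = 0}"
    \<comment> \<open>The projections \<psi> i of the spanning functions vanish at \<open>u0\<close>
      and satisfy \<Sum> c i \<psi> i = 0. Since \<open>c i0\<close> is nonzero, \<psi> i0 can be
      eliminated, so V0 is spanned by fewer functions.\<close>
    define \<psi> where "\<psi> i x = \<phi> i x - \<phi> i u0 / g u0 * g x" for i x
    have proj: "(\<Sum>i\<in>I. d i * \<psi> i x) = (\<Sum>i\<in>I. d i * \<phi> i x) - (\<Sum>i\<in>I. d i * \<phi> i u0) / g u0 * g x" for d x
      by (simp add: \<psi>_def right_diff_distrib sum_subtractf sum_divide_distrib sum_distrib_right mult.assoc)
    have card: "card (I - {i0}) < card I" using i0 less.prems(1) by (intro card_Diff1_less)
    have "\<exists>U e. finite U \<and> U \<subseteq> S \<and> (\<forall>u\<in>U. e u \<in> V0) \<and> (\<forall>h\<in>V0. \<forall>x. h x = (\<Sum>u\<in>U. h u * e u x))"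
    proof (rule less.hyps[OF card, of V0 \<psi>])
      fix h assume h: "h \<in> V0"
      then obtain d where d: "\<And>x. h x = (\<Sum>i\<in>I. d i * \<phi> i x)" using span[of h] by (auto simp: V0_def)
      have "h x = (\<Sum>i\<in>I - {i0}. (d i - d i0 / c i0 * c i) * \<psi> i x)" for x
      proof -
        have "(\<Sum>i\<in>I. d i * \<psi> i x) = h x" using h by (simp add: proj d[symmetric] V0_def)
        moreover have "(\<Sum>i\<in>I. c i * \<psi> i x) = 0" using u0 by (simp add: proj c[symmetric])
        ultimately have "h x = (\<Sum>i\<in>I. d i * \<psi> i x) - d i0 / c i0 * (\<Sum>i\<in>I. c i * \<psi> i x)" by simp
        also have "\<dots> = (\<Sum>i\<in>I. (d i - d i0 / c i0 * c i) * \<psi> i x)"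
          by (simp add: left_diff_distrib sum_subtractf sum_distrib_left mult.assoc)
        also have "\<dots> = (\<Sum>i\<in>I - {i0}. (d i - d i0 / c i0 * c i) * \<psi> i x)"
          using i0 less.prems(1) by (simp add: sum.remove)
        finally show ?thesis .
      qed
      then show "\<exists>c. \<forall>x. h x = (\<Sum>i\<in>I - {i0}. c i * \<psi> i x)"
        by (auto intro: exI[of _ "\<lambda>i. d i - d i0 / c i0 * c i"])
    next
      fix h x assume "h \<in> V0" "\<And>u. u \<in> S \<Longrightarrow> h u = 0"
      then show "h x = 0" using sep[of h x] by (auto simp: V0_def)
    qed (use less.prems(1) add scale in \<open>auto simp: V0_def\<close>)
    then obtain U e where U: "finite U" "U \<subseteq> S" "\<And>u. u \<in> U \<Longrightarrow> e u \<in> V0"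
      "\<And>h x. h \<in> V0 \<Longrightarrow> h x = (\<Sum>u\<in>U. h u * e u x)" by blast
    define U' where "U' = U - {u0}"
    define e' where "e' u = (if u = u0 then (\<lambda>x. 1 / g u0 * (g x + - 1 * (\<Sum>u\<in>U'. g u * e u x))) else e u)" for u
    have U': "finite U'" "u0 \<notin> U'" using U by (auto simp: U'_def)
    have zero: "(\<lambda>x. 0) \<in> V" using scale[OF g(1), of 0] by simp
    have sumV: "(\<lambda>x. \<Sum>u\<in>W. d u * e u x) \<in> V" if "finite W" "W \<subseteq> U" for W d
      using that
    proof (induction rule: finite_induct)
      case (insert u W)
      have "(\<lambda>x. d u * e u x + (\<Sum>u\<in>W. d u * e u x)) \<in> V"
        using insert U(3) by (intro add scale) (auto simp: V0_def)
      then show ?case using insert by simp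
    qed (simp add: zero)
    have "e' u \<in> V" if "u \<in> insert u0 U'" for u
    proof (cases "u = u0")
      case True
      have "(\<lambda>x. 1 / g u0 * (g x + - 1 * (\<Sum>u\<in>U'. g u * e u x))) \<in> V"
        by (rule scale, rule add[OF g(1)], rule scale, rule sumV) (use U' in \<open>auto simp: U'_def\<close>)
      then show ?thesis using True by (simp add: e'_def)
    next
      case False
      then show ?thesis using that U(3) by (auto simp: e'_def U'_def V0_def)
    qed
    moreover have "h x = (\<Sum>u\<in>insert u0 U'. h u * e' u x)" if h: "h \<in> V" for h x
    proof -
      define r where "r = h u0 / g u0"
      have "(\<lambda>x. h x + - r * g x) \<in> V" by (intro add scale h g(1))
      then have "(\<lambda>x. h x + - r * g x) \<in> V0" using u0 by (simp add: V0_def r_def)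
      from U(4)[OF this, of x] have "h x - r * g x = (\<Sum>u\<in>U. (h u - r * g u) * e u x)" by simp
      also have "\<dots> = (\<Sum>u\<in>U'. (h u - r * g u) * e u x)"
        unfolding U'_def using U(1) u0 by (intro sum.mono_neutral_right) (auto simp: r_def)
      finally have "h x = r * g x + (\<Sum>u\<in>U'. h u * e u x) - r * (\<Sum>u\<in>U'. g u * e u x)"
        by (simp add: left_diff_distrib sum_subtractf sum_distrib_left mult.assoc)
      moreover have "(\<Sum>u\<in>insert u0 U'. h u * e' u x)
          = h u0 * (1 / g u0 * (g x + - 1 * (\<Sum>u\<in>U'. g u * e u x))) + (\<Sum>u\<in>U'. h u * e u x)"
        using U' by (subst sum.insert) (auto simp: e'_def intro!: sum.cong)
      ultimately show ?thesis by (simp add: r_def algebra_simps)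
    qed
    moreover have "finite (insert u0 U')" "insert u0 U' \<subseteq> S" using U u0 U' by (auto simp: U'_def)
    ultimately show ?thesis by blast
  qed
qed

section \<open>Homogeneous polynomials lie in the span of finitely many monomials\<close>

lemma sum_list_concat_map:
  "sum_list (concat (map f xs)) = sum_list (map (\<lambda>x. sum_list (f x)) xs)"
  by (induction xs) auto

text \<open>A monomial is encoded as a list of basis vectors and a polynomial as a list of terms, in
  which monomials may repeat; multiplication is then concatenation, without collecting
  terms.\<close>

lemma real_polynomial_function_monomials:
  fixes h :: "'a::euclidean_space \<Rightarrow> real"
  assumes "real_polynomial_function h"
  shows "\<exists>ps :: (real \<times> 'a list) list. (\<forall>p\<in>set ps. set (snd p) \<subseteq> Basis) \<and>
    (\<forall>x. h x = (\<Sum>p\<leftarrow>ps. fst p * (\<Prod>b\<leftarrow>snd p. x \<bullet> b)))"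
  using assms
proof induction
  case (linear f)
  interpret bounded_linear f by fact
  obtain bs :: "'a list" where bs: "set bs = Basis" "distinct bs"
    using finite_distinct_list[OF finite_Basis] by blast
  have eq: "f x = (\<Sum>p\<leftarrow>map (\<lambda>b. (f b, [b])) bs. fst p * (\<Prod>b\<leftarrow>snd p. x \<bullet> b))" for x
  proof -
    have "f x = f (\<Sum>b\<in>Basis. (x \<bullet> b) *\<^sub>R b)" by (simp only: euclidean_representation)
    also have "\<dots> = (\<Sum>b\<in>Basis. f b * (x \<bullet> b))" by (simp only: sum scaleR real_scaleR_def mult.commute)
    finally show ?thesis
      using bs by (simp add: o_def sum_list_distinct_conv_sum_set)
  qed
  have "\<forall>p\<in>set (map (\<lambda>b. (f b, [b])) bs). set (snd p) \<subseteq> Basis" using bs by auto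
  with eq show ?case by (intro exI[of _ "map (\<lambda>b. (f b, [b])) bs"] conjI allI)
next
  case (const c)
  show ?case by (intro exI[of _ "[(c, [])]"]) auto
next
  case (add f g)
  then obtain ps qs where
    "\<forall>p\<in>set ps. set (snd p) \<subseteq> Basis" "\<forall>x. f x = (\<Sum>p\<leftarrow>ps. fst p * (\<Prod>b\<leftarrow>snd p. x \<bullet> b))"
    "\<forall>p\<in>set qs. set (snd p) \<subseteq> Basis" "\<forall>x. g x = (\<Sum>p\<leftarrow>qs. fst p * (\<Prod>b\<leftarrow>snd p. x \<bullet> b))" by blast
  then show ?case by (intro exI[of _ "ps @ qs"]) auto
next
  case (mult f g)
  then obtain ps qs where *:
    "\<forall>p\<in>set ps. set (snd p) \<subseteq> Basis" "\<forall>x. f x = (\<Sum>p\<leftarrow>ps. fst p * (\<Prod>b\<leftarrow>snd p. x \<bullet> b))"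
    "\<forall>p\<in>set qs. set (snd p) \<subseteq> Basis" "\<forall>x. g x = (\<Sum>p\<leftarrow>qs. fst p * (\<Prod>b\<leftarrow>snd p. x \<bullet> b))" by blast
  define rs where "rs = concat (map (\<lambda>p. map (\<lambda>q. (fst p * fst q, snd p @ snd q)) qs) ps)"
  have "(\<Sum>p\<leftarrow>rs. fst p * (\<Prod>b\<leftarrow>snd p. x \<bullet> b)) = f x * g x" for x
  proof -
    have "(\<Sum>p\<leftarrow>rs. fst p * (\<Prod>b\<leftarrow>snd p. x \<bullet> b))
       = (\<Sum>p\<leftarrow>ps. \<Sum>q\<leftarrow>qs. (fst p * (\<Prod>b\<leftarrow>snd p. x \<bullet> b)) * (fst q * (\<Prod>b\<leftarrow>snd q. x \<bullet> b)))"
      by (simp add: rs_def map_concat sum_list_concat_map o_def mult_ac)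
    also have "\<dots> = f x * g x"
      by (simp add: *(2,4) sum_list_const_mult sum_list_mult_const)
    finally show ?thesis .
  qed
  moreover have "\<forall>p\<in>set rs. set (snd p) \<subseteq> Basis" using *(1,3) by (auto simp: rs_def)
  ultimately show ?case by (intro exI[of _ rs] conjI allI) (simp_all only:)
qed

lemma coeff_sum_list: "coeff (\<Sum>x\<leftarrow>xs. f x) n = (\<Sum>x\<leftarrow>xs. coeff (f x) n)"
  by (induction xs) auto

lemma poly_sum_list: "poly (\<Sum>x\<leftarrow>xs. f x) t = (\<Sum>x\<leftarrow>xs. poly (f x) t)"
  by (induction xs) auto

lemma sum_list_filter_if: "(\<Sum>x\<leftarrow>xs. if P x then f x else (0::real)) = (\<Sum>x\<leftarrow>filter P xs. f x)"
  by (induction xs) auto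

text \<open>For fixed x, both h (t x) = t^k h x and its expansion are polynomials in t; comparing
  the coefficients of t^k leaves only the monomials of length k.\<close>

lemma homogeneous_polynomials_finite_span:
  fixes h :: "'a::euclidean_space \<Rightarrow> real"
  assumes h: "real_polynomial_function h" and hom: "\<And>t u. h (t *\<^sub>R u) = t ^ k * h u"
  shows "\<exists>c. \<forall>x. h x = (\<Sum>l\<in>{l. set l \<subseteq> Basis \<and> length l = k}. c l * (\<Prod>b\<leftarrow>l. x \<bullet> b))"
proof -
  obtain ps :: "(real \<times> 'a list) list" where ps: "\<forall>p\<in>set ps. set (snd p) \<subseteq> Basis"
    "\<And>x. h x = (\<Sum>p\<leftarrow>ps. fst p * (\<Prod>b\<leftarrow>snd p. x \<bullet> b))"
    using real_polynomial_function_monomials[OF h] by blast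
  define qs where "qs = filter (\<lambda>p. length (snd p) = k) ps"
  have scale: "(\<Prod>b\<leftarrow>l. (t *\<^sub>R x) \<bullet> b) = t ^ length l * (\<Prod>b\<leftarrow>l. x \<bullet> b)" for t and x :: 'a and l
    by (induction l) auto
  have "h x = (\<Sum>p\<leftarrow>qs. fst p * (\<Prod>b\<leftarrow>snd p. x \<bullet> b))" for x
  proof -
    define P where "P = (\<Sum>p\<leftarrow>ps. monom (fst p * (\<Prod>b\<leftarrow>snd p. x \<bullet> b)) (length (snd p)))"
    have "poly P t = poly (monom (h x) k) t" for t
    proof -
      have "poly P t = (\<Sum>p\<leftarrow>ps. fst p * (\<Prod>b\<leftarrow>snd p. (t *\<^sub>R x) \<bullet> b))"
        unfolding P_def poly_sum_list poly_monom scale by (simp add: mult_ac)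
      also have "\<dots> = h (t *\<^sub>R x)" by (simp only: ps(2))
      finally show ?thesis by (simp add: hom poly_monom mult.commute)
    qed
    then have "poly P = poly (monom (h x) k)" by (rule ext)
    then have "P = monom (h x) k" by (simp only: poly_eq_poly_eq_iff)
    then have "h x = coeff P k" by simp
    also have "\<dots> = (\<Sum>p\<leftarrow>qs. fst p * (\<Prod>b\<leftarrow>snd p. x \<bullet> b))"
      unfolding P_def coeff_sum_list qs_def by (simp add: sum_list_filter_if[symmetric] eq_commute)
    finally show ?thesis .
  qed
  moreover have "\<exists>c. \<forall>x. (\<Sum>p\<leftarrow>qs. fst p * (\<Prod>b\<leftarrow>snd p. x \<bullet> b))
      = (\<Sum>l\<in>{l. set l \<subseteq> Basis \<and> length l = k}. c l * (\<Prod>b\<leftarrow>l. x \<bullet> b))"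
  proof -
    have fin: "finite {l. set l \<subseteq> (Basis :: 'a set) \<and> length l = k}"
      by (rule finite_lists_length_eq) simp
    have "\<forall>p\<in>set qs. snd p \<in> {l. set l \<subseteq> Basis \<and> length l = k}" using ps(1) by (auto simp: qs_def)
    then show ?thesis
    proof (induction qs)
      case Nil
      show ?case by (intro exI[of _ "\<lambda>_. 0"]) simp
    next
      case (Cons p qs)
      then obtain c where c: "\<And>x. (\<Sum>p\<leftarrow>qs. fst p * (\<Prod>b\<leftarrow>snd p. x \<bullet> b))
        = (\<Sum>l\<in>{l. set l \<subseteq> Basis \<and> length l = k}. c l * (\<Prod>b\<leftarrow>l. x \<bullet> b))" by auto
      have p: "snd p \<in> {l. set l \<subseteq> Basis \<and> length l = k}" using Cons.prems by simp
      have "(\<Sum>p\<leftarrow>p # qs. fst p * (\<Prod>b\<leftarrow>snd p. x \<bullet> b))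
        = (\<Sum>l\<in>{l. set l \<subseteq> Basis \<and> length l = k}. (c l + (if l = snd p then fst p else 0)) * (\<Prod>b\<leftarrow>l. x \<bullet> b))" for x
      proof -
        have "(\<Sum>l\<in>{l. set l \<subseteq> Basis \<and> length l = k}. (if l = snd p then fst p else 0) * (\<Prod>b\<leftarrow>l. x \<bullet> b))
          = (\<Sum>l\<in>{l. set l \<subseteq> Basis \<and> length l = k}. if l = snd p then fst p * (\<Prod>b\<leftarrow>l. x \<bullet> b) else 0)"
          by (intro sum.cong) auto
        also have "\<dots> = fst p * (\<Prod>b\<leftarrow>snd p. x \<bullet> b)"
          using fin p by (subst sum.delta) auto
        finally show ?thesis by (simp add: c distrib_right sum.distrib)
      qed
      then show ?case by (intro exI[of _ "\<lambda>l. c l + (if l = snd p then fst p else 0)"] allI)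
    qed
  qed
  ultimately show ?thesis by simp
qed

text \<open>Homogeneity scales any point into the unit ball, so points of the ball separate harmonic
  polynomials.\<close>

lemma harmonic_polys_eq_0_iff_on_ball:
  assumes h: "h \<in> harmonic_polys k" and 0: "\<And>u. u \<in> ball 0 1 \<Longrightarrow> h u = 0"
  shows "h x = 0"
proof -
  define t where "t = 1 / (norm x + 1)"
  have "norm x + 1 > 0" by (simp add: add_nonneg_pos)
  then have "t > 0" "t *\<^sub>R x \<in> ball 0 1" by (auto simp: t_def field_simps)
  then show ?thesis using 0[of "t *\<^sub>R x"] harmonic_polys_homogeneous[OF h, of t x] by simp
qed

text \<open>The nodes lie in the open unit ball because only for such u are x \<mapsto> f x u known
  to be C2 and compactly supported. The coefficients of \<open>f x\<close> are then these slices
  themselves.\<close>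

lemma harmonic_interpolation:
  obtains U :: "'a::euclidean_space set" and e where "finite U" "U \<subseteq> ball 0 1" "\<And>u. u \<in> U \<Longrightarrow> e u \<in> harmonic_polys k"
    "\<And>h x. h \<in> harmonic_polys k \<Longrightarrow> h x = (\<Sum>u\<in>U. h u * e u x)"
proof -
  have "\<exists>U e. finite U \<and> U \<subseteq> ball 0 1 \<and> (\<forall>u\<in>U. e u \<in> harmonic_polys k) \<and>
    (\<forall>h\<in>harmonic_polys k. \<forall>x::'a. h x = (\<Sum>u\<in>U. h u * e u x))"
  proof (rule interpolation_basis)
    show "finite {l. set l \<subseteq> (Basis :: 'a set) \<and> length l = k}"
      by (rule finite_lists_length_eq) simp
    fix h :: "'a \<Rightarrow> real" assume h: "h \<in> harmonic_polys k"
    show "\<exists>c. \<forall>x. h x = (\<Sum>l | set l \<subseteq> Basis \<and> length l = k. c l * (\<Prod>b\<leftarrow>l. x \<bullet> b))"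
      by (rule homogeneous_polynomials_finite_span[OF harmonic_polys_poly[OF h] harmonic_polys_homogeneous[OF h]])
  qed (auto intro: harmonic_polys_add harmonic_polys_cmult harmonic_polys_eq_0_iff_on_ball)
  with that show thesis by blast
qed

section \<open>Surface measure and reproducing kernel\<close>

lemma scale_measure_eq_density: "scale_measure r M = density M (\<lambda>_. r)"
  by (rule measure_eqI) (simp_all add: emeasure_density nn_integral_cmult_indicator)

lemma
  fixes f :: "'a::euclidean_space \<Rightarrow> real"
  assumes [measurable]: "f \<in> borel_measurable borel"
  shows integral_surface_measure: "(LINT u|surface_measure. f u)
      = DIM('a) * (LINT x|lborel. indicator (cball 0 1 - {0}) x * f (sgn x))" (is ?int)
    and integrable_surface_measure_iff: "integrable surface_measure f
      \<longleftrightarrow> integrable lborel (\<lambda>x. indicator (cball 0 1 - {0}) x * f (sgn x))" (is ?iff)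
proof -
  have sgn[measurable]: "sgn \<in> restrict_space lborel (cball 0 1 - {0::'a}) \<rightarrow>\<^sub>M borel"
    by (rule measurable_restrict_space1) simp
  have eq: "surface_measure = density (distr (restrict_space lborel (cball 0 1 - {0::'a})) borel sgn) (\<lambda>_. ennreal (real DIM('a)))"
    by (simp add: surface_measure_def scale_measure_eq_density)
  have set: "(cball 0 1 - {0::'a}) \<inter> space lborel \<in> sets lborel" by simp
  show ?int
    unfolding eq
    by (subst integral_real_density)
       (simp_all add: integral_distr integral_restrict_space[OF set])
  show ?iff
    unfolding eq
    by (subst integrable_density)
       (simp_all add: integrable_distr_eq integrable_restrict_space[OF set])
qed

lemma borel_measurable_indicator_sgn [measurable]:
  fixes f :: "'a::euclidean_space \<Rightarrow> real"
  assumes "f \<in> borel_measurable borel"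
  shows "(\<lambda>x. indicator (cball 0 1 - {0}) x * f (sgn x)) \<in> borel_measurable borel"
  using measurable_compose[OF borel_measurable_sgn assms]
  by (intro borel_measurable_times borel_measurable_indicator) simp_all

lemma integrable_surface_measure_continuous:
  fixes f :: "'a::euclidean_space \<Rightarrow> real"
  assumes f: "continuous_on UNIV f"
  shows "integrable surface_measure f"
proof -
  have [measurable]: "f \<in> borel_measurable borel" by (rule borel_measurable_continuous_onI[OF f])
  have "bounded (f ` sphere 0 1)"
    by (intro compact_imp_bounded compact_continuous_image continuous_on_subset[OF f]) auto
  then obtain C where C: "\<And>u. norm u = 1 \<Longrightarrow> \<bar>f u\<bar> \<le> C" "C > 0"
    by (force simp: bounded_pos)
  have "integrable lborel (\<lambda>x. indicator (cball 0 1 - {0::'a}) x * f (sgn x))"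
  proof (rule Bochner_Integration.integrable_bound)
    show "integrable lborel (\<lambda>x::'a. C * indicator (cball 0 1) x)"
      using emeasure_lborel_cball_finite by (intro integrable_mult_right integrable_real_indicator) auto
    show "AE x in lborel. norm (indicator (cball 0 1 - {0}) x * f (sgn x)) \<le> norm (C * indicator (cball 0 1) (x::'a))"
      using C by (intro AE_I2) (auto simp: indicator_def norm_sgn)
  qed (simp add: borel_measurable_indicator_sgn)
  then show ?thesis by (simp add: integrable_surface_measure_iff)
qed

lemma measure_surface_measure:
  "measure (surface_measure :: 'a::euclidean_space measure) UNIV = DIM('a) * unit_ball_vol DIM('a)"
proof -
  have "measure (surface_measure :: 'a measure) UNIV = (LINT u|(surface_measure :: 'a measure). 1)"
    by (simp add: surface_measure_def space_scale_measure)
  also have "\<dots> = DIM('a) * (LINT x|lborel. indicator (cball 0 1 - {0::'a}) x * 1)"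
    by (rule integral_surface_measure) simp
  also have "(LINT x|lborel. indicator (cball 0 1 - {0::'a}) x * 1) = (LINT x|lborel. indicator (cball 0 1) (x :: 'a) :: real)"
    by (rule integral_cong_AE) (use AE_lborel_singleton[of "0::'a"] in \<open>auto simp: indicator_def\<close>)
  also have "\<dots> = unit_ball_vol DIM('a)"
    by (simp add: content_cball)
  finally show ?thesis .
qed

lemma sgn_orthogonal: "orthogonal_transformation R \<Longrightarrow> sgn (R x) = R (sgn x)"
  by (simp add: sgn_div_norm orthogonal_transformation_norm linear_scale orthogonal_transformation_linear)

text \<open>Inherited from Lebesgue measure: the punctured ball is invariant and \<open>sgn\<close>
  commutes with orthogonal maps.\<close>

lemma integral_surface_measure_orthogonal:
  fixes f :: "'a::euclidean_space \<Rightarrow> real" and R :: "'a \<Rightarrow> 'a"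
  assumes R: "orthogonal_transformation R" and [measurable]: "f \<in> borel_measurable borel"
  shows "(LINT u|surface_measure. f (R u)) = (LINT u|surface_measure. f u)"
proof -
  have [measurable]: "R \<in> borel_measurable borel"
    using R by (intro borel_measurable_continuous_onI linear_continuous_on linear_conv_bounded_linear[THEN iffD1] orthogonal_transformation_linear)
  define F where "F x = indicator (cball 0 1 - {0}) x * f (sgn x)" for x
  have [measurable]: "F \<in> borel_measurable borel" unfolding F_def by (rule borel_measurable_indicator_sgn) simp
  have "(LINT x|lborel. F x) = (LINT x|lborel. F (R x))"
    by (subst lborel_distr_orthogonal[OF R, symmetric], subst integral_distr) simp_all
  also have "\<dots> = (LINT x|lborel. indicator (cball 0 1 - {0}) x * f (R (sgn x)))"
  proof (rule Bochner_Integration.integral_cong[OF refl])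
    fix x
    show "F (R x) = indicator (cball 0 1 - {0}) x * f (R (sgn x))"
      using orthogonal_transformation_norm[OF R, of x]
      by (auto simp: F_def indicator_def sgn_orthogonal[OF R])
  qed
  finally have "(LINT x|lborel. F x) = (LINT x|lborel. indicator (cball 0 1 - {0}) x * f (R (sgn x)))" .
  moreover have "(\<lambda>u. f (R u)) \<in> borel_measurable borel" by measurable
  ultimately show ?thesis
    by (simp add: integral_surface_measure F_def)
qed

lemma continuous_on_harmonic: "h \<in> harmonic_polys k \<Longrightarrow> continuous_on S h"
  by (intro continuous_on_real_polynomial_function harmonic_polys_poly)

text \<open>The integrand is nonnegative, so h vanishes at \<open>sgn x\<close> for almost every x
  in the ball, and by homogeneity at x. The zero set is closed, so on the open ball almost
  everywhere becomes everywhere.\<close>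

lemma harmonic_polys_L2_eq_0:
  assumes h: "h \<in> harmonic_polys k" and 0: "(LINT u|surface_measure. h u * h u) = 0"
  shows "h x = 0"
proof (rule harmonic_polys_eq_0_iff_on_ball[OF h])
  note cont = continuous_on_harmonic[OF h]
  have [measurable]: "h \<in> borel_measurable borel" by (rule borel_measurable_continuous_onI[OF cont])
  have "integrable surface_measure (\<lambda>u. h u * h u)"
    by (intro integrable_surface_measure_continuous continuous_intros cont)
  then have int: "integrable lborel (\<lambda>x. indicator (cball 0 1 - {0}) x * (h (sgn x) * h (sgn x)))"
    by (subst (asm) integrable_surface_measure_iff) simp_all
  have "(LINT x|lborel. indicator (cball 0 1 - {0}) x * (h (sgn x) * h (sgn x))) = 0"
    using 0 by (subst (asm) integral_surface_measure) simp_all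
  then have "AE x in lborel. indicator (cball 0 1 - {0}) x * (h (sgn x) * h (sgn x)) = 0"
    by (subst (asm) integral_nonneg_eq_0_iff_AE[OF int]) (auto simp: indicator_def)
  then have "AE x in lborel. x \<in> ball 0 1 \<longrightarrow> x \<in> {x. h x = 0}"
    using AE_lborel_singleton[of 0]
  proof eventually_elim
    case (elim x)
    show ?case
    proof
      assume "x \<in> ball 0 1"
      with elim have "h (sgn x) = 0" by (auto simp: indicator_def)
      then have "h (norm x *\<^sub>R sgn x) = 0" by (simp only: harmonic_polys_homogeneous[OF h] mult_zero_right)
      then show "x \<in> {x. h x = 0}" by (simp add: sgn_div_norm elim)
    qed
  qed
  then have AE: "AE x in lebesgue. x \<in> ball 0 1 \<longrightarrow> x \<in> {x. h x = 0}"
    by (rule AE_completion)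
  have "closed {x. h x = 0}"
    by (intro closed_Collect_eq cont continuous_on_const)
  then show "\<And>u. u \<in> ball 0 1 \<Longrightarrow> h u = 0"
    using mem_closed_if_AE_lebesgue_open[OF open_ball _ AE] by blast
qed

section \<open>The L2 product on the sphere and the reproducing kernel\<close>

definition sphere_inner :: "('a::euclidean_space \<Rightarrow> real) \<Rightarrow> ('a \<Rightarrow> real) \<Rightarrow> real" where
  "sphere_inner f g = (LINT w|surface_measure. f w * g w)"

lemma sphere_inner_integrable:
  assumes "f \<in> harmonic_polys k" "g \<in> harmonic_polys k"
  shows "integrable surface_measure (\<lambda>w. f w * g w)"
  using assms by (intro integrable_surface_measure_continuous continuous_intros continuous_on_harmonic)

lemma sphere_inner_sum_left:
  assumes "\<And>i. i \<in> I \<Longrightarrow> f i \<in> harmonic_polys k" "g \<in> harmonic_polys k"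
  shows "sphere_inner (\<lambda>x. \<Sum>i\<in>I. c i * f i x) g = (\<Sum>i\<in>I. c i * sphere_inner (f i) g)"
proof -
  have "sphere_inner (\<lambda>x. \<Sum>i\<in>I. c i * f i x) g = (LINT w|surface_measure. (\<Sum>i\<in>I. c i * (f i w * g w)))"
    by (simp add: sphere_inner_def sum_distrib_right mult.assoc)
  also have "\<dots> = (\<Sum>i\<in>I. c i * sphere_inner (f i) g)"
    using sphere_inner_integrable[OF assms(1) assms(2)] by (simp add: sphere_inner_def)
  finally show ?thesis .
qed

lemma sphere_inner_commute: "sphere_inner f g = sphere_inner g f"
  by (simp add: sphere_inner_def mult.commute)

lemma sphere_inner_add_left:
  assumes "f \<in> harmonic_polys k" "g \<in> harmonic_polys k" "h \<in> harmonic_polys k"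
  shows "sphere_inner (\<lambda>x. f x + g x) h = sphere_inner f h + sphere_inner g h"
  using assms by (simp add: sphere_inner_def distrib_right sphere_inner_integrable)

lemma sphere_inner_cmult_left: "sphere_inner (\<lambda>x. a * f x) h = a * sphere_inner f h"
  by (simp add: sphere_inner_def mult.assoc)

text \<open>Interpolating the functionals \<open>\<langle>h, \<cdot>\<rangle>\<close> instead of the functions \<open>h\<close> yields a pair of
  \<open>L\<^sup>2\<close>-dual bases \<open>u\<close>, \<open>\<epsilon> u\<close>; the reproducing kernel is then \<open>\<Sum>u. \<epsilon> u v * u w\<close>.\<close>

lemma reproducing_kernel_exists:
  fixes v :: "'a::euclidean_space"
  shows "\<exists>z. z \<in> harmonic_polys k \<and> (\<forall>h\<in>harmonic_polys k. h v = (LINT w|surface_measure. z w * h w))"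
proof -
  \<comment> \<open>The functionals are set to 0 off the harmonic polynomials because the hypotheses
    of \<open>interpolation_basis\<close> quantify over all arguments, here arbitrary functions
    g.\<close>
  define F where "F h g = (if g \<in> harmonic_polys k then sphere_inner h g else 0)" for h g :: "'a \<Rightarrow> real"
  define V where "V = F ` harmonic_polys k"
  obtain U0 and e0 :: "'a \<Rightarrow> 'a \<Rightarrow> real" where U0: "finite U0" "\<And>u. u \<in> U0 \<Longrightarrow> e0 u \<in> harmonic_polys k"
    "\<And>h x. h \<in> harmonic_polys k \<Longrightarrow> h x = (\<Sum>u\<in>U0. h u * e0 u x)"
    using harmonic_interpolation by metis
  have "\<exists>U e. finite U \<and> U \<subseteq> harmonic_polys k \<and> (\<forall>u\<in>U. e u \<in> V) \<and> (\<forall>h\<in>V. \<forall>x. h x = (\<Sum>u\<in>U. h u * e u x))"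
  proof (rule interpolation_basis[OF U0(1)])
    fix G assume "G \<in> V"
    then obtain h where h: "h \<in> harmonic_polys k" "G = F h" by (auto simp: V_def)
    have eq: "(\<lambda>x. \<Sum>u\<in>U0. h u * e0 u x) = h" by (rule ext) (rule U0(3)[OF h(1), symmetric])
    have "sphere_inner (\<lambda>x. \<Sum>u\<in>U0. h u * e0 u x) g = (\<Sum>u\<in>U0. h u * sphere_inner (e0 u) g)"
      if "g \<in> harmonic_polys k" for g
      by (rule sphere_inner_sum_left[OF U0(2) that])
    then have "sphere_inner h g = (\<Sum>u\<in>U0. h u * sphere_inner (e0 u) g)" if "g \<in> harmonic_polys k" for g
      using that by (simp only: eq)
    then show "\<exists>c. \<forall>g. G g = (\<Sum>u\<in>U0. c u * F (e0 u) g)"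
      by (intro exI[of _ h]) (auto simp: h(2) F_def)
  next
    fix f g assume "f \<in> V" "g \<in> V"
    then obtain h h' where h: "h \<in> harmonic_polys k" "h' \<in> harmonic_polys k" "f = F h" "g = F h'" by (auto simp: V_def)
    then have "(\<lambda>x. f x + g x) = F (\<lambda>x. h x + h' x)"
      by (auto simp: F_def sphere_inner_add_left)
    then show "(\<lambda>x. f x + g x) \<in> V" using h by (auto simp: V_def intro: harmonic_polys_add)
  next
    fix f a assume "f \<in> V"
    then obtain h where h: "h \<in> harmonic_polys k" "f = F h" by (auto simp: V_def)
    then have "(\<lambda>x. a * f x) = F (\<lambda>x. a * h x)"
      by (auto simp: F_def sphere_inner_cmult_left)
    then show "(\<lambda>x. a * f x) \<in> V" using h by (auto simp: V_def intro: harmonic_polys_cmult)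
  next
    \<comment> \<open>Evaluating the functional at its own representative h shows that h has L2 norm
      0.\<close>
    fix f x assume "f \<in> V" and 0: "\<And>u. u \<in> harmonic_polys k \<Longrightarrow> f u = 0"
    then obtain h where h: "h \<in> harmonic_polys k" "f = F h" by (auto simp: V_def)
    have "h y = 0" for y
      using 0[OF h(1)] h by (intro harmonic_polys_L2_eq_0[OF h(1)]) (simp add: F_def sphere_inner_def)
    then show "f x = 0" by (simp add: h F_def sphere_inner_def)
  qed
  then obtain U e where U: "finite U" "U \<subseteq> harmonic_polys k" "\<And>u. u \<in> U \<Longrightarrow> e u \<in> V"
    "\<And>G x. G \<in> V \<Longrightarrow> G x = (\<Sum>u\<in>U. G u * e u x)" by blast
  have "\<forall>u\<in>U. \<exists>\<epsilon>. \<epsilon> \<in> harmonic_polys k \<and> e u = F \<epsilon>" using U(3) by (auto simp: V_def)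
  then obtain \<epsilon> where \<epsilon>: "\<And>u. u \<in> U \<Longrightarrow> \<epsilon> u \<in> harmonic_polys k" "\<And>u. u \<in> U \<Longrightarrow> e u = F (\<epsilon> u)"
    by metis
  \<comment> \<open>Interpolation gives the expansion only inside inner products. The difference of
    the two sides is then orthogonal to itself, which makes it a pointwise identity.\<close>
  have expand: "h x = (\<Sum>u\<in>U. sphere_inner h u * \<epsilon> u x)" if h: "h \<in> harmonic_polys k" for h x
  proof -
    define s where "s = (\<lambda>x. \<Sum>u\<in>U. sphere_inner h u * \<epsilon> u x)"
    have s: "s \<in> harmonic_polys k" unfolding s_def by (intro harmonic_polys_sum \<epsilon>)
    define d where "d = (\<lambda>x. h x + - 1 * s x)"
    have d: "d \<in> harmonic_polys k" unfolding d_def by (intro harmonic_polys_add harmonic_polys_cmult h s)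
    have "sphere_inner h g = sphere_inner s g" if g: "g \<in> harmonic_polys k" for g
    proof -
      have "sphere_inner h g = F h g" using g by (simp add: F_def)
      also have "\<dots> = (\<Sum>u\<in>U. F h u * e u g)" using h by (intro U(4)) (simp add: V_def)
      also have "\<dots> = (\<Sum>u\<in>U. sphere_inner h u * sphere_inner (\<epsilon> u) g)"
        using U(2) g by (intro sum.cong) (auto simp: F_def \<epsilon>)
      also have "\<dots> = sphere_inner s g" unfolding s_def using \<epsilon> g by (subst sphere_inner_sum_left) auto
      finally show ?thesis .
    qed
    then have "sphere_inner h d = sphere_inner s d" using d by simp
    moreover have "sphere_inner d d = sphere_inner h d + - 1 * sphere_inner s d"
      using sphere_inner_add_left[OF h harmonic_polys_cmult[OF s, of "- 1"] d]
      unfolding d_def[symmetric] sphere_inner_cmult_left .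
    ultimately have "sphere_inner d d = 0" by simp
    then have "d x = 0" by (intro harmonic_polys_L2_eq_0[OF d]) (simp add: sphere_inner_def)
    then show ?thesis by (simp add: d_def s_def)
  qed
  define z where "z = (\<lambda>x. \<Sum>u\<in>U. \<epsilon> u v * u x)"
  have "z \<in> harmonic_polys k" unfolding z_def using U(2) by (intro harmonic_polys_sum) auto
  moreover have "h v = (LINT w|surface_measure. z w * h w)" if h: "h \<in> harmonic_polys k" for h
  proof -
    have "(LINT w|surface_measure. z w * h w) = sphere_inner z h" by (simp add: sphere_inner_def)
    also have "\<dots> = (\<Sum>u\<in>U. \<epsilon> u v * sphere_inner u h)"
      unfolding z_def using U(2) h by (subst sphere_inner_sum_left) auto
    also have "\<dots> = h v" by (simp add: expand[OF h, of v] sphere_inner_commute[of h] mult.commute)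
    finally show ?thesis by simp
  qed
  ultimately show ?thesis by blast
qed

text \<open>The definition uses a definite description, so uniqueness must accompany existence: two
  candidates differ by a harmonic polynomial orthogonal to itself.\<close>

lemma reproducing_kernel:
  fixes v :: "'a::euclidean_space"
  shows "(\<lambda>u. reproducing_kernel k u v) \<in> harmonic_polys k"
    and "h \<in> harmonic_polys k \<Longrightarrow> h v = (LINT w|surface_measure. reproducing_kernel k w v * h w)"
proof -
  define P where "P z \<longleftrightarrow> z \<in> harmonic_polys k \<and> (\<forall>h\<in>harmonic_polys k. h v = (LINT w|surface_measure. z w * h w))"
    for z :: "'a \<Rightarrow> real"
  have "\<exists>!z. P z"
  proof (rule ex_ex1I)
    show "\<exists>z. P z" unfolding P_def by (rule reproducing_kernel_exists)
    fix z z' assume z: "P z" "P z'"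
    define d where "d = (\<lambda>x. z x + - 1 * z' x)"
    have zh: "z \<in> harmonic_polys k" "z' \<in> harmonic_polys k" using z by (auto simp: P_def)
    note zc = harmonic_polys_cmult[OF zh(2), of "- 1"]
    have d: "d \<in> harmonic_polys k"
      unfolding d_def by (intro harmonic_polys_add zh(1) zc)
    have "sphere_inner z d = sphere_inner z' d" using z d unfolding P_def sphere_inner_def by metis
    moreover have "sphere_inner d d = sphere_inner z d + - 1 * sphere_inner z' d"
      using sphere_inner_add_left[OF zh(1) zc d] unfolding d_def[symmetric] sphere_inner_cmult_left .
    ultimately have "sphere_inner d d = 0" by simp
    then have "d x = 0" for x by (intro harmonic_polys_L2_eq_0[OF d]) (simp add: sphere_inner_def)
    then show "z = z'" by (auto simp: d_def)
  qed
  then have "P (THE z. P z)" by (rule theI')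
  moreover have "(\<lambda>u. reproducing_kernel k u v) = (THE z. P z)"
    by (simp add: reproducing_kernel_def P_def)
  ultimately have "P (\<lambda>u. reproducing_kernel k u v)" by simp
  then show "(\<lambda>u. reproducing_kernel k u v) \<in> harmonic_polys k"
    "h \<in> harmonic_polys k \<Longrightarrow> h v = (LINT w|surface_measure. reproducing_kernel k w v * h w)"
    by (auto simp: P_def)
qed

section \<open>Reflections and the reduction of the potential to a convolution\<close>

lemma
  fixes a :: "'a::euclidean_space"
  shows linear_clifford_reflect: "linear (clifford_reflect a)"
    and clifford_reflect_adjoint: "clifford_reflect a x \<bullet> y = x \<bullet> clifford_reflect a y"
    and clifford_reflect_involution: "clifford_reflect a (clifford_reflect a x) = x"
    and orthogonal_clifford_reflect: "orthogonal_transformation (clifford_reflect a)"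
proof -
  show lin: "linear (clifford_reflect a)"
    by (rule linearI) (simp_all add: clifford_reflect_def algebra_simps add_divide_distrib inner_simps)
  show adj: "clifford_reflect a x \<bullet> y = x \<bullet> clifford_reflect a y" for x y
    by (simp add: clifford_reflect_def inner_simps inner_commute)
  \<comment> \<open>For a = 0 the map is the identity, by division by zero, so no condition on a
    appears.\<close>
  show inv: "clifford_reflect a (clifford_reflect a x) = x" for x
    by (cases "a = 0") (simp_all add: clifford_reflect_def inner_simps dot_square_norm field_simps)
  show "orthogonal_transformation (clifford_reflect a)"
    unfolding orthogonal_transformation_def using lin by (simp add: adj inv)
qed

text \<open>The multiple \<open>|z|\<^sup>2\<close> of the reflection along \<open>z\<close>; unlike the reflection it is polynomial in \<open>z\<close>.\<close>

definition srefl :: "'a::euclidean_space \<Rightarrow> 'a \<Rightarrow> 'a" where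
  "srefl z v = (z \<bullet> z) *\<^sub>R v - (2 * (z \<bullet> v)) *\<^sub>R z"

lemma
  fixes z :: "'a::euclidean_space"
  shows linear_refl: "linear (srefl z)"
    and refl_adjoint: "srefl z x \<bullet> y = x \<bullet> srefl z y"
    and refl_refl: "srefl z (srefl z x) = (z \<bullet> z)\<^sup>2 *\<^sub>R x"
    and refl_eq_clifford_reflect: "srefl z v = (norm z)\<^sup>2 *\<^sub>R clifford_reflect z v"
proof -
  show "linear (srefl z)"
    by (rule linearI) (simp_all add: srefl_def algebra_simps inner_simps)
  show "srefl z x \<bullet> y = x \<bullet> srefl z y"
    by (simp add: srefl_def inner_simps inner_commute)
  show "srefl z (srefl z x) = (z \<bullet> z)\<^sup>2 *\<^sub>R x"
    by (simp add: srefl_def inner_simps algebra_simps power2_eq_square)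
  show "srefl z v = (norm z)\<^sup>2 *\<^sub>R clifford_reflect z v"
    by (cases "z = 0") (simp_all add: srefl_def clifford_reflect_def dot_square_norm algebra_simps)
qed

lemma harmonic_refl: "h \<in> harmonic_polys k \<Longrightarrow> (\<lambda>v. h (srefl z v)) \<in> harmonic_polys k"
  by (rule harmonic_compose_selfadjoint[OF _ linear_refl refl_adjoint refl_refl])

text \<open>The reflection R preserves the surface measure and is an involution, so substituting R u
  for u moves it from the kernel to g. As g o R is again harmonic, the reproducing property
  applies.\<close>

lemma inner_integral_fundamental_solution:
  fixes g :: "'a::euclidean_space \<Rightarrow> real"
  assumes g: "g \<in> harmonic_polys k"
  shows "(LINT u|surface_measure. fundamental_solution k x y u v * g u)
    = fundamental_const TYPE('a) k * norm (y - x) powi (2 - int DIM('a)) * g (clifford_reflect (y - x) v)"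
proof -
  define R where "R = clifford_reflect (y - x)"
  note R = orthogonal_clifford_reflect[of "y - x", folded R_def]
  have gR: "(\<lambda>u. g (R u)) \<in> harmonic_polys k"
    unfolding R_def
    by (rule harmonic_compose_selfadjoint[OF g linear_clifford_reflect clifford_reflect_adjoint, where c=1])
       (simp add: clifford_reflect_involution)
  have [measurable]: "(\<lambda>u. reproducing_kernel k u v) \<in> borel_measurable borel" "(\<lambda>u. g (R u)) \<in> borel_measurable borel"
    by (intro borel_measurable_continuous_onI continuous_on_harmonic[OF reproducing_kernel(1)] continuous_on_harmonic[OF gR])+
  have "(LINT u|surface_measure. reproducing_kernel k (R u) v * g u)
     = (LINT u|surface_measure. reproducing_kernel k (R u) v * g (R (R u)))"
    by (simp add: R_def clifford_reflect_involution)
  also have "\<dots> = (LINT u|surface_measure. reproducing_kernel k u v * g (R u))"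
    by (rule integral_surface_measure_orthogonal[OF R]) measurable
  also have "\<dots> = g (R v)" using reproducing_kernel(2)[OF gR, of v] by simp
  finally have *: "(LINT u|surface_measure. reproducing_kernel k (R u) v * g u) = g (R v)" .
  have "(LINT u|surface_measure. fundamental_solution k x y u v * g u)
      = (LINT u|surface_measure. (fundamental_const TYPE('a) k * norm (y - x) powi (2 - int DIM('a))) * (reproducing_kernel k (R u) v * g u))"
    by (simp add: fundamental_solution_def R_def mult.assoc)
  also have "\<dots> = (fundamental_const TYPE('a) k * norm (y - x) powi (2 - int DIM('a))) * g (R v)"
    by (simp only: integral_mult_right_zero *)
  finally show ?thesis by (simp add: R_def)
qed

text \<open>Replacing the reflection by \<open>srefl\<close> costs |z|^(2k), by homogeneity. At z =
  0 both sides are 0, since the exponent 2 - m is negative and \<open>0 powr a = 0\<close>.\<close>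

lemma norm_powi_clifford_reflect:
  fixes z :: "'a::euclidean_space"
  assumes g: "g \<in> harmonic_polys k" and m: "DIM('a) \<ge> 3"
  shows "norm z powi (2 - int DIM('a)) * g (clifford_reflect z v)
    = norm z powr (2 - real DIM('a) - 2 * real k) * g (srefl z v)"
proof (cases "z = 0")
  case True
  then show ?thesis using m by (simp add: power_int_0_left_if)
next
  case False
  then have "norm z powi (2 - int DIM('a)) = norm z powr (2 - real DIM('a))"
    using powr_real_of_int'[of "norm z" "2 - int DIM('a)"] by simp
  moreover have "norm z powr (2 - real DIM('a) - 2 * real k) * ((norm z)\<^sup>2) ^ k = norm z powr (2 - real DIM('a))"
  proof -
    have "((norm z)\<^sup>2) ^ k = norm z powr (2 * real k)"
      using False powr_realpow[of "norm z" "2 * k"] by (simp add: power_mult)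
    then show ?thesis by (simp only: powr_add[symmetric]) simp
  qed
  ultimately show ?thesis
    by (simp add: refl_eq_clifford_reflect harmonic_polys_homogeneous[OF g])
qed

lemma integral_lborel_reflect_translate:
  fixes f :: "'a::euclidean_space \<Rightarrow> real"
  assumes [measurable]: "f \<in> borel_measurable borel"
  shows "(LINT x|lborel. f (y - x)) = (LINT x|lborel. f x)"
proof -
  have "orthogonal_transformation (uminus :: 'a \<Rightarrow> 'a)"
    by (simp add: orthogonal_transformation_def linear_uminus)
  then have eq: "distr lborel borel uminus = (lborel :: 'a measure)" by (rule lborel_distr_orthogonal)
  have "(LINT x|lborel. f x) = (LINT x|lborel. f (y + x))"
    by (rule integral_lborel_translation[symmetric]) simp
  also have "\<dots> = (LINT x|lborel. f (y - x))"
    by (subst eq[symmetric], subst integral_distr) simp_all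
  finally show ?thesis by simp
qed

lemma bosonic_potential_eq_convolution:
  fixes f :: "'a::euclidean_space \<Rightarrow> 'a \<Rightarrow> real"
  assumes f: "\<And>x. f x \<in> harmonic_polys k" and cont: "\<And>u. u \<in> ball 0 1 \<Longrightarrow> continuous_on UNIV (\<lambda>x. f x u)"
    and m: "DIM('a) \<ge> 3"
  shows "bosonic_potential k f y v = fundamental_const TYPE('a) k *
    (LINT z|lborel. norm z powr (2 - real DIM('a) - 2 * real k) * f (y - z) (srefl z v))"
proof -
  obtain U :: "'a set" and e where U: "finite U" "U \<subseteq> ball 0 1" "\<And>u. u \<in> U \<Longrightarrow> e u \<in> harmonic_polys k"
    "\<And>h x. h \<in> harmonic_polys k \<Longrightarrow> h x = (\<Sum>u\<in>U. h u * e u x)" using harmonic_interpolation by metis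
  define F where "F z = norm z powr (2 - real DIM('a) - 2 * real k) * f (y - z) (srefl z v)" for z
  \<comment> \<open>\<open>srefl z v\<close> leaves the unit ball, outside which no regularity of f
    is assumed. Expanding over the nodes reduces measurability to continuous slices.\<close>
  have F: "F z = norm z powr (2 - real DIM('a) - 2 * real k) * (\<Sum>u\<in>U. f (y - z) u * e u (srefl z v))" for z
    unfolding F_def by (subst U(4)[OF f]) (rule refl)
  have "(\<lambda>z. f (y - z) u * e u (srefl z v)) \<in> borel_measurable borel" if "u \<in> U" for u
    using that U unfolding srefl_def
    by (intro borel_measurable_continuous_onI continuous_intros continuous_on_compose2[OF cont, of u]
        continuous_on_compose2[OF continuous_on_harmonic[OF U(3), of u UNIV]]) auto
  then have [measurable]: "F \<in> borel_measurable borel"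
    unfolding F by measurable
  have "bosonic_potential k f y v = (LINT x|lborel. fundamental_const TYPE('a) k * F (y - x))"
    unfolding bosonic_potential_def inner_integral_fundamental_solution[OF f] F_def
    by (simp add: norm_powi_clifford_reflect[OF f m] mult.assoc)
  also have "\<dots> = fundamental_const TYPE('a) k * (LINT x|lborel. F x)"
    by (simp add: integral_lborel_reflect_translate)
  finally show ?thesis by (simp add: F_def)
qed

section \<open>Divergences\<close>

definition tr :: "('a::euclidean_space \<Rightarrow> 'a) \<Rightarrow> real" where
  "tr L = (\<Sum>b\<in>Basis. L b \<bullet> b)"

lemma tr_add: "tr (\<lambda>d. A d + B d) = tr A + tr B"
  and tr_diff: "tr (\<lambda>d. A d - B d) = tr A - tr B"
  and tr_scaleR: "tr (\<lambda>d. c *\<^sub>R A d) = c * tr A"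
  and tr_id: "tr (\<lambda>d::'a::euclidean_space. d) = DIM('a)"
  by (simp_all add: tr_def inner_add_left inner_diff_left sum.distrib sum_subtractf sum_distrib_left)

lemma tr_rank1:
  assumes "linear l"
  shows "tr (\<lambda>d. l d *\<^sub>R w) = l w"
proof -
  have "l w = l (\<Sum>b\<in>Basis. (w \<bullet> b) *\<^sub>R b)" by (simp only: euclidean_representation)
  also have "\<dots> = tr (\<lambda>d. l d *\<^sub>R w)"
    by (simp add: tr_def linear_sum[OF assms] linear_scale[OF assms] mult.commute)
  finally show ?thesis by simp
qed

definition dvg :: "('a::euclidean_space \<Rightarrow> 'a) \<Rightarrow> 'a \<Rightarrow> real" where
  "dvg X z = (\<Sum>b\<in>Basis. dir_deriv b (\<lambda>z. X z \<bullet> b) z)"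

lemma dvg_eqI:
  assumes "(X has_derivative X') (at z)"
  shows "dvg X z = tr X'"
  unfolding dvg_def tr_def
  by (intro sum.cong refl dir_deriv_eqI has_derivative_inner_left assms)

lemma real_polynomial_function_inner:
  fixes X Y :: "'a::euclidean_space \<Rightarrow> 'b::euclidean_space"
  assumes "polynomial_function X" "polynomial_function Y"
  shows "real_polynomial_function (\<lambda>z. X z \<bullet> Y z)"
  using assms
  by (subst euclidean_inner) (intro real_polynomial_function_sum real_polynomial_function.intros(4),
     auto simp: polynomial_function_iff_Basis_inner)

lemma polynomial_function_scaleR:
  fixes X :: "'a::euclidean_space \<Rightarrow> 'b::euclidean_space"
  assumes "real_polynomial_function f" "polynomial_function X"
  shows "polynomial_function (\<lambda>z. f z *\<^sub>R X z)"
  using assms by (auto simp: polynomial_function_iff_Basis_inner)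

lemma polynomial_function_grad:
  assumes "real_polynomial_function h" "polynomial_function W"
  shows "polynomial_function (\<lambda>z. grad h (W z))"
  unfolding polynomial_function_iff_Basis_inner
  using real_polynomial_function_composition[OF real_polynomial_function_grad_inner[OF assms(1)]] assms(2)
  by (auto simp: polynomial_function_iff_Basis_inner)

lemma polynomial_function_hess:
  fixes h :: "'a::euclidean_space \<Rightarrow> real" and W P :: "'b::euclidean_space \<Rightarrow> 'a"
  assumes h: "real_polynomial_function h" and "polynomial_function W" "polynomial_function P"
  shows "polynomial_function (\<lambda>z. hess h (W z) (P z))"
proof (subst hess_eq_sum[OF h], rule polynomial_function_sum)
  fix b :: 'a assume b: "b \<in> Basis"
  have "polynomial_function (\<lambda>z. hess h (W z) b)"
    unfolding grad_dir_deriv[OF h, symmetric]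
    by (intro polynomial_function_grad real_polynomial_function_dir_deriv h assms)
  then show "polynomial_function (\<lambda>z. (P z \<bullet> b) *\<^sub>R hess h (W z) b)"
    using assms(3) b by (intro polynomial_function_scaleR) (auto simp: polynomial_function_iff_Basis_inner)
qed simp

lemma polynomial_function_refl:
  assumes "polynomial_function X"
  shows "polynomial_function (\<lambda>z. srefl z (X z))"
  unfolding srefl_def
  by (intro polynomial_function_diff polynomial_function_scaleR real_polynomial_function_inner
      real_polynomial_function.intros(4) polynomial_function_id real_polynomial_function.intros(2) assms)

lemma real_polynomial_function_compose':
  "real_polynomial_function h \<Longrightarrow> polynomial_function W \<Longrightarrow> real_polynomial_function (\<lambda>z. h (W z))"
  using real_polynomial_function_compose[of W h] by (simp add: o_def)

lemmas poly_intros = polynomial_function_add polynomial_function_diff polynomial_function_scaleR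
  real_polynomial_function_inner real_polynomial_function.intros(2-4) real_polynomial_function_diff
  polynomial_function_id polynomial_function_const polynomial_function_grad
  polynomial_function_hess polynomial_function_refl
  real_polynomial_function_dir_deriv

lemma polynomial_function_imp_inner:
  fixes X :: "'a::euclidean_space \<Rightarrow> 'b::euclidean_space"
  shows "polynomial_function X \<Longrightarrow> real_polynomial_function (\<lambda>z. X z \<bullet> b)"
  by (intro poly_intros)

lemma dvg_scaleR:
  assumes f: "real_polynomial_function f" and X: "polynomial_function X"
  shows "dvg (\<lambda>z. f z *\<^sub>R X z) z = f z * dvg X z + dir_deriv (X z) f z"
proof -
  have "dvg (\<lambda>z. f z *\<^sub>R X z) z = (\<Sum>b\<in>Basis. f z * dir_deriv b (\<lambda>z. X z \<bullet> b) z + dir_deriv b f z * (X z \<bullet> b))"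
    unfolding dvg_def by (simp add: dir_deriv_mult[OF f polynomial_function_imp_inner[OF X]])
  also have "\<dots> = f z * dvg X z + dir_deriv (X z) f z"
    unfolding inner_grad[OF f, symmetric] dvg_def
    by (subst euclidean_inner[of "grad f z"]) (simp add: sum.distrib sum_distrib_left)
  finally show ?thesis .
qed

section \<open>The derivative of z \<mapsto> \<open>srefl z v\<close> and the traces it
  produces\<close>

definition drefl :: "'a::euclidean_space \<Rightarrow> 'a \<Rightarrow> 'a \<Rightarrow> 'a" where
  "drefl z v d = (2 * (z \<bullet> d)) *\<^sub>R v - (2 * (d \<bullet> v)) *\<^sub>R z - (2 * (z \<bullet> v)) *\<^sub>R d"

lemma has_derivative_refl: "((\<lambda>z. srefl z v) has_derivative drefl z v) (at z)"
  unfolding srefl_def[abs_def] drefl_def[abs_def]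
  by (rule derivative_eq_intros refl | simp add: inner_commute algebra_simps)+

lemma linear_drefl: "linear (drefl z v)"
  using has_derivative_refl has_derivative_linear by blast

lemma drefl_self: "drefl z v z = 2 *\<^sub>R srefl z v"
  by (rule euclidean_eqI) (simp add: drefl_def srefl_def inner_simps algebra_simps)

text \<open>Along the parameter v itself the derivative is radial; this is why second derivatives of
  h survive only as \<open>z \<bullet> hess h (srefl z v) z\<close>.\<close>

lemma drefl_param: "drefl z v v = (- 2 * (v \<bullet> v)) *\<^sub>R z"
  by (simp add: drefl_def algebra_simps)

lemma linear_inner_compose: "linear A \<Longrightarrow> linear (\<lambda>d. u \<bullet> A d)"
  by (rule linearI) (simp_all add: linear_add linear_scale inner_add_right)

text \<open>\<open>drefl z v\<close> is an antisymmetric map minus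
  \<open>2 * (z \<bullet> v)\<close> times the identity. Against a symmetric A the first part has
  trace 0, and the second does because A is trace-free; harmonicity of h enters the divergences
  here.\<close>

lemma tr_drefl:
  assumes A: "linear A" and sym: "\<And>x y. A x \<bullet> y = x \<bullet> A y" and 0: "tr A = 0"
  shows "tr (\<lambda>d. A (drefl z v d)) = 0"
proof -
  have "(\<lambda>d. A (drefl z v d)) = (\<lambda>d. (2 * (z \<bullet> d)) *\<^sub>R A v - (2 * (d \<bullet> v)) *\<^sub>R A z - (2 * (z \<bullet> v)) *\<^sub>R A d)"
    by (simp add: drefl_def linear_diff[OF A] linear_scale[OF A])
  moreover have "linear (\<lambda>d. 2 * (z \<bullet> d))" "linear (\<lambda>d. 2 * (d \<bullet> v))"
    by (auto intro!: linearI simp: inner_simps algebra_simps)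
  ultimately show ?thesis
    by (simp only: tr_diff tr_scaleR tr_rank1 0 sym)
qed

lemma inner_refl_self: "z \<bullet> srefl z u = - (z \<bullet> z) * (z \<bullet> u)"
  by (simp add: srefl_def inner_simps algebra_simps)

text \<open>\<open>srefl z\<close> is a multiple of the identity plus a rank-one map, and the trace
  of A removes the first part.\<close>

lemma tr_refl_compose:
  assumes A: "linear A" and 0: "tr A = 0"
  shows "tr (\<lambda>d. srefl z (A d)) = - 2 * (z \<bullet> A z)"
proof -
  have "linear (\<lambda>d. 2 * (z \<bullet> A d))"
    by (rule linearI) (simp_all add: linear_add[OF A] linear_scale[OF A] inner_simps algebra_simps)
  then show ?thesis unfolding srefl_def by (simp only: tr_diff tr_scaleR tr_rank1 0)
qed

section \<open>Divergences of fields built from the derivatives of h at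
  \<open>srefl z v\<close>\<close>

context
  fixes h :: "'a::euclidean_space \<Rightarrow> real" and k :: nat
  assumes h: "h \<in> harmonic_polys k"
begin

private lemma p: "real_polynomial_function h" by (rule harmonic_polys_poly[OF h])

private lemma hess_props:
  "linear (hess h w)" "hess h w x \<bullet> y = x \<bullet> hess h w y" "tr (hess h w) = 0"
  "hess h w w = (real k - 1) *\<^sub>R grad h w" "w \<bullet> grad h w = real k * h w"
  using linear_hess[OF p] hess_symmetric[OF p] hess_trace[OF h] euler_grad[OF h] euler_harmonic[OF h]
    inner_grad[OF p, of w w]
  by (simp_all add: tr_def inner_commute)

private lemma has_derivative_grad_refl:
  "((\<lambda>z. grad h (srefl z v)) has_derivative (\<lambda>d. hess h (srefl z v) (drefl z v d))) (at z)"
  by (rule has_derivative_compose[OF has_derivative_refl has_derivative_grad[OF p]])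

private lemma has_derivative_inner_grad_refl:
  "((\<lambda>z. z \<bullet> grad h (srefl z v)) has_derivative
     (\<lambda>d. d \<bullet> grad h (srefl z v) + z \<bullet> hess h (srefl z v) (drefl z v d))) (at z)"
  using has_derivative_inner[OF has_derivative_ident has_derivative_grad_refl[of v z]]
  by (simp add: add.commute)

private lemma linear_hess_drefl: "linear (\<lambda>d. hess h (srefl z v) (drefl z v d))"
  using linear_compose[OF linear_drefl hess_props(1)] by (simp add: o_def)

private lemma linear_inner_grad_refl:
  "linear (\<lambda>d. d \<bullet> grad h (srefl z v) + z \<bullet> hess h (srefl z v) (drefl z v d))"
  using has_derivative_inner_grad_refl has_derivative_linear by blast

text \<open>\<open>tr_drefl\<close> removes the trace of the differentiated gradient, so only
  rank-one and scalar terms remain; Euler's identity for the gradient collects them. The factor is 2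
  N for N = m + 2k - 2.\<close>

lemma dvg_refl_grad:
  "dvg (\<lambda>z. srefl z (grad h (srefl z v))) z = - (2 * DIM('a) + 4 * real k - 4) * (z \<bullet> grad h (srefl z v))"
proof -
  define G where "G = grad h (srefl z v)"
  define A where "A = hess h (srefl z v)"
  note A = hess_props[of "srefl z v", folded A_def G_def]
  note lin = linear_inner_grad_refl[of z v, folded A_def G_def]
  have "((\<lambda>z. srefl z (grad h (srefl z v))) has_derivative
    (\<lambda>d. (2 * (z \<bullet> d)) *\<^sub>R G + (z \<bullet> z) *\<^sub>R A (drefl z v d)
       - ((2 * (d \<bullet> G + z \<bullet> A (drefl z v d))) *\<^sub>R z + (2 * (z \<bullet> G)) *\<^sub>R d))) (at z)"
    unfolding srefl_def[of _ "grad h _"] G_def A_def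
    by (rule derivative_eq_intros has_derivative_grad_refl has_derivative_inner_grad_refl refl | simp add: inner_commute algebra_simps)+
  then have "dvg (\<lambda>z. srefl z (grad h (srefl z v))) z = tr (\<lambda>d. (2 * (z \<bullet> d)) *\<^sub>R G + (z \<bullet> z) *\<^sub>R A (drefl z v d)
       - ((2 * (d \<bullet> G + z \<bullet> A (drefl z v d))) *\<^sub>R z + (2 * (z \<bullet> G)) *\<^sub>R d))"
    by (rule dvg_eqI)
  also have "\<dots> = 2 * (z \<bullet> G) - (2 * (z \<bullet> G + z \<bullet> A (drefl z v z)) + 2 * (z \<bullet> G) * DIM('a))"
  proof -
    have "linear (\<lambda>d. 2 * (z \<bullet> d))" by (auto intro!: linearI simp: inner_simps algebra_simps)
    moreover have "linear (\<lambda>d. 2 * (d \<bullet> G + z \<bullet> A (drefl z v d)))"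
      using linear_compose_scale_right[OF lin, of 2] by simp
    ultimately show ?thesis
      by (simp only: tr_diff tr_add tr_scaleR tr_rank1 tr_id tr_drefl[OF A(1-3)])
  qed
  also have "\<dots> = - (2 * DIM('a) + 4 * real k - 4) * (z \<bullet> G)"
    by (simp add: drefl_self linear_scale[OF A(1)] A(4) algebra_simps)
  finally show ?thesis by (simp add: G_def)
qed

text \<open>By \<open>dir_deriv_harmonic_refl\<close> the field is the gradient of z \<mapsto>
  \<open>h (srefl z v)\<close>, so this is the Laplacian of that polynomial in z.\<close>

lemma dvg_grad_harmonic_refl:
  "dvg (\<lambda>z. (2 * (v \<bullet> grad h (srefl z v))) *\<^sub>R z - (2 * (z \<bullet> grad h (srefl z v))) *\<^sub>R v - (2 * (z \<bullet> v)) *\<^sub>R grad h (srefl z v)) z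
    = (2 * DIM('a) + 4 * real k - 8) * (v \<bullet> grad h (srefl z v)) + 4 * (v \<bullet> v) * (z \<bullet> hess h (srefl z v) z)"
proof -
  define G where "G = grad h (srefl z v)"
  define A where "A = hess h (srefl z v)"
  note A = hess_props[of "srefl z v", folded A_def G_def]
  note lin = linear_inner_grad_refl[of z v, folded A_def G_def]
  have "((\<lambda>z. (2 * (v \<bullet> grad h (srefl z v))) *\<^sub>R z - (2 * (z \<bullet> grad h (srefl z v))) *\<^sub>R v - (2 * (z \<bullet> v)) *\<^sub>R grad h (srefl z v))
     has_derivative
    (\<lambda>d. ((2 * (v \<bullet> A (drefl z v d))) *\<^sub>R z + (2 * (v \<bullet> G)) *\<^sub>R d)
       - (2 * (d \<bullet> G + z \<bullet> A (drefl z v d))) *\<^sub>R v - ((2 * (d \<bullet> v)) *\<^sub>R G + (2 * (z \<bullet> v)) *\<^sub>R A (drefl z v d)))) (at z)"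
    unfolding G_def A_def
    by (rule derivative_eq_intros has_derivative_grad_refl has_derivative_inner_grad_refl refl | simp add: inner_commute algebra_simps)+
  then have "dvg (\<lambda>z. (2 * (v \<bullet> grad h (srefl z v))) *\<^sub>R z - (2 * (z \<bullet> grad h (srefl z v))) *\<^sub>R v - (2 * (z \<bullet> v)) *\<^sub>R grad h (srefl z v)) z
     = tr (\<lambda>d. ((2 * (v \<bullet> A (drefl z v d))) *\<^sub>R z + (2 * (v \<bullet> G)) *\<^sub>R d)
       - (2 * (d \<bullet> G + z \<bullet> A (drefl z v d))) *\<^sub>R v - ((2 * (d \<bullet> v)) *\<^sub>R G + (2 * (z \<bullet> v)) *\<^sub>R A (drefl z v d)))"
    by (rule dvg_eqI)
  also have "\<dots> = (2 * (v \<bullet> A (drefl z v z)) + 2 * (v \<bullet> G) * DIM('a)) - 2 * (v \<bullet> G + z \<bullet> A (drefl z v v)) - 2 * (G \<bullet> v)"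
  proof -
    have "linear (\<lambda>d. 2 * (d \<bullet> v))" by (auto intro!: linearI simp: inner_simps algebra_simps)
    moreover have "linear (\<lambda>d. 2 * (d \<bullet> G + z \<bullet> A (drefl z v d)))"
      using linear_compose_scale_right[OF lin, of 2] by simp
    moreover have "linear (\<lambda>d. 2 * (v \<bullet> A (drefl z v d)))"
      using linear_compose_scale_right[OF linear_inner_compose[OF linear_hess_drefl[of z v]], of 2 v] by (simp add: A_def)
    ultimately show ?thesis
      by (simp only: tr_diff tr_add tr_scaleR tr_rank1 tr_id tr_drefl[OF A(1-3)])
  qed
  also have "\<dots> = (2 * DIM('a) + 4 * real k - 8) * (v \<bullet> G) + 4 * (v \<bullet> v) * (z \<bullet> A z)"
    by (simp add: drefl_self drefl_param linear_scale[OF A(1)] linear_neg[OF A(1)] A(4) inner_commute[of G] algebra_simps)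
  finally show ?thesis by (simp add: G_def A_def)
qed

text \<open>As v is constant, this is the derivative of
  \<open>z \<bullet> grad h (srefl z v)\<close> along v, and \<open>drefl_param\<close> makes its
  inner derivative radial.\<close>

lemma dvg_inner_grad_scaleR_param:
  "dvg (\<lambda>z. (z \<bullet> grad h (srefl z v)) *\<^sub>R v) z
    = v \<bullet> grad h (srefl z v) - 2 * (v \<bullet> v) * (z \<bullet> hess h (srefl z v) z)"
proof -
  have "((\<lambda>z. (z \<bullet> grad h (srefl z v)) *\<^sub>R v) has_derivative
     (\<lambda>d. (d \<bullet> grad h (srefl z v) + z \<bullet> hess h (srefl z v) (drefl z v d)) *\<^sub>R v)) (at z)"
    by (rule has_derivative_scaleR_left[OF has_derivative_inner_grad_refl])
  then show ?thesis
    by (simp only: dvg_eqI tr_rank1[OF linear_inner_grad_refl])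
       (simp add: drefl_param linear_scale[OF hess_props(1)] linear_neg[OF hess_props(1)])
qed

text \<open>The scalar factor is homogeneous of degree 2k - 2 in z, and Euler's identity adds this
  degree to the divergence m of the identity field.\<close>

lemma dvg_param_grad_scaleR:
  "dvg (\<lambda>z. (v \<bullet> grad h (srefl z v)) *\<^sub>R z) z = (DIM('a) + 2 * real k - 2) * (v \<bullet> grad h (srefl z v))"
proof -
  have "((\<lambda>z. (v \<bullet> grad h (srefl z v)) *\<^sub>R z) has_derivative
     (\<lambda>d. (v \<bullet> hess h (srefl z v) (drefl z v d)) *\<^sub>R z + (v \<bullet> grad h (srefl z v)) *\<^sub>R d)) (at z)"
    by (rule derivative_eq_intros has_derivative_grad_refl refl | simp add: algebra_simps)+
  then show ?thesis
    by (simp only: dvg_eqI tr_add tr_scaleR tr_id tr_rank1[OF linear_inner_compose[OF linear_hess_drefl]])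
       (simp add: drefl_self linear_scale[OF hess_props(1)] hess_props(4) algebra_simps)
qed

lemma dir_deriv_harmonic_refl:
  "dir_deriv d (\<lambda>z. h (srefl z v)) z =
    ((2 * (v \<bullet> grad h (srefl z v))) *\<^sub>R z - (2 * (z \<bullet> grad h (srefl z v))) *\<^sub>R v - (2 * (z \<bullet> v)) *\<^sub>R grad h (srefl z v)) \<bullet> d"
proof -
  have "((\<lambda>z. h (srefl z v)) has_derivative (\<lambda>d. grad h (srefl z v) \<bullet> drefl z v d)) (at z)"
    by (rule has_derivative_compose[OF has_derivative_refl has_derivative_grad_inner[OF p]])
  then have "dir_deriv d (\<lambda>z. h (srefl z v)) z = grad h (srefl z v) \<bullet> drefl z v d" by (rule dir_deriv_eqI)
  then show ?thesis by (simp add: drefl_def inner_simps inner_commute algebra_simps)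
qed

text \<open>Euler's identity for h at \<open>srefl z v\<close>, with the reflection expanded: a
  linear relation between h and the two gradient terms.\<close>

lemma euler_refl:
  "(z \<bullet> z) * (v \<bullet> grad h (srefl z v)) = real k * h (srefl z v) + 2 * (z \<bullet> v) * (z \<bullet> grad h (srefl z v))"
  using hess_props(5)[of "srefl z v"] by (simp add: srefl_def[of z v] inner_diff_left)

end

text \<open>The components of \<open>hess h\<close> are gradients of harmonic polynomials of degree \<open>k - 1\<close>, to
  which \<open>dvg_refl_grad\<close> applies; this avoids third derivatives.\<close>

lemma dvg_refl_hess:
  fixes h :: "'a::euclidean_space \<Rightarrow> real"
  assumes h: "h \<in> harmonic_polys k" and P: "polynomial_function P" "(P has_derivative P') (at z)"
  shows "dvg (\<lambda>z. srefl z (hess h (srefl z v) (P z))) z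
    = - (2 * DIM('a) + 4 * real k - 8) * (z \<bullet> hess h (srefl z v) (P z)) + tr (\<lambda>d. srefl z (hess h (srefl z v) (P' d)))"
proof -
  note p = harmonic_polys_poly[OF h]
  define Y where "Y c z = srefl z (grad (dir_deriv c h) (srefl z v))" for c z
  have Y: "Y c z = srefl z (hess h (srefl z v) c)" for c z
    by (simp add: Y_def grad_dir_deriv[OF p])
  have lin: "linear (\<lambda>c. srefl z (hess h (srefl z v) c))" for z
    using linear_compose[OF linear_hess[OF p] linear_refl] by (simp add: o_def)
  have expand: "srefl z (hess h (srefl z v) u) = (\<Sum>c\<in>Basis. (u \<bullet> c) *\<^sub>R Y c z)" for u z
  proof -
    have "srefl z (hess h (srefl z v) u) = srefl z (hess h (srefl z v) (\<Sum>c\<in>Basis. (u \<bullet> c) *\<^sub>R c))"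
      by (simp only: euclidean_representation)
    also have "\<dots> = (\<Sum>c\<in>Basis. (u \<bullet> c) *\<^sub>R Y c z)"
      by (simp only: linear_sum[OF lin] linear_scale[OF lin] Y)
    finally show ?thesis .
  qed
  have polyY: "polynomial_function (Y c)" for c
    unfolding Y_def[abs_def] by (intro poly_intros p)
  have dY: "dvg (Y c) z = - (2 * DIM('a) + 4 * real k - 8) * (z \<bullet> hess h (srefl z v) c)" for c
  proof (cases "k = 0")
    \<comment> \<open>For k = 0 the truncated degree k - 1 would give the factor 2 m - 4 instead of
      2 m - 8; the field is 0, so the claim still holds.\<close>
    case True
    then have "dir_deriv c h = (\<lambda>x. 0)" for c using h dir_deriv_degree_0 by blast
    then have "hess h x c = 0" for x c by (simp add: hess_def dir_deriv_const)
    then show ?thesis unfolding Y by (simp add: dvg_def srefl_def dir_deriv_const)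
  next
    case False
    then have "2 * real DIM('a) + 4 * real (k - 1) - 4 = 2 * real DIM('a) + 4 * real k - 8" by (cases k) auto
    then show ?thesis
      using dvg_refl_grad[OF dir_deriv_harmonic[OF h], of c v z] unfolding Y_def grad_dir_deriv[OF p] by simp
  qed
  have "dvg (\<lambda>z. srefl z (hess h (srefl z v) (P z))) z = (\<Sum>b\<in>Basis. dir_deriv b (\<lambda>z. \<Sum>c\<in>Basis. (P z \<bullet> c) * (Y c z \<bullet> b)) z)"
    unfolding dvg_def expand by (simp add: inner_sum_left)
  also have "\<dots> = (\<Sum>b\<in>Basis. \<Sum>c\<in>Basis. (P z \<bullet> c) * dir_deriv b (\<lambda>z. Y c z \<bullet> b) z + (P' b \<bullet> c) * (Y c z \<bullet> b))"
    by (intro sum.cong refl dir_deriv_eqI has_derivative_sum has_derivative_mult has_derivative_inner_left P(2)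
        has_derivative_dir_deriv polynomial_function_imp_inner polyY)
  also have "\<dots> = (\<Sum>c\<in>Basis. (P z \<bullet> c) * dvg (Y c) z) + (\<Sum>b\<in>Basis. \<Sum>c\<in>Basis. (P' b \<bullet> c) * (Y c z \<bullet> b))"
    by (simp only: sum.distrib dvg_def sum_distrib_left, subst sum.swap, rule refl)
  also have "(\<Sum>b\<in>Basis. \<Sum>c\<in>Basis. (P' b \<bullet> c) * (Y c z \<bullet> b)) = tr (\<lambda>d. srefl z (hess h (srefl z v) (P' d)))"
    unfolding tr_def expand by (simp add: inner_sum_left)
  also have "(\<Sum>c\<in>Basis. (P z \<bullet> c) * dvg (Y c) z) = - (2 * DIM('a) + 4 * real k - 8) * (z \<bullet> hess h (srefl z v) (P z))"
  proof -
    have "z \<bullet> hess h (srefl z v) (P z) = (\<Sum>c\<in>Basis. (P z \<bullet> c) * (z \<bullet> hess h (srefl z v) c))"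
      by (subst hess_eq_sum[OF p]) (simp add: inner_sum_right)
    then show ?thesis by (simp only: dY sum_distrib_left mult.left_commute)
  qed
  finally show ?thesis .
qed

lemma dvg_refl_hess_self:
  fixes h :: "'a::euclidean_space \<Rightarrow> real"
  assumes h: "h \<in> harmonic_polys k"
  shows "dvg (\<lambda>z. srefl z (hess h (srefl z v) z)) z = - (2 * DIM('a) + 4 * real k - 6) * (z \<bullet> hess h (srefl z v) z)"
proof -
  note p = harmonic_polys_poly[OF h]
  have "tr (\<lambda>d. srefl z (hess h (srefl z v) d)) = - 2 * (z \<bullet> hess h (srefl z v) z)"
    by (rule tr_refl_compose[OF linear_hess[OF p]]) (use hess_trace[OF h] in \<open>simp add: tr_def\<close>)
  then show ?thesis
    using dvg_refl_hess[OF h polynomial_function_id has_derivative_ident, of v z] by (simp add: algebra_simps)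
qed

text \<open>Here P is \<open>srefl z a\<close>. Its trace contributes another -4 and restores the
  factor 2 N of \<open>dvg_refl_grad\<close>, so both fields lead to the same weight 2 N - 2 t |z|^2
  later.\<close>

lemma dvg_refl_hess_refl:
  fixes h :: "'a::euclidean_space \<Rightarrow> real"
  assumes h: "h \<in> harmonic_polys k"
  shows "dvg (\<lambda>z. srefl z (hess h (srefl z v) (srefl z a))) z
    = - (2 * DIM('a) + 4 * real k - 4) * (srefl z (hess h (srefl z v) z) \<bullet> a)"
proof -
  note p = harmonic_polys_poly[OF h]
  define A where "A = hess h (srefl z v)"
  have A: "linear A" "A x \<bullet> y = x \<bullet> A y" "tr A = 0" for x y
    unfolding A_def using linear_hess[OF p] hess_symmetric[OF p] hess_trace[OF h] by (auto simp: tr_def)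
  have lin: "linear (\<lambda>c. srefl z (A c))"
    using linear_compose[OF A(1) linear_refl] by (simp add: o_def)
  have "(\<lambda>d. srefl z (A (drefl z a d))) = (\<lambda>d. (2 * (z \<bullet> d)) *\<^sub>R srefl z (A a) - (2 * (d \<bullet> a)) *\<^sub>R srefl z (A z)
      - (2 * (z \<bullet> a)) *\<^sub>R srefl z (A d))"
    by (simp add: drefl_def linear_diff[OF lin] linear_scale[OF lin])
  moreover have "linear (\<lambda>d. 2 * (z \<bullet> d))" "linear (\<lambda>d. 2 * (d \<bullet> a))"
    by (auto intro!: linearI simp: inner_simps algebra_simps)
  ultimately have "tr (\<lambda>d. srefl z (A (drefl z a d))) = 2 * (z \<bullet> srefl z (A a)) - 2 * (srefl z (A z) \<bullet> a) - 2 * (z \<bullet> a) * (- 2 * (z \<bullet> A z))"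
    by (simp only: tr_diff tr_scaleR tr_rank1 tr_refl_compose[OF A(1) A(3)])
  also have "\<dots> = - 4 * (srefl z (A z) \<bullet> a)"
    by (simp add: srefl_def inner_simps A(2) inner_commute[of z a] algebra_simps)
  finally have "tr (\<lambda>d. srefl z (A (drefl z a d))) = - 4 * (srefl z (A z) \<bullet> a)" .
  moreover have "z \<bullet> A (srefl z a) = srefl z (A z) \<bullet> a"
    by (simp add: refl_adjoint A(2))
  ultimately show ?thesis
    using dvg_refl_hess[OF h polynomial_function_refl[OF polynomial_function_const] has_derivative_refl, of v a z]
    by (simp add: A_def algebra_simps)
qed

section \<open>Gaussian moments\<close>

text \<open>Allowing every \<delta> > 0 makes the induction close: a product splits \<delta> into
  halves, and no degrees have to be tracked.\<close>

lemma real_polynomial_function_exp_bound: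
  fixes p :: "'a::euclidean_space \<Rightarrow> real"
  assumes "real_polynomial_function p" "\<delta> > 0"
  shows "\<exists>C>0. \<forall>z. \<bar>p z\<bar> \<le> C * exp (\<delta> * (z \<bullet> z))"
  using assms
proof (induction arbitrary: \<delta>)
  case (linear f)
  then obtain K where K: "K > 0" "\<And>x. norm (f x) \<le> norm x * K" using bounded_linear.pos_bounded by blast
  have "\<bar>f z\<bar> \<le> K * (1 + 1 / \<delta>) * exp (\<delta> * (z \<bullet> z))" for z
  proof -
    have "2 * norm z \<le> 1 + (norm z)\<^sup>2" using zero_le_power2[of "norm z - 1"]
      by (simp add: power2_eq_square algebra_simps)
    then have "norm z \<le> 1 + (norm z)\<^sup>2" using norm_ge_zero[of z] by linarith
    also have "\<dots> \<le> (1 + 1 / \<delta>) * (1 + \<delta> * (z \<bullet> z))"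
      using linear.prems by (simp add: dot_square_norm field_simps)
    also have "\<dots> \<le> (1 + 1 / \<delta>) * exp (\<delta> * (z \<bullet> z))"
      using linear.prems by (intro mult_left_mono exp_ge_add_one_self) auto
    finally have "norm z \<le> (1 + 1 / \<delta>) * exp (\<delta> * (z \<bullet> z))" .
    then have "K * norm z \<le> K * ((1 + 1 / \<delta>) * exp (\<delta> * (z \<bullet> z)))" using K by (intro mult_left_mono) auto
    then show ?thesis using K(2)[of z] by (simp add: mult_ac)
  qed
  moreover have "K * (1 + 1 / \<delta>) > 0" using K linear.prems by (simp add: add_pos_pos)
  ultimately show ?case by blast
next
  case (const c)
  have "\<bar>c\<bar> \<le> (\<bar>c\<bar> + 1) * exp (\<delta> * (z \<bullet> z))" for z :: 'a
    using mult_mono[of "\<bar>c\<bar>" "\<bar>c\<bar> + 1" 1 "exp (\<delta> * (z \<bullet> z))"] const by simp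
  then show ?case by (intro exI[of _ "\<bar>c\<bar> + 1"]) auto
next
  case (add f g)
  obtain C D where "C > 0" "\<And>z. \<bar>f z\<bar> \<le> C * exp (\<delta> * (z \<bullet> z))" "D > 0" "\<And>z. \<bar>g z\<bar> \<le> D * exp (\<delta> * (z \<bullet> z))"
    using add by metis
  then have "C + D > 0" "\<bar>f z + g z\<bar> \<le> (C + D) * exp (\<delta> * (z \<bullet> z))" for z
    by (auto simp: distrib_right intro!: order_trans[OF abs_triangle_ineq] add_mono)
  then show ?case by blast
next
  case (mult f g)
  have "\<delta> / 2 > 0" using mult.prems by simp
  then obtain C D where CD: "C > 0" "\<And>z. \<bar>f z\<bar> \<le> C * exp (\<delta> / 2 * (z \<bullet> z))" "D > 0" "\<And>z. \<bar>g z\<bar> \<le> D * exp (\<delta> / 2 * (z \<bullet> z))"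
    using mult.IH by metis
  have "\<bar>f z * g z\<bar> \<le> C * D * exp (\<delta> * (z \<bullet> z))" for z
  proof -
    have "\<bar>f z * g z\<bar> \<le> (C * exp (\<delta> / 2 * (z \<bullet> z))) * (D * exp (\<delta> / 2 * (z \<bullet> z)))"
      unfolding abs_mult using CD by (intro mult_mono) auto
    also have "\<dots> = C * D * (exp (\<delta> / 2 * (z \<bullet> z)) * exp (\<delta> / 2 * (z \<bullet> z)))" by (simp only: mult_ac)
    also have "\<dots> = C * D * exp (\<delta> * (z \<bullet> z))" unfolding exp_add[symmetric] by simp
    finally show ?thesis .
  qed
  moreover have "C * D > 0" using CD by simp
  ultimately show ?case by blast
qed

lemma borel_measurable_real_polynomial_function:
  fixes p :: "'a::euclidean_space \<Rightarrow> real"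
  shows "real_polynomial_function p \<Longrightarrow> p \<in> borel_measurable borel"
  by (intro borel_measurable_continuous_onI continuous_on_real_polynomial_function)

lemma integrable_gaussian_polynomial:
  fixes p :: "'a::euclidean_space \<Rightarrow> real"
  assumes p: "real_polynomial_function p"
  shows "integrable lborel (\<lambda>z. exp (- (z \<bullet> z)) * p z)"
proof -
  note [measurable] = borel_measurable_real_polynomial_function[OF p]
  obtain C where C: "C > 0" "\<And>z. \<bar>p z\<bar> \<le> C * exp (1 / 2 * (z \<bullet> z))"
    using real_polynomial_function_exp_bound[OF p, of "1 / 2"] by auto
  show ?thesis
  proof (rule Bochner_Integration.integrable_bound)
    show "integrable lborel (\<lambda>z::'a. C * exp (- (1 / 2) * (norm z)\<^sup>2))"
      by (intro integrable_mult_right integrable_gaussian) simp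
    show "AE z in lborel. norm (exp (- (z \<bullet> z)) * p z) \<le> norm (C * exp (- (1 / 2) * (norm z)\<^sup>2))"
    proof (rule AE_I2)
      fix z :: 'a
      have "norm (exp (- (z \<bullet> z)) * p z) \<le> exp (- (z \<bullet> z)) * (C * exp (1 / 2 * (z \<bullet> z)))"
        using C(2)[of z] by (simp add: abs_mult)
      also have "\<dots> = C * (exp (- (z \<bullet> z)) * exp (1 / 2 * (z \<bullet> z)))" by (simp only: mult_ac)
      also have "\<dots> = C * exp (- (1 / 2) * (norm z)\<^sup>2)" unfolding exp_add[symmetric] by (simp add: dot_square_norm)
      finally show "norm (exp (- (z \<bullet> z)) * p z) \<le> norm (C * exp (- (1 / 2) * (norm z)\<^sup>2))" using C(1) by simp
    qed
  qed measurable
qed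

definition gauss :: "('a::euclidean_space \<Rightarrow> real) \<Rightarrow> real" where
  "gauss p = (LINT z|lborel. exp (- (z \<bullet> z)) * p z)"

lemma gauss_add:
  assumes "real_polynomial_function p" "real_polynomial_function q"
  shows "gauss (\<lambda>z. p z + q z) = gauss p + gauss q"
  using assms[THEN integrable_gaussian_polynomial] by (simp add: gauss_def distrib_left)

lemma gauss_diff:
  assumes "real_polynomial_function p" "real_polynomial_function q"
  shows "gauss (\<lambda>z. p z - q z) = gauss p - gauss q"
  using assms[THEN integrable_gaussian_polynomial] by (simp add: gauss_def right_diff_distrib)

lemma gauss_cmult: "gauss (\<lambda>z. c * p z) = c * gauss p"
proof -
  have "gauss (\<lambda>z. c * p z) = (LINT z|lborel. c * (exp (- (z \<bullet> z)) * p z))"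
    unfolding gauss_def by (simp only: mult_ac)
  then show ?thesis by (simp add: gauss_def)
qed

lemma gauss_sum:
  assumes "\<And>i. i \<in> I \<Longrightarrow> real_polynomial_function (p i)"
  shows "gauss (\<lambda>z. \<Sum>i\<in>I. p i z) = (\<Sum>i\<in>I. gauss (p i))"
  using assms[THEN integrable_gaussian_polynomial] by (simp add: gauss_def sum_distrib_left)

lemma gauss_const:
  "gauss (\<lambda>z::'a::euclidean_space. c) = c * (unit_ball_vol DIM('a) * Gamma (DIM('a) / 2 + 1))"
  using has_bochner_integral_gaussian[where 'a='a]
  by (simp add: gauss_def has_bochner_integral_iff dot_square_norm mult.commute)

lemma gauss_dir_deriv:
  fixes p :: "'a::euclidean_space \<Rightarrow> real"
  assumes p: "real_polynomial_function p"
  shows "gauss (dir_deriv b p) = 2 * gauss (\<lambda>z. (z \<bullet> b) * p z)"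
proof -
  define F where "F z = exp (- (z \<bullet> z)) * p z" for z
  define F' where "F' z d = exp (- (z \<bullet> z)) * (dir_deriv d p z - 2 * ((z \<bullet> d) * p z))" for z d
  have F: "(F has_derivative F' z) (at z)" for z
    unfolding F_def F'_def[abs_def]
    by (rule derivative_eq_intros has_derivative_dir_deriv[OF p] refl | simp add: inner_commute algebra_simps)+
  have poly: "real_polynomial_function (\<lambda>z. dir_deriv b p z - 2 * ((z \<bullet> b) * p z))"
    by (intro poly_intros p)
  obtain C where C: "C > 0" "\<And>z. \<bar>dir_deriv b p z - 2 * ((z \<bullet> b) * p z)\<bar> \<le> C * exp (1 / 2 * (z \<bullet> z))"
    using real_polynomial_function_exp_bound[OF poly, of "1 / 2"] by auto
  have "(LINT z|lborel. F' z b) = 0"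
  proof (rule integral_directional_derivative_eq_0(2)[OF F])
    show "integrable lborel F" unfolding F_def by (rule integrable_gaussian_polynomial[OF p])
    show "integrable lborel (\<lambda>z::'a. C * exp (b \<bullet> b / 2) * exp (- (1 / 4) * (norm z)\<^sup>2))"
      by (intro integrable_mult_right integrable_gaussian) simp
    fix z :: 'a and t :: real assume t: "\<bar>t\<bar> \<le> 1"
    define y where "y = z + t *\<^sub>R b"
    \<comment> \<open>The derivative is evaluated at y, but the majorant must depend on z alone;
      |z|^2 \<le> 2 |y|^2 + 2 |b|^2 costs half of the exponent.\<close>
    have "norm z \<le> norm y + norm b"
    proof -
      have "norm z \<le> norm y + norm (t *\<^sub>R b)" using norm_triangle_ineq4[of y "t *\<^sub>R b"] by (simp add: y_def)
      moreover have "norm (t *\<^sub>R b) \<le> norm b" using t by (simp add: mult_left_le_one_le)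
      ultimately show ?thesis by simp
    qed
    then have "(norm z)\<^sup>2 \<le> (norm y + norm b)\<^sup>2" by (intro power_mono) auto
    also have "\<dots> \<le> 2 * (norm y)\<^sup>2 + 2 * (norm b)\<^sup>2"
      using zero_le_power2[of "norm y - norm b"] by (simp add: power2_eq_square algebra_simps)
    finally have le: "- (1 / 2) * (y \<bullet> y) \<le> b \<bullet> b / 2 + - (1 / 4) * (norm z)\<^sup>2"
      by (simp add: dot_square_norm)
    have "\<bar>F' y b\<bar> \<le> exp (- (y \<bullet> y)) * (C * exp (1 / 2 * (y \<bullet> y)))"
      using C(2)[of y] by (simp add: F'_def abs_mult)
    also have "\<dots> = C * (exp (- (y \<bullet> y)) * exp (1 / 2 * (y \<bullet> y)))" by (simp only: mult_ac)
    also have "\<dots> = C * exp (- (1 / 2) * (y \<bullet> y))" unfolding exp_add[symmetric] by simp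
    also have "\<dots> \<le> C * exp (b \<bullet> b / 2 + - (1 / 4) * (norm z)\<^sup>2)"
      using C(1) le by (intro mult_left_mono) (simp_all only: exp_le_cancel_iff)
    also have "\<dots> = C * exp (b \<bullet> b / 2) * exp (- (1 / 4) * (norm z)\<^sup>2)" by (simp only: exp_add mult.assoc)
    finally show "\<bar>F' (z + t *\<^sub>R b) b\<bar> \<le> C * exp (b \<bullet> b / 2) * exp (- (1 / 4) * (norm z)\<^sup>2)" by (simp add: y_def)
  qed
  then have "gauss (\<lambda>z. dir_deriv b p z - 2 * ((z \<bullet> b) * p z)) = 0"
    by (simp add: gauss_def F'_def)
  moreover have "gauss (\<lambda>z. dir_deriv b p z - 2 * ((z \<bullet> b) * p z)) = gauss (dir_deriv b p) - 2 * gauss (\<lambda>z. (z \<bullet> b) * p z)"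
    by (subst gauss_diff, intro poly_intros p, intro poly_intros p, simp only: gauss_cmult)
  ultimately show ?thesis by simp
qed

text \<open>The divergence theorem for the Gaussian weight, whose gradient is -2 z times the weight.
  It is the source of all moment relations below.\<close>

lemma gauss_dvg:
  fixes X :: "'a::euclidean_space \<Rightarrow> 'a"
  assumes X: "polynomial_function X"
  shows "gauss (dvg X) = 2 * gauss (\<lambda>z. z \<bullet> X z)"
proof -
  have "gauss (dvg X) = (\<Sum>b\<in>Basis. gauss (dir_deriv b (\<lambda>z. X z \<bullet> b)))"
    unfolding dvg_def[abs_def]
    by (intro gauss_sum real_polynomial_function_dir_deriv polynomial_function_imp_inner X)
  also have "\<dots> = (\<Sum>b\<in>Basis. 2 * gauss (\<lambda>z. (z \<bullet> b) * (X z \<bullet> b)))"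
    by (intro sum.cong refl gauss_dir_deriv polynomial_function_imp_inner X)
  also have "\<dots> = 2 * gauss (\<lambda>z. \<Sum>b\<in>Basis. (z \<bullet> b) * (X z \<bullet> b))"
    by (subst gauss_sum) (auto intro!: poly_intros X simp: sum_distrib_left)
  finally show ?thesis by (simp only: euclidean_inner[symmetric])
qed

section \<open>Relations between the Gaussian moments of a reflected harmonic polynomial\<close>

context
  fixes h :: "'a::euclidean_space \<Rightarrow> real" and k :: nat and v :: 'a
  assumes h: "h \<in> harmonic_polys k"
begin

private lemma poly_h: "real_polynomial_function h" by (rule harmonic_polys_poly[OF h])

private lemma poly_refl: "polynomial_function (\<lambda>z. srefl z v)"
  by (intro poly_intros)

private lemma polys:
  "real_polynomial_function (\<lambda>z. h (srefl z v))"
  "real_polynomial_function (\<lambda>z. v \<bullet> grad h (srefl z v))"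
  "real_polynomial_function (\<lambda>z. z \<bullet> grad h (srefl z v))"
  "real_polynomial_function (\<lambda>z. z \<bullet> hess h (srefl z v) z)"
  "real_polynomial_function (\<lambda>z. (z \<bullet> v) * (z \<bullet> grad h (srefl z v)))"
  by (rule real_polynomial_function_compose'[OF poly_h poly_refl] | intro poly_intros poly_h)+

text \<open>The relations result from integrating by parts against the gradient of \<open>z \<mapsto> h (srefl z v)\<close> and
  against the fields \<open>(z \<bullet> grad h) v\<close>, \<open>(v \<bullet> grad h) z\<close> and \<open>srefl z (hess h z)\<close>, all derivatives
  of \<open>h\<close> being taken at \<open>srefl z v\<close>.\<close>

lemma gauss_moment_relations:
  defines "q \<equiv> gauss (\<lambda>z. h (srefl z v))" and "V \<equiv> gauss (\<lambda>z. v \<bullet> grad h (srefl z v))"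
    and "a \<equiv> gauss (\<lambda>z. (z \<bullet> v) * (z \<bullet> grad h (srefl z v)))"
    and "b \<equiv> (v \<bullet> v) * gauss (\<lambda>z. z \<bullet> hess h (srefl z v) z)"
    and "b' \<equiv> (v \<bullet> v) * gauss (\<lambda>z. (z \<bullet> z) * (z \<bullet> hess h (srefl z v) z))"
  shows "2 * real k * q = (DIM('a) + 2 * real k - 4) * V" "a = V / 2" "b = 0" "b' = 0"
proof -
  have 1: "(2 * DIM('a) + 4 * real k - 8) * V + 4 * b = 4 * real k * q"
  proof -
    define X where "X z = (2 * (v \<bullet> grad h (srefl z v))) *\<^sub>R z - (2 * (z \<bullet> grad h (srefl z v))) *\<^sub>R v - (2 * (z \<bullet> v)) *\<^sub>R grad h (srefl z v)" for z
    have X: "polynomial_function X" unfolding X_def[abs_def] by (intro poly_intros poly_h)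
    have "z \<bullet> X z = (2 * real k) * h (srefl z v)" for z
      using euler_refl[OF h, of z v] by (simp add: X_def inner_diff_right inner_commute[of z v] algebra_simps)
    then have "gauss (dvg X) = 2 * ((2 * real k) * q)"
      by (simp only: gauss_dvg[OF X] gauss_cmult q_def)
    moreover have "gauss (dvg X) = (2 * DIM('a) + 4 * real k - 8) * V + 4 * (v \<bullet> v) * gauss (\<lambda>z. z \<bullet> hess h (srefl z v) z)"
    proof -
      have "dvg X = (\<lambda>z. (2 * DIM('a) + 4 * real k - 8) * (v \<bullet> grad h (srefl z v)) + 4 * (v \<bullet> v) * (z \<bullet> hess h (srefl z v) z))"
        unfolding X_def[abs_def] using dvg_grad_harmonic_refl[OF h] by (rule ext)
      then show ?thesis
        unfolding V_def
        by (simp only:) (subst gauss_add, intro poly_intros poly_h, intro poly_intros poly_h, simp only: gauss_cmult)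
    qed
    ultimately show ?thesis by (simp add: b_def)
  qed
  have 2: "V - 2 * b = 2 * a"
  proof -
    have X: "polynomial_function (\<lambda>z. (z \<bullet> grad h (srefl z v)) *\<^sub>R v)" by (intro poly_intros poly_h)
    have "gauss (dvg (\<lambda>z. (z \<bullet> grad h (srefl z v)) *\<^sub>R v)) = 2 * a"
      unfolding gauss_dvg[OF X] a_def by (simp add: mult.commute)
    moreover have "gauss (dvg (\<lambda>z. (z \<bullet> grad h (srefl z v)) *\<^sub>R v)) = V - 2 * (v \<bullet> v) * gauss (\<lambda>z. z \<bullet> hess h (srefl z v) z)"
    proof -
      have "dvg (\<lambda>z. (z \<bullet> grad h (srefl z v)) *\<^sub>R v) = (\<lambda>z. v \<bullet> grad h (srefl z v) - 2 * (v \<bullet> v) * (z \<bullet> hess h (srefl z v) z))"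
        using dvg_inner_grad_scaleR_param[OF h] by (rule ext)
      then show ?thesis
        unfolding V_def
        by (simp only:) (subst gauss_diff, intro poly_intros poly_h, intro poly_intros poly_h, simp only: gauss_cmult)
    qed
    ultimately show ?thesis by (simp add: b_def)
  qed
  have 3: "(DIM('a) + 2 * real k - 2) * V = 2 * (real k * q + 2 * a)"
  proof -
    have X: "polynomial_function (\<lambda>z. (v \<bullet> grad h (srefl z v)) *\<^sub>R z)" by (intro poly_intros poly_h)
    have "z \<bullet> (v \<bullet> grad h (srefl z v)) *\<^sub>R z = real k * h (srefl z v) + 2 * ((z \<bullet> v) * (z \<bullet> grad h (srefl z v)))" for z
      using euler_refl[OF h, of z v] by (simp add: mult.commute)
    then have "gauss (dvg (\<lambda>z. (v \<bullet> grad h (srefl z v)) *\<^sub>R z)) = 2 * gauss (\<lambda>z. real k * h (srefl z v) + 2 * ((z \<bullet> v) * (z \<bullet> grad h (srefl z v))))"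
      by (simp only: gauss_dvg[OF X])
    also have "\<dots> = 2 * (real k * q + 2 * a)"
      unfolding q_def a_def
      by (subst gauss_add, intro real_polynomial_function.intros polys, intro real_polynomial_function.intros polys, simp only: gauss_cmult)
    finally have "gauss (dvg (\<lambda>z. (v \<bullet> grad h (srefl z v)) *\<^sub>R z)) = 2 * (real k * q + 2 * a)" .
    moreover have "dvg (\<lambda>z. (v \<bullet> grad h (srefl z v)) *\<^sub>R z) = (\<lambda>z. (DIM('a) + 2 * real k - 2) * (v \<bullet> grad h (srefl z v)))"
      using dvg_param_grad_scaleR[OF h] by (rule ext)
    ultimately show ?thesis unfolding V_def by (simp only: gauss_cmult)
  qed
  have 4: "(2 * DIM('a) + 4 * real k - 6) * b = 2 * b'"
  proof -
    have X: "polynomial_function (\<lambda>z. srefl z (hess h (srefl z v) z))" by (intro poly_intros poly_h)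
    have "gauss (dvg (\<lambda>z. srefl z (hess h (srefl z v) z))) = 2 * gauss (\<lambda>z. - 1 * ((z \<bullet> z) * (z \<bullet> hess h (srefl z v) z)))"
      unfolding gauss_dvg[OF X] inner_refl_self by simp
    moreover have "dvg (\<lambda>z. srefl z (hess h (srefl z v) z)) = (\<lambda>z. - (2 * DIM('a) + 4 * real k - 6) * (z \<bullet> hess h (srefl z v) z))"
      using dvg_refl_hess_self[OF h] by (rule ext)
    ultimately have "- (2 * DIM('a) + 4 * real k - 6) * gauss (\<lambda>z. z \<bullet> hess h (srefl z v) z)
        = - 2 * gauss (\<lambda>z. (z \<bullet> z) * (z \<bullet> hess h (srefl z v) z))" by (simp only: gauss_cmult)
    then have "(2 * DIM('a) + 4 * real k - 6) * gauss (\<lambda>z. z \<bullet> hess h (srefl z v) z)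
        = 2 * gauss (\<lambda>z. (z \<bullet> z) * (z \<bullet> hess h (srefl z v) z))" by (simp add: algebra_simps)
    then show ?thesis unfolding b_def b'_def by (simp only: mult.left_commute[of _ "v \<bullet> v"])
  qed
  \<comment> \<open>Insert \<open>4 * real k * q\<close> from 1 and \<open>2 * a\<close> from 2 into
    twice relation 3: all multiples of V cancel and only b remains.\<close>
  show b: "b = 0" using 1 2 3 by (simp add: algebra_simps)
  show "b' = 0" using 4 b by simp
  show "a = V / 2" using 2 b by simp
  then show "2 * real k * q = (DIM('a) + 2 * real k - 4) * V" using 3 by (simp add: algebra_simps)
qed

end

text \<open>The moment of \<open>v \<bullet> grad h\<close> is the same integral for the polynomial
  \<open>dir_deriv v h\<close>, of degree one less, whose value at v is a multiple of h v by Euler.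
  Each step of the first moment relation adds one factor of the Pochhammer symbol.\<close>

lemma gauss_harmonic_refl:
  fixes h :: "'a::euclidean_space \<Rightarrow> real"
  assumes "h \<in> harmonic_polys k"
  shows "gauss (\<lambda>z. h (srefl z v)) = unit_ball_vol DIM('a) * Gamma (DIM('a) / 2 + 1) * pochhammer (DIM('a) / 2 - 1) k * h v"
  using assms
proof (induction k arbitrary: h)
  case 0
  have "h x = h 0" for x using harmonic_polys_homogeneous[OF 0, of 0 x] by simp
  then have "(\<lambda>z. h (srefl z v)) = (\<lambda>z. h v)" by metis
  then show ?case by (simp add: gauss_const)
next
  case (Suc k)
  note p = harmonic_polys_poly[OF Suc.prems]
  have IH: "gauss (\<lambda>z. v \<bullet> grad h (srefl z v))
    = unit_ball_vol DIM('a) * Gamma (DIM('a) / 2 + 1) * pochhammer (DIM('a) / 2 - 1) k * (real (Suc k) * h v)"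
    using Suc.IH[of "dir_deriv v h"] dir_deriv_harmonic[OF Suc.prems, of v] euler_harmonic[OF Suc.prems, of v]
    by (simp add: inner_grad[OF p] inner_commute[of v])
  have "2 * real (Suc k) * gauss (\<lambda>z. h (srefl z v)) = (DIM('a) + 2 * real (Suc k) - 4) * gauss (\<lambda>z. v \<bullet> grad h (srefl z v))"
    by (rule gauss_moment_relations(1)[OF Suc.prems])
  also have "\<dots> = 2 * real (Suc k) * (unit_ball_vol DIM('a) * Gamma (DIM('a) / 2 + 1) * (pochhammer (DIM('a) / 2 - 1) k * (DIM('a) / 2 - 1 + real k)) * h v)"
    by (simp add: IH algebra_simps)
  finally show ?case by (simp only: pochhammer_Suc mult_cancel_left) simp
qed

section \<open>Integration by parts against Gaussian kernels\<close>

text \<open>The derivative of \<open>exp (- t |z|\<^sup>2) * p z\<close>, without the exponential factor.\<close>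

definition wderiv :: "real \<Rightarrow> 'a::euclidean_space \<Rightarrow> ('a \<Rightarrow> real) \<Rightarrow> 'a \<Rightarrow> real" where
  "wderiv t d p z = dir_deriv d p z - 2 * t * ((z \<bullet> d) * p z)"

text \<open>The divergence of exp (- t |z|^2) X z, again without the exponential factor.\<close>

definition wdvg :: "real \<Rightarrow> ('a::euclidean_space \<Rightarrow> 'a) \<Rightarrow> 'a \<Rightarrow> real" where
  "wdvg t X z = dvg X z - 2 * t * (z \<bullet> X z)"

lemma real_polynomial_function_wderiv:
  "real_polynomial_function p \<Longrightarrow> real_polynomial_function (wderiv t d p)"
  unfolding wderiv_def[abs_def] by (intro poly_intros)

lemma wdvg_eq_sum: "wdvg t X z = (\<Sum>b\<in>Basis. wderiv t b (\<lambda>z. X z \<bullet> b) z)"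
  by (simp add: wdvg_def wderiv_def dvg_def sum_subtractf euclidean_inner[of z "X z"] sum_distrib_left)

lemma dir_deriv_cmult:
  assumes "real_polynomial_function p"
  shows "dir_deriv d (\<lambda>z. c * p z) z = c * dir_deriv d p z"
  by (rule dir_deriv_eqI[OF has_derivative_mult_right[OF has_derivative_dir_deriv[OF assms]]])

lemma dir_deriv_sum:
  assumes "\<And>i. i \<in> I \<Longrightarrow> real_polynomial_function (p i)"
  shows "dir_deriv d (\<lambda>z. \<Sum>i\<in>I. p i z) z = (\<Sum>i\<in>I. dir_deriv d (p i) z)"
  by (rule dir_deriv_eqI[OF has_derivative_sum]) (rule has_derivative_dir_deriv[OF assms])

lemma wderiv_cmult:
  "real_polynomial_function p \<Longrightarrow> wderiv t d (\<lambda>z. c * p z) z = c * wderiv t d p z"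
  by (simp add: wderiv_def dir_deriv_cmult algebra_simps)

lemma wderiv_add:
  "real_polynomial_function p \<Longrightarrow> real_polynomial_function q \<Longrightarrow>
    wderiv t d (\<lambda>z. p z + q z) z = wderiv t d p z + wderiv t d q z"
  by (simp add: wderiv_def dir_deriv_add algebra_simps)

lemma wderiv_sum:
  "(\<And>i. i \<in> I \<Longrightarrow> real_polynomial_function (p i)) \<Longrightarrow>
    wderiv t d (\<lambda>z. \<Sum>i\<in>I. p i z) z = (\<Sum>i\<in>I. wderiv t d (p i) z)"
  by (simp add: wderiv_def dir_deriv_sum sum_subtractf sum_distrib_left)

lemma dir_deriv_inner_mult:
  assumes p: "real_polynomial_function p"
  shows "dir_deriv d (\<lambda>z. (z \<bullet> e) * p z) z = (z \<bullet> e) * dir_deriv d p z + (d \<bullet> e) * p z"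
  by (rule dir_deriv_eqI[OF has_derivative_mult[OF has_derivative_inner_left[OF has_derivative_ident] has_derivative_dir_deriv[OF p]]])

text \<open>These operators are derivatives conjugated by a Gaussian. Integration by parts delivers
  them in the opposite order; swapping them puts b innermost, so that sums over b become weighted
  divergences.\<close>

lemma wderiv_commute:
  assumes p: "real_polynomial_function p"
  shows "wderiv t d (wderiv t e p) z = wderiv t e (wderiv t d p) z"
proof -
  have "wderiv t d (wderiv t e p) z = dir_deriv d (dir_deriv e p) z - 2 * t * ((z \<bullet> e) * dir_deriv d p z + (d \<bullet> e) * p z)
     - 2 * t * ((z \<bullet> d) * (dir_deriv e p z - 2 * t * ((z \<bullet> e) * p z)))" for d e
  proof -
    have "dir_deriv d (wderiv t e p) z = dir_deriv d (\<lambda>z. dir_deriv e p z + (- 2 * t) * ((z \<bullet> e) * p z)) z"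
      by (simp add: wderiv_def[abs_def])
    also have "\<dots> = dir_deriv d (dir_deriv e p) z + (- 2 * t) * ((z \<bullet> e) * dir_deriv d p z + (d \<bullet> e) * p z)"
      by (subst dir_deriv_add, intro poly_intros p, intro poly_intros p, subst dir_deriv_cmult, intro poly_intros p,
          simp only: dir_deriv_inner_mult[OF p])
    finally show ?thesis by (simp add: wderiv_def[of t d] wderiv_def[of t e] )
  qed
  from this[of d e] this[of e d] show ?thesis
    by (simp add: dir_deriv_commute[OF p, of d] inner_commute[of d] algebra_simps)
qed

lemma gaussian_convolution_by_parts:
  fixes p g :: "'a::euclidean_space \<Rightarrow> real"
  assumes p: "real_polynomial_function p"
    and g: "\<And>x. (g has_derivative g' x) (at x)" and g': "continuous_on UNIV (\<lambda>x. g' x d)"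
    and supp: "\<And>x. norm x > r \<Longrightarrow> g x = 0" "\<And>x. norm x > r \<Longrightarrow> g' x d = 0"
  shows "(LINT z|lborel. exp (- t * (z \<bullet> z)) * p z * g' (y - z) d)
    = (LINT z|lborel. exp (- t * (z \<bullet> z)) * wderiv t d p z * g (y - z))"
proof (rule convolution_integration_by_parts[OF _ _ g g' supp])
  show "((\<lambda>z. exp (- t * (z \<bullet> z)) * p z) has_derivative (\<lambda>d. exp (- t * (z \<bullet> z)) * wderiv t d p z)) (at z)" for z
    unfolding wderiv_def
    by (rule derivative_eq_intros has_derivative_dir_deriv[OF p] refl | simp add: inner_commute algebra_simps)+
  show "continuous_on UNIV (\<lambda>z. exp (- t * (z \<bullet> z)) * wderiv t d p z)"
    by (intro continuous_intros continuous_on_real_polynomial_function real_polynomial_function_wderiv p)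
qed

text \<open>\<open>g2 b x a\<close> is the derivative along a of the derivative along b. The
  derivatives are plain functions so that each of them can serve as the smooth factor of a
  convolution.\<close>

locale compactly_supported_C2 =
  fixes g :: "'a::euclidean_space \<Rightarrow> real" and g1 :: "'a \<Rightarrow> 'a \<Rightarrow> real" and g2 :: "'a \<Rightarrow> 'a \<Rightarrow> 'a \<Rightarrow> real" and r :: real
  assumes deriv1: "(g has_derivative g1 x) (at x)"
    and deriv2: "((\<lambda>x. g1 x b) has_derivative g2 b x) (at x)"
    and cont2: "continuous_on UNIV (\<lambda>x. g2 b x a)"
    and supp: "norm x > r \<Longrightarrow> g x = 0" "norm x > r \<Longrightarrow> g1 x a = 0" "norm x > r \<Longrightarrow> g2 b x a = 0"
begin

lemma cont0: "continuous_on UNIV g"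
  using deriv1 by (intro has_derivative_continuous_on) auto

lemma cont1: "continuous_on UNIV (\<lambda>x. g1 x b)"
  using deriv2 by (intro has_derivative_continuous_on) auto

lemma gaussian_convolution_by_parts_2:
  assumes p: "real_polynomial_function p"
  shows "(LINT z|lborel. exp (- t * (z \<bullet> z)) * p z * g2 b (y - z) a)
    = (LINT z|lborel. exp (- t * (z \<bullet> z)) * wderiv t a (wderiv t b p) z * g (y - z))"
  using gaussian_convolution_by_parts[OF p deriv2 cont2 supp(2,3), where t=t and y=y]
    gaussian_convolution_by_parts[OF real_polynomial_function_wderiv[OF p, of t a] deriv1 cont1 supp(1,2), where t=t and y=y]
  by (simp add: wderiv_commute[OF p, of t a])

end

text \<open>N and N - 2 are the two denominators of the bosonic Laplacian, and - N is the exponent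
  of |z| in the kernel.\<close>

locale harmonic_kernel =
  fixes h :: "'a::euclidean_space \<Rightarrow> real" and k :: nat and v :: 'a and N :: real
  assumes h: "h \<in> harmonic_polys k"
    and dim3: "DIM('a) \<ge> 3" and dim4: "DIM('a) \<noteq> 4 \<or> k = 0"
    and N: "N = DIM('a) + 2 * real k - 2"
begin

lemma p: "real_polynomial_function h" by (rule harmonic_polys_poly[OF h])

lemma N_pos: "N > 0" using dim3 by (simp add: N)

abbreviation "q z \<equiv> h (srefl z v)"
abbreviation "hv z \<equiv> v \<bullet> grad h (srefl z v)"
abbreviation "hz z \<equiv> z \<bullet> grad h (srefl z v)"
abbreviation "hzz z \<equiv> z \<bullet> hess h (srefl z v) z"

lemma poly_q: "real_polynomial_function (\<lambda>z. q z)"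
  by (rule real_polynomial_function_compose'[OF p]) (intro poly_intros)

lemmas poly_kernel_intros = poly_intros poly_q p

text \<open>N = 2 forces k = 0, where h is constant. Every term divided by N - 2 then vanishes
  anyway, in agreement with division by zero.\<close>

lemma N_cases: "N \<noteq> 2 \<or> (\<forall>z. hv z = 0 \<and> hz z = 0 \<and> hzz z = 0)"
proof (cases "k = 0")
  case True
  then have 0: "dir_deriv c h x = 0" for c x using h dir_deriv_degree_0 by blast
  then have "dir_deriv c h = (\<lambda>x. 0)" for c by blast
  then show ?thesis using 0 by (simp add: grad_def hess_def dir_deriv_const)
next
  case False
  then show ?thesis using dim3 by (simp add: N)
qed

text \<open>The result of applying the \<open>(a, b)\<close> coefficient of the bosonic Laplacian (a differential
  operator in the second variable) to \<open>v \<mapsto> h (srefl z v)\<close>.\<close>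

definition coef :: "'a \<Rightarrow> 'a \<Rightarrow> 'a \<Rightarrow> real" where
  "coef a b z = (a \<bullet> b) * q z + (- 4 / N * (v \<bullet> a)) * (srefl z (grad h (srefl z v)) \<bullet> b)
     + 4 * (v \<bullet> v) / (N * (N - 2)) * (srefl z (hess h (srefl z v) (srefl z a)) \<bullet> b)"

text \<open>\<open>exp (- t |z|\<^sup>2) * E t z\<close> is what the adjoint bosonic Laplacian makes of the heat-type kernel
  \<open>exp (- t |z|\<^sup>2) * h (srefl z v)\<close>. By \<open>E_eq\<close>, \<open>t\<^bsup>N/2 - 1\<^esup> exp (- t |z|\<^sup>2) * E t z\<close> is the \<open>t\<close>-derivative
  of \<open>t\<^bsup>N/2\<^esup> exp (- t |z|\<^sup>2) * (B0 z + t * B1 z)\<close>, which determines \<open>B0\<close> and \<open>B1\<close>.\<close>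

definition E :: "real \<Rightarrow> 'a \<Rightarrow> real" where
  "E t z = (4 * t\<^sup>2 * (z \<bullet> z) - (2 * DIM('a) + 8 * real k) * t) * q z + (2 * N - 4) * hv z + 4 * (v \<bullet> v) * hzz z
     + 4 / N * ((2 * N - 2 * t * (z \<bullet> z)) * (hv z - 2 * (v \<bullet> v) * hzz z)
        + (z \<bullet> v) * hz z * (- 4 * t - 4 * t * N + 4 * t\<^sup>2 * (z \<bullet> z)))
     + 4 * (v \<bullet> v) / (N * (N - 2)) *
       (((2 * N - 2 * t * (z \<bullet> z)) * (2 * N - 2) - 4 * t * (z \<bullet> z) - 2 * t * (z \<bullet> z) * (2 * N - 2 * t * (z \<bullet> z))) * hzz z)"

definition B0 :: "'a \<Rightarrow> real" where
  "B0 z = 4 * (N + 2) / N * hv z + 8 * (N + 2) * (v \<bullet> v) / (N * (N - 2)) * hzz z"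

definition B1 :: "'a \<Rightarrow> real" where
  "B1 z = - 4 * q z + (- 16 / N) * ((z \<bullet> v) * hz z) + (- 16 * (v \<bullet> v) / (N * (N - 2))) * ((z \<bullet> z) * hzz z)"

lemma poly_coef: "real_polynomial_function (coef a b)"
  unfolding coef_def[abs_def] by (intro poly_kernel_intros)

lemma poly_B: "real_polynomial_function B0" "real_polynomial_function B1"
  unfolding B0_def[abs_def] B1_def[abs_def] by (intro poly_kernel_intros)+

section \<open>The adjoint bosonic Laplacian of the Gaussian kernel, term by term\<close>

lemma poly_psi: "real_polynomial_function (\<lambda>z::'a. 2 * N - 2 * t * (z \<bullet> z))"
  by (intro poly_kernel_intros)

lemma dir_deriv_psi: "dir_deriv d (\<lambda>z. 2 * N - 2 * t * (z \<bullet> z)) z = - 4 * t * (z \<bullet> d)"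
  by (rule dir_deriv_eqI[where h'="\<lambda>d. - 4 * t * (z \<bullet> d)"])
     (rule derivative_eq_intros refl | simp add: inner_commute algebra_simps)+

text \<open>The Laplacian term. The first weighted derivatives of \<open>q\<close> are the
  components of Z - 2 t q z, with Z the gradient of \<open>q\<close>, so the second ones sum to a
  weighted divergence.\<close>

lemma E1: "(\<Sum>b\<in>Basis. wderiv t b (wderiv t b (\<lambda>z. q z)) z)
  = (4 * t\<^sup>2 * (z \<bullet> z) - (2 * DIM('a) + 8 * real k) * t) * q z + (2 * N - 4) * hv z + 4 * (v \<bullet> v) * hzz z"
proof -
  define Z where "Z z = (2 * hv z) *\<^sub>R z - (2 * hz z) *\<^sub>R v - (2 * (z \<bullet> v)) *\<^sub>R grad h (srefl z v)" for z
  have polyZ: "polynomial_function Z" unfolding Z_def[abs_def] by (intro poly_kernel_intros)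
  have dZ: "dir_deriv d (\<lambda>z. q z) z = Z z \<bullet> d" for d z
    unfolding Z_def by (rule dir_deriv_harmonic_refl[OF h])
  have zZ: "Z z \<bullet> z = 2 * real k * q z" for z
    using euler_refl[OF h, of z v] by (simp add: Z_def inner_diff_left inner_commute[of v z] inner_commute[of "grad h (srefl z v)" z] algebra_simps)
  have dvgZ: "dvg Z z = (2 * N - 4) * hv z + 4 * (v \<bullet> v) * hzz z"
    unfolding Z_def[abs_def] dvg_grad_harmonic_refl[OF h] by (simp add: N)
  have polyX: "polynomial_function (\<lambda>z. (- 2 * t * q z) *\<^sub>R z)" by (intro poly_kernel_intros)
  have "wderiv t b (\<lambda>z. q z) = (\<lambda>z. (Z z + (- 2 * t * q z) *\<^sub>R z) \<bullet> b)" for b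
    by (rule ext) (simp add: wderiv_def dZ inner_add_left inner_diff_left)
  then have "(\<Sum>b\<in>Basis. wderiv t b (wderiv t b (\<lambda>z. q z)) z) = wdvg t (\<lambda>z. Z z + (- 2 * t * q z) *\<^sub>R z) z"
    by (simp add: wdvg_eq_sum)
  also have "\<dots> = wdvg t Z z + wdvg t (\<lambda>z. (- 2 * t * q z) *\<^sub>R z) z"
  proof -
    have "wderiv t b (\<lambda>z. (Z z + (- 2 * t * q z) *\<^sub>R z) \<bullet> b) z = wderiv t b (\<lambda>z. Z z \<bullet> b) z + wderiv t b (\<lambda>z. (- 2 * t * q z) *\<^sub>R z \<bullet> b) z" for b
      unfolding inner_add_left
      by (rule wderiv_add[OF polynomial_function_imp_inner[OF polyZ] polynomial_function_imp_inner[OF polyX]])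
    then show ?thesis by (simp add: wdvg_eq_sum sum.distrib)
  qed
  also have "wdvg t (\<lambda>z. (- 2 * t * q z) *\<^sub>R z) z = - 2 * t * (DIM('a) * q z + 2 * real k * q z) + 4 * t\<^sup>2 * (z \<bullet> z) * q z"
  proof -
    have f: "real_polynomial_function (\<lambda>z. - 2 * t * q z)" by (intro poly_kernel_intros)
    have "dvg (\<lambda>z::'a. z) z = DIM('a)"
      by (subst dvg_eqI[OF has_derivative_ident]) (rule tr_id)
    moreover have "dir_deriv z (\<lambda>z. - 2 * t * q z) z = - 2 * t * (2 * real k * q z)"
      using dir_deriv_cmult[OF poly_q, of z "- 2 * t" z] by (simp add: dZ zZ)
    ultimately have "dvg (\<lambda>z. (- 2 * t * q z) *\<^sub>R z) z = - 2 * t * q z * DIM('a) + - 2 * t * (2 * real k * q z)"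
      using dvg_scaleR[OF f polynomial_function_id, of z] by simp
    then show ?thesis by (simp add: wdvg_def power2_eq_square algebra_simps)
  qed
  also have "wdvg t Z z = (2 * N - 4) * hv z + 4 * (v \<bullet> v) * hzz z - 2 * t * (2 * real k * q z)"
    using zZ[of z] by (simp add: wdvg_def dvgZ inner_commute)
  finally show ?thesis by (simp add: algebra_simps)
qed

lemma wdvg_refl_grad: "wdvg t (\<lambda>z. srefl z (grad h (srefl z v))) z = - 1 * ((2 * N - 2 * t * (z \<bullet> z)) * hz z)"
  unfolding wdvg_def dvg_refl_grad[OF h] inner_refl_self by (simp add: N algebra_simps)

lemma wdvg_refl_hess_refl: "wdvg t (\<lambda>z. srefl z (hess h (srefl z v) (srefl z a))) z
  = - 1 * ((2 * N - 2 * t * (z \<bullet> z)) * (srefl z (hess h (srefl z v) z) \<bullet> a))"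
proof -
  have "z \<bullet> hess h (srefl z v) (srefl z a) = srefl z (hess h (srefl z v) z) \<bullet> a"
    by (simp add: refl_adjoint hess_symmetric[OF p])
  then show ?thesis
    unfolding wdvg_def dvg_refl_hess_refl[OF h] inner_refl_self by (simp add: N algebra_simps)
qed

lemma linear_wderiv_direction:
  assumes "real_polynomial_function f"
  shows "linear (\<lambda>d. wderiv t d f z)"
  by (intro linearI)
     (simp_all add: wderiv_def linear_add[OF linear_dir_deriv[OF assms]]
       linear_scale[OF linear_dir_deriv[OF assms]] inner_simps algebra_simps)

text \<open>The term with one v-derivative. Summing over b first gives the weighted divergence
  computed in \<open>wdvg_refl_grad\<close>; the sum over a is then a weighted derivative along
  v.\<close>

lemma E2: "(\<Sum>a\<in>Basis. \<Sum>b\<in>Basis. (v \<bullet> a) * wderiv t a (wderiv t b (\<lambda>z. srefl z (grad h (srefl z v)) \<bullet> b)) z)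
  = - ((2 * N - 2 * t * (z \<bullet> z)) * (hv z - 2 * (v \<bullet> v) * hzz z)
        + (z \<bullet> v) * hz z * (- 4 * t - 4 * t * N + 4 * t\<^sup>2 * (z \<bullet> z)))"
proof -
  define Y where "Y z = srefl z (grad h (srefl z v))" for z
  have polyY: "polynomial_function Y" unfolding Y_def[abs_def] by (intro poly_kernel_intros)
  have polyW: "real_polynomial_function (\<lambda>z. wderiv t b (\<lambda>z. Y z \<bullet> b) z)" for b
    by (intro real_polynomial_function_wderiv polynomial_function_imp_inner polyY)
  have polyhz: "real_polynomial_function (\<lambda>z. hz z)" by (intro poly_kernel_intros)
  have poly: "real_polynomial_function (\<lambda>z. (2 * N - 2 * t * (z \<bullet> z)) * hz z)"
    by (intro poly_kernel_intros)
  have eq: "(\<lambda>z. \<Sum>b\<in>Basis. wderiv t b (\<lambda>z. Y z \<bullet> b) z) = (\<lambda>z. - 1 * ((2 * N - 2 * t * (z \<bullet> z)) * hz z))"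
    unfolding wdvg_eq_sum[symmetric] Y_def by (rule ext) (rule wdvg_refl_grad)
  have "(\<Sum>b\<in>Basis. wderiv t a (wderiv t b (\<lambda>z. Y z \<bullet> b)) z) = - 1 * wderiv t a (\<lambda>z. (2 * N - 2 * t * (z \<bullet> z)) * hz z) z" for a
    proof -
    have "wderiv t a (\<lambda>z. \<Sum>b\<in>Basis. wderiv t b (\<lambda>z. Y z \<bullet> b) z) z = (\<Sum>b\<in>Basis. wderiv t a (wderiv t b (\<lambda>z. Y z \<bullet> b)) z)"
      by (rule wderiv_sum) (rule polyW)
    with eq show ?thesis using wderiv_cmult[OF poly, where t=t and d=a and c="- 1" and z=z] by simp
  qed
  then have "(\<Sum>a\<in>Basis. \<Sum>b\<in>Basis. (v \<bullet> a) * wderiv t a (wderiv t b (\<lambda>z. Y z \<bullet> b)) z)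
     = - (\<Sum>a\<in>Basis. (v \<bullet> a) * wderiv t a (\<lambda>z. (2 * N - 2 * t * (z \<bullet> z)) * hz z) z)"
    by (simp add: sum_distrib_left[symmetric] sum_negf)
  also have "(\<Sum>a\<in>Basis. (v \<bullet> a) * wderiv t a (\<lambda>z. (2 * N - 2 * t * (z \<bullet> z)) * hz z) z) = wderiv t v (\<lambda>z. (2 * N - 2 * t * (z \<bullet> z)) * hz z) z"
    using linear_sum[OF linear_wderiv_direction[OF poly, of t z], of "\<lambda>b. (v \<bullet> b) *\<^sub>R b" Basis]
    by (simp add: euclidean_representation linear_scale[OF linear_wderiv_direction[OF poly]])
  also have "\<dots> = (2 * N - 2 * t * (z \<bullet> z)) * (hv z - 2 * (v \<bullet> v) * hzz z)
        + (z \<bullet> v) * hz z * (- 4 * t - 4 * t * N + 4 * t\<^sup>2 * (z \<bullet> z))"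
  proof -
    \<comment> \<open>The derivative of \<open>hz\<close> along v is the divergence of
      \<open>hz z *\<^sub>R v\<close>, already known from
      \<open>dvg_inner_grad_scaleR_param\<close>.\<close>
    have dhz: "dir_deriv v (\<lambda>z. hz z) z = hv z - 2 * (v \<bullet> v) * hzz z"
      using dvg_inner_grad_scaleR_param[OF h, of v z] dvg_scaleR[OF polyhz polynomial_function_const, of v z]
      by (simp add: dvg_def dir_deriv_const)
    show ?thesis
      unfolding wderiv_def dir_deriv_mult[OF poly_psi polyhz] dir_deriv_psi dhz
      by (simp add: power2_eq_square algebra_simps)
  qed
  finally show ?thesis by (simp add: Y_def)
qed

text \<open>The term with two v-derivatives. The sum over b gives the a-component of a multiple of
  F, so the sum over a is another weighted divergence, which \<open>dvg_refl_hess_self\<close>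
  evaluates.\<close>

lemma E3: "(\<Sum>a\<in>Basis. \<Sum>b\<in>Basis. wderiv t a (wderiv t b (\<lambda>z. srefl z (hess h (srefl z v) (srefl z a)) \<bullet> b)) z)
  = ((2 * N - 2 * t * (z \<bullet> z)) * (2 * N - 2) - 4 * t * (z \<bullet> z) - 2 * t * (z \<bullet> z) * (2 * N - 2 * t * (z \<bullet> z))) * hzz z"
proof -
  define Y where "Y a z = srefl z (hess h (srefl z v) (srefl z a))" for a z
  define F where "F z = srefl z (hess h (srefl z v) z)" for z
  have polyY: "polynomial_function (Y a)" for a unfolding Y_def[abs_def] by (intro poly_kernel_intros)
  have polyF: "polynomial_function F" unfolding F_def[abs_def] by (intro poly_kernel_intros)
  have polyW: "real_polynomial_function (\<lambda>z. wderiv t b (\<lambda>z. Y a z \<bullet> b) z)" for a b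
    by (intro real_polynomial_function_wderiv polynomial_function_imp_inner polyY)
  have poly: "real_polynomial_function (\<lambda>z. (2 * N - 2 * t * (z \<bullet> z)) * (F z \<bullet> a))" for a
    by (intro poly_kernel_intros polyF)
  have eq: "(\<lambda>z. \<Sum>b\<in>Basis. wderiv t b (\<lambda>z. Y a z \<bullet> b) z) = (\<lambda>z. - 1 * ((2 * N - 2 * t * (z \<bullet> z)) * (F z \<bullet> a)))" for a
    unfolding wdvg_eq_sum[symmetric] Y_def F_def by (rule ext) (rule wdvg_refl_hess_refl)
  have "(\<Sum>b\<in>Basis. wderiv t a (wderiv t b (\<lambda>z. Y a z \<bullet> b)) z) = - 1 * wderiv t a (\<lambda>z. ((2 * N - 2 * t * (z \<bullet> z)) *\<^sub>R F z) \<bullet> a) z" for a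
    proof -
    have "wderiv t a (\<lambda>z. \<Sum>b\<in>Basis. wderiv t b (\<lambda>z. Y a z \<bullet> b) z) z = (\<Sum>b\<in>Basis. wderiv t a (wderiv t b (\<lambda>z. Y a z \<bullet> b)) z)"
      by (rule wderiv_sum) (rule polyW)
    with eq[of a] show ?thesis using wderiv_cmult[OF poly, where t=t and d=a and c="- 1" and z=z] by simp
  qed
  then have "(\<Sum>a\<in>Basis. \<Sum>b\<in>Basis. wderiv t a (wderiv t b (\<lambda>z. Y a z \<bullet> b)) z)
     = - wdvg t (\<lambda>z. (2 * N - 2 * t * (z \<bullet> z)) *\<^sub>R F z) z"
    by (simp add: wdvg_eq_sum sum_negf)
  also have "\<dots> = ((2 * N - 2 * t * (z \<bullet> z)) * (2 * N - 2) - 4 * t * (z \<bullet> z) - 2 * t * (z \<bullet> z) * (2 * N - 2 * t * (z \<bullet> z))) * hzz z"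
  proof -
    have dF: "dvg F z = - (2 * N - 2) * hzz z"
      unfolding F_def[abs_def] dvg_refl_hess_self[OF h] by (simp add: N algebra_simps)
    have zF: "z \<bullet> F z = - (z \<bullet> z) * hzz z" by (simp add: F_def inner_refl_self)
    show ?thesis
      unfolding wdvg_def dvg_scaleR[OF poly_psi polyF] dir_deriv_psi inner_scaleR_right dF zF by (simp add: algebra_simps)
  qed
  finally show ?thesis by (simp add: Y_def)
qed

lemma sum_wderiv_coef: "(\<Sum>a\<in>Basis. \<Sum>b\<in>Basis. wderiv t a (wderiv t b (coef a b)) z) = E t z"
proof -
  let ?Y = "\<lambda>b z. srefl z (grad h (srefl z v)) \<bullet> b"
  let ?X = "\<lambda>a b z. srefl z (hess h (srefl z v) (srefl z a)) \<bullet> b"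
  have Y: "real_polynomial_function (?Y b)" and X: "real_polynomial_function (?X a b)" for a b
    by (intro poly_kernel_intros)+
  have lin: "wderiv t d (\<lambda>z. c1 * p1 z + c2 * p2 z + c3 * p3 z) z = c1 * wderiv t d p1 z + c2 * wderiv t d p2 z + c3 * wderiv t d p3 z"
    if "real_polynomial_function p1" "real_polynomial_function p2" "real_polynomial_function p3" for p1 p2 p3 d c1 c2 c3 z
    using that by (simp add: wderiv_add wderiv_cmult real_polynomial_function.intros)
  have "wderiv t a (wderiv t b (coef a b)) z
    = (a \<bullet> b) * wderiv t a (wderiv t b (\<lambda>z. q z)) z + (- 4 / N * (v \<bullet> a)) * wderiv t a (wderiv t b (?Y b)) z
     + 4 * (v \<bullet> v) / (N * (N - 2)) * wderiv t a (wderiv t b (?X a b)) z" for a b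
  proof -
    have "wderiv t b (coef a b) = (\<lambda>z. (a \<bullet> b) * wderiv t b (\<lambda>z. q z) z + (- 4 / N * (v \<bullet> a)) * wderiv t b (?Y b) z
     + 4 * (v \<bullet> v) / (N * (N - 2)) * wderiv t b (?X a b) z)"
      unfolding coef_def[abs_def] by (rule ext) (rule lin[OF poly_q Y X])
    then show ?thesis
      by (simp only: lin[OF real_polynomial_function_wderiv[OF poly_q] real_polynomial_function_wderiv[OF Y]
          real_polynomial_function_wderiv[OF X]])
  qed
  then have "(\<Sum>a\<in>Basis. \<Sum>b\<in>Basis. wderiv t a (wderiv t b (coef a b)) z)
    = (\<Sum>a\<in>Basis. \<Sum>b\<in>Basis. (a \<bullet> b) * wderiv t a (wderiv t b (\<lambda>z. q z)) z)
      + - 4 / N * (\<Sum>a\<in>Basis. \<Sum>b\<in>Basis. (v \<bullet> a) * wderiv t a (wderiv t b (?Y b)) z)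
      + 4 * (v \<bullet> v) / (N * (N - 2)) * (\<Sum>a\<in>Basis. \<Sum>b\<in>Basis. wderiv t a (wderiv t b (?X a b)) z)"
    by (simp only: sum.distrib sum_distrib_left mult.assoc)
  also have "(\<Sum>a\<in>Basis. \<Sum>b\<in>Basis. (a \<bullet> b) * wderiv t a (wderiv t b (\<lambda>z. q z)) z) = (\<Sum>b\<in>Basis. wderiv t b (wderiv t b (\<lambda>z. q z)) z)"
    by (intro sum.cong refl) (simp add: inner_Basis if_distrib if_distribR cong: if_cong)
  finally show ?thesis
  proof -
    have neg: "- 4 / N * - x = 4 / N * x" for x :: real by simp
    assume "(\<Sum>a\<in>Basis. \<Sum>b\<in>Basis. wderiv t a (wderiv t b (coef a b)) z) = (\<Sum>b\<in>Basis. wderiv t b (wderiv t b (\<lambda>z. q z)) z)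
      + - 4 / N * (\<Sum>a\<in>Basis. \<Sum>b\<in>Basis. (v \<bullet> a) * wderiv t a (wderiv t b (?Y b)) z)
      + 4 * (v \<bullet> v) / (N * (N - 2)) * (\<Sum>a\<in>Basis. \<Sum>b\<in>Basis. wderiv t a (wderiv t b (?X a b)) z)"
    then show ?thesis unfolding E1 E2 E3 E_def neg .
  qed
qed

text \<open>For N \<noteq> 2 the coefficients of t^0 and t^2 agree identically; in the coefficient
  of t the two sides differ by a multiple of the Euler relation \<open>eu\<close>. For N = 2 all
  derivative terms vanish.\<close>

lemma E_eq: "E t z = N / 2 * B0 z + t * ((N / 2 + 1) * B1 z - (z \<bullet> z) * B0 z) - t\<^sup>2 * (z \<bullet> z) * B1 z"
proof -
  have eu: "(z \<bullet> z) * hv z = real k * q z + 2 * (z \<bullet> v) * hz z" by (rule euler_refl[OF h])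
  have m: "real DIM('a) = N + 2 - 2 * real k" by (simp add: N)
  have nz: "N \<noteq> 0" using N_pos by simp
  show ?thesis
  proof (cases "N = 2")
    case True
    with N_cases have 0: "hv z = 0" "hz z = 0" "hzz z = 0" by auto
    have "real k * q z = 0" using eu 0 by simp
    then show ?thesis unfolding E_def B0_def B1_def 0 using True m by (auto simp: algebra_simps power2_eq_square)
  next
    case False
    define s A C D F u where "s = z \<bullet> z" and "A = q z" and "C = hv z" and "D = hz z" and "F = hzz z" and "u = v \<bullet> v"
    define M where "M = N - 2"
    have M: "M \<noteq> 0" "N = M + 2" using False by (auto simp: M_def)
    have eu': "s * C = real k * A + 2 * (z \<bullet> v) * D" using eu by (simp add: s_def A_def C_def D_def)
    show ?thesis
      unfolding E_def B0_def B1_def of_nat_mult of_nat_numeral m s_def[symmetric] A_def[symmetric] C_def[symmetric] D_def[symmetric]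
        F_def[symmetric] u_def[symmetric] M_def[symmetric]
      using M(1) nz eu' apply (simp add: field_simps power2_eq_square)
      unfolding M(2) by algebra
  qed
qed

end

section \<open>The fundamental solution\<close>

text \<open>Passes to the gauge integral over a box, where the order of integration of continuous
  functions can be exchanged.\<close>

lemma integral_lborel_eq_integral_cbox:
  fixes F :: "'a::euclidean_space \<Rightarrow> real"
  assumes F: "continuous_on UNIV F" and "\<And>z. z \<notin> cbox l u \<Longrightarrow> F z = 0"
  shows "(LINT z|lborel. F z) = integral (cbox l u) F"
proof -
  have "set_integrable lborel (cbox l u) F"
    unfolding set_integrable_def
    by (intro borel_integrable_compact compact_cbox continuous_on_subset[OF F]) simp
  then have "(LINT z:cbox l u|lborel. F z) = integral (cbox l u) F"
    by (rule set_borel_integral_eq_integral)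
  moreover have "(LINT z:cbox l u|lborel. F z) = (LINT z|lborel. F z)"
    unfolding set_lebesgue_integral_def using assms(2)
    by (intro Bochner_Integration.integral_cong) (auto simp: indicator_def)
  ultimately show ?thesis by simp
qed

lemma has_bochner_integral_powr_exp:
  fixes s x :: real
  assumes "x > 0" "s > 0"
  shows "has_bochner_integral lborel (\<lambda>t. indicator {0..} t * (t powr (x - 1) * exp (- t * s))) (Gamma x * s powr (- x))"
proof -
  have "has_bochner_integral lborel (\<lambda>t. indicator {0..} t * (t powr (x - 1) / exp t)) (Gamma x)"
  proof (rule has_bochner_integral_nn_integral)
    show "(\<integral>\<^sup>+t. ennreal (indicator {0..} t * (t powr (x - 1) / exp t)) \<partial>lborel) = ennreal (Gamma x)"
      by (rule nn_integral_has_integral_lborel)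
         (use Gamma_integral_real[OF assms(1)] in \<open>auto simp: has_integral_restrict_UNIV[of "{0..}", symmetric] indicator_def of_bool_def if_distrib if_distribR cong: if_cong\<close>)
  qed (use assms in \<open>auto intro: less_imp_le[OF Gamma_real_pos]\<close>)
  then have "has_bochner_integral lborel (\<lambda>t. indicator {0..} (0 + s * t) * ((0 + s * t) powr (x - 1) / exp (0 + s * t))) (Gamma x /\<^sub>R \<bar>s\<bar>)"
    using lborel_has_bochner_integral_real_affine_iff[of s "\<lambda>t. indicator {0..} t * (t powr (x - 1) / exp t)" "Gamma x" 0] assms by simp
  then have "has_bochner_integral lborel (\<lambda>t. s powr (1 - x) * (indicator {0..} (0 + s * t) * ((0 + s * t) powr (x - 1) / exp (0 + s * t)))) (s powr (1 - x) * (Gamma x /\<^sub>R \<bar>s\<bar>))"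
    by (rule has_bochner_integral_mult_right[OF _]) 
  moreover have "s powr (1 - x) * (indicator {0..} (0 + s * t) * ((0 + s * t) powr (x - 1) / exp (0 + s * t)))
      = indicator {0..} t * (t powr (x - 1) * exp (- t * s))" for t
  proof (cases "t \<ge> 0")
    case True
    then have "(s * t) powr (x - 1) = s powr (x - 1) * t powr (x - 1)" using assms by (simp add: powr_mult)
    moreover have "s powr (1 - x) * s powr (x - 1) = 1" using assms by (simp flip: powr_add)
    ultimately show ?thesis using True assms by (simp add: exp_minus field_simps)
  next
    case False
    then show ?thesis using assms by (simp add: indicator_def zero_le_mult_iff)
  qed
  moreover have "s powr (1 - x) * (Gamma x /\<^sub>R \<bar>s\<bar>) = Gamma x * s powr (- x)"
    using assms by (simp add: powr_diff powr_minus field_simps)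
  ultimately show ?thesis by (simp only:)
qed

text \<open>By homogeneity the kernel is bounded by |z|^(2-m) times the maximum of |p| on the unit
  sphere.\<close>

lemma locally_integrable_homogeneous_kernel:
  fixes p :: "'a::euclidean_space \<Rightarrow> real"
  assumes p: "real_polynomial_function p" and hom: "\<And>c z. c > 0 \<Longrightarrow> p (c *\<^sub>R z) = c ^ (2 * k) * p z"
    and N: "N = DIM('a) + 2 * real k - 2" and dim: "DIM('a) \<ge> 3"
  shows "locally_integrable (\<lambda>z. norm z powr (- N) * p z)"
  unfolding locally_integrable_def
proof (intro conjI allI)
  have [measurable]: "p \<in> borel_measurable borel" by (rule borel_measurable_real_polynomial_function[OF p])
  have m: "(\<lambda>z::'a. norm z powr (- N)) \<in> borel_measurable borel"
    by (intro powr_real_measurable) simp_all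
  show meas: "(\<lambda>z. norm z powr (- N) * p z) \<in> borel_measurable borel"
    by (rule borel_measurable_times[OF m]) simp
  have "bounded (p ` sphere 0 1)"
    by (intro compact_imp_bounded compact_continuous_image continuous_on_real_polynomial_function p) auto
  then obtain C where C: "\<And>u. norm u = 1 \<Longrightarrow> \<bar>p u\<bar> \<le> C" "C > 0"
    by (force simp: bounded_pos)
  fix r
  show "integrable lborel (\<lambda>z. indicator (cball 0 r) z * (norm z powr (- N) * p z))"
  proof (rule Bochner_Integration.integrable_bound)
    show "integrable lborel (\<lambda>z::'a. C * (indicator (cball 0 r) z * norm z powr (2 - real DIM('a))))"
      by (intro integrable_mult_right integrable_norm_powr_cball dim)
    show "(\<lambda>z. indicator (cball 0 r) z * (norm z powr (- N) * p z)) \<in> borel_measurable lborel"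
      unfolding measurable_lborel1 by (intro borel_measurable_times borel_measurable_indicator meas[unfolded fun_eq_iff]) (use meas in simp_all)
    show "AE z in lborel. norm (indicator (cball 0 r) z * (norm z powr (- N) * p z)) \<le> norm (C * (indicator (cball 0 r) z * norm z powr (2 - real DIM('a))))"
    proof (rule AE_I2)
      fix z :: 'a
      have "norm z powr (- N) * \<bar>p z\<bar> \<le> C * norm z powr (2 - real DIM('a))"
      proof (cases "z = 0")
        case False
        have "p z = norm z ^ (2 * k) * p (sgn z)"
          using hom[of "norm z" "sgn z"] False by (simp add: sgn_div_norm)
        moreover have "norm z powr (real (2 * k)) = norm z ^ (2 * k)"
          using False by (intro powr_realpow) simp
        ultimately have "norm z powr (- N) * \<bar>p z\<bar> = (norm z powr (- N) * norm z powr (real (2 * k))) * \<bar>p (sgn z)\<bar>"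
          by (simp only: abs_mult power_abs abs_norm_cancel mult.assoc)
        also have "norm z powr (- N) * norm z powr (real (2 * k)) = norm z powr (2 - real DIM('a))"
          by (simp add: N flip: powr_add)
        also have "norm z powr (2 - real DIM('a)) * \<bar>p (sgn z)\<bar> \<le> norm z powr (2 - real DIM('a)) * C"
          using C(1)[of "sgn z"] False by (intro mult_left_mono) (auto simp: norm_sgn)
        finally show ?thesis by (simp add: mult.commute)
      qed simp
      then show "norm (indicator (cball 0 r) z * (norm z powr (- N) * p z)) \<le> norm (C * (indicator (cball 0 r) z * norm z powr (2 - real DIM('a))))"
        using C(2) by (simp add: indicator_def abs_mult)
    qed
  qed
qed

lemma integral_double_sum:
  fixes f :: "'i \<Rightarrow> 'j \<Rightarrow> 'a \<Rightarrow> real"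
  assumes "\<And>i j. integrable M (f i j)"
  shows "(LINT x|M. (\<Sum>i\<in>I. \<Sum>j\<in>J. f i j x)) = (\<Sum>i\<in>I. \<Sum>j\<in>J. LINT x|M. f i j x)"
  using assms by simp

section \<open>Scaling in z and local integrability of the coefficients\<close>

lemma grad_scaled:
  assumes "h \<in> harmonic_polys k"
  shows "t *\<^sub>R grad h (t *\<^sub>R u) = t ^ k *\<^sub>R grad h u"
  by (rule euclidean_eqI)
     (simp add: inner_grad[OF harmonic_polys_poly[OF assms]] dir_deriv_scaled[OF assms])

lemma hess_scaled:
  assumes h: "h \<in> harmonic_polys k"
  shows "t\<^sup>2 *\<^sub>R hess h (t *\<^sub>R u) d = t ^ k *\<^sub>R hess h u d"
proof -
  note p = harmonic_polys_poly[OF h]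
  have "t\<^sup>2 *\<^sub>R hess h (t *\<^sub>R u) d = t *\<^sub>R (t *\<^sub>R grad (dir_deriv d h) (t *\<^sub>R u))"
    by (simp add: grad_dir_deriv[OF p] power2_eq_square)
  also have "\<dots> = (t * t ^ (k - 1)) *\<^sub>R hess h u d"
    unfolding grad_scaled[OF dir_deriv_harmonic[OF h]] by (simp only: grad_dir_deriv[OF p] scaleR_scaleR)
  also have "\<dots> = t ^ k *\<^sub>R hess h u d"
  \<comment> \<open>The identity t t^(k-1) = t^k fails for truncated subtraction at k = 0, but the
    Hessian is 0 there.\<close>
  proof (cases k)
    case 0
    then have "dir_deriv c h = (\<lambda>x. 0)" for c using h dir_deriv_degree_0 by blast
    then show ?thesis by (simp add: hess_def dir_deriv_const)
  qed simp
  finally show ?thesis .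
qed

lemma srefl_scaled: "srefl (c *\<^sub>R z) u = c\<^sup>2 *\<^sub>R srefl z u"
  by (simp add: srefl_def power2_eq_square algebra_simps)

locale bosonic_kernel = harmonic_kernel h k v N + compactly_supported_C2 g g1 g2 r
  for h :: "'a::euclidean_space \<Rightarrow> real" and k v N and g :: "'a \<Rightarrow> real" and g1 g2 r
begin

text \<open>The bosonic Laplacian in (y, v) of \<open>g (y - z) * h (srefl z v)\<close>: the
  singular factor is left out, and all y-derivatives fall on g.\<close>

definition R :: "'a \<Rightarrow> 'a \<Rightarrow> real" where
  "R y z = (\<Sum>a\<in>Basis. \<Sum>b\<in>Basis. coef a b z * g2 b (y - z) a)"

lemma
  assumes c: "c > 0"
  shows q_scaled: "h (srefl (c *\<^sub>R z) v) = c ^ (2 * k) * q z"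
    and grad_refl_scaled: "grad h (srefl (c *\<^sub>R z) v) = (c ^ (2 * k) / c\<^sup>2) *\<^sub>R grad h (srefl z v)"
    and hess_refl_scaled: "hess h (srefl (c *\<^sub>R z) v) d = (c ^ (2 * k) / c ^ 4) *\<^sub>R hess h (srefl z v) d"
proof -
  show "h (srefl (c *\<^sub>R z) v) = c ^ (2 * k) * q z"
    by (simp add: srefl_scaled harmonic_polys_homogeneous[OF h] power_mult)
  have "c\<^sup>2 *\<^sub>R grad h (srefl (c *\<^sub>R z) v) = c ^ (2 * k) *\<^sub>R grad h (srefl z v)"
    unfolding srefl_scaled using grad_scaled[OF h, of "c\<^sup>2" "srefl z v"] by (simp add: power_mult)
  then have "(1 / c\<^sup>2) *\<^sub>R (c\<^sup>2 *\<^sub>R grad h (srefl (c *\<^sub>R z) v)) = (1 / c\<^sup>2) *\<^sub>R (c ^ (2 * k) *\<^sub>R grad h (srefl z v))" by simp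
  then show "grad h (srefl (c *\<^sub>R z) v) = (c ^ (2 * k) / c\<^sup>2) *\<^sub>R grad h (srefl z v)" using c by simp
  have "c ^ 4 *\<^sub>R hess h (srefl (c *\<^sub>R z) v) d = c ^ (2 * k) *\<^sub>R hess h (srefl z v) d"
    unfolding srefl_scaled using hess_scaled[OF h, of "c\<^sup>2" "srefl z v" d] by (simp add: power_mult[symmetric])
  then have "(1 / c ^ 4) *\<^sub>R (c ^ 4 *\<^sub>R hess h (srefl (c *\<^sub>R z) v) d) = (1 / c ^ 4) *\<^sub>R (c ^ (2 * k) *\<^sub>R hess h (srefl z v) d)" by simp
  then show "hess h (srefl (c *\<^sub>R z) v) d = (c ^ (2 * k) / c ^ 4) *\<^sub>R hess h (srefl z v) d" using c by simp
qed

lemma coef_scaled: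
  assumes c: "c > 0"
  shows "coef a b (c *\<^sub>R z) = c ^ (2 * k) * coef a b z"
proof -
  have "srefl (c *\<^sub>R z) (grad h (srefl (c *\<^sub>R z) v)) = c ^ (2 * k) *\<^sub>R srefl z (grad h (srefl z v))"
    using c by (simp only: srefl_scaled grad_refl_scaled[OF c, unfolded srefl_scaled] linear_scale[OF linear_refl] scaleR_scaleR) simp
  moreover have "srefl (c *\<^sub>R z) (hess h (srefl (c *\<^sub>R z) v) (srefl (c *\<^sub>R z) a)) = c ^ (2 * k) *\<^sub>R srefl z (hess h (srefl z v) (srefl z a))"
  proof -
    have "c\<^sup>2 * ((c ^ (2 * k) / c ^ 4) * c\<^sup>2) = c ^ (2 * k)" using c by (simp add: field_simps power2_eq_square power4_eq_xxxx)
    then show ?thesis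
      by (simp only: srefl_scaled hess_refl_scaled[OF c, unfolded srefl_scaled]
          linear_scale[OF linear_hess[OF p]] linear_scale[OF linear_refl] scaleR_scaleR)
         (simp add: mult_ac)
  qed
  ultimately show ?thesis
    unfolding coef_def by (simp only: q_scaled[OF c] inner_scaleR_left) (simp add: algebra_simps)
qed

text \<open>The degrees 2k - 2 and 2k match the scaling z \<mapsto> c z, t \<mapsto> t / c^2, under
  which B0 + t B1 is multiplied by a power of c.\<close>

lemma B_scaled:
  assumes c: "c > 0"
  shows "B0 (c *\<^sub>R z) = c ^ (2 * k) / c\<^sup>2 * B0 z" and "B1 (c *\<^sub>R z) = c ^ (2 * k) * B1 z"
proof -
  have hv: "v \<bullet> grad h (srefl (c *\<^sub>R z) v) = c ^ (2 * k) / c\<^sup>2 * hv z" by (simp add: grad_refl_scaled[OF c])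
  have hz: "c * (z \<bullet> grad h (srefl (c *\<^sub>R z) v)) * c = c ^ (2 * k) * hz z"
    using c by (simp add: grad_refl_scaled[OF c] power2_eq_square)
  have hzz: "(c *\<^sub>R z) \<bullet> hess h (srefl (c *\<^sub>R z) v) (c *\<^sub>R z) = c ^ (2 * k) / c\<^sup>2 * hzz z"
    using c by (simp add: hess_refl_scaled[OF c] linear_scale[OF linear_hess[OF p]] power2_eq_square power4_eq_xxxx)
  show "B0 (c *\<^sub>R z) = c ^ (2 * k) / c\<^sup>2 * B0 z"
    unfolding B0_def hv hzz by (simp only: distrib_left mult.left_commute)
  have e1: "(c *\<^sub>R z \<bullet> v) * (c *\<^sub>R z \<bullet> grad h (srefl (c *\<^sub>R z) v)) = c ^ (2 * k) * ((z \<bullet> v) * hz z)"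
    using hz by (simp add: mult_ac)
  have e2: "(c *\<^sub>R z \<bullet> c *\<^sub>R z) * (c ^ (2 * k) / c\<^sup>2 * hzz z) = c ^ (2 * k) * ((z \<bullet> z) * hzz z)"
    using c by (simp add: power2_eq_square)
  show "B1 (c *\<^sub>R z) = c ^ (2 * k) * B1 z"
    unfolding B1_def hzz e1 e2 q_scaled[OF c] by (simp add: algebra_simps)
qed

lemma locally_integrable_coef: "locally_integrable (\<lambda>z. norm z powr (- N) * coef a b z)"
  by (rule locally_integrable_homogeneous_kernel[OF poly_coef coef_scaled N dim3])

lemma integrable_kernel_R: "integrable lborel (\<lambda>z. norm z powr (- N) * R y z)"
  unfolding R_def sum_distrib_left mult.assoc[symmetric]
  by (intro Bochner_Integration.integrable_sum integrable_locally_mult[OF locally_integrable_coef cont2 supp(3)])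

lemma continuous_R: "continuous_on UNIV (R y)"
  unfolding R_def
  by (intro continuous_intros continuous_on_real_polynomial_function poly_coef continuous_on_compose2[OF cont2]) auto

lemma gaussian_R:
  "(LINT z|lborel. exp (- t * (z \<bullet> z)) * R y z) = (LINT z|lborel. exp (- t * (z \<bullet> z)) * E t z * g (y - z))"
proof -
  have loc: "locally_integrable (\<lambda>z. exp (- t * (z \<bullet> z)) * f z)" if "real_polynomial_function f" for f :: "'a \<Rightarrow> real"
    using that by (intro locally_integrable_continuous continuous_intros continuous_on_real_polynomial_function)
  have "(LINT z|lborel. exp (- t * (z \<bullet> z)) * R y z)
     = (LINT z|lborel. (\<Sum>a\<in>Basis. \<Sum>b\<in>Basis. exp (- t * (z \<bullet> z)) * coef a b z * g2 b (y - z) a))"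
    unfolding R_def by (simp only: sum_distrib_left mult.assoc)
  also have "\<dots> = (\<Sum>a\<in>Basis. \<Sum>b\<in>Basis. LINT z|lborel. exp (- t * (z \<bullet> z)) * coef a b z * g2 b (y - z) a)"
    by (rule integral_double_sum) (rule integrable_locally_mult[OF loc[OF poly_coef] cont2 supp(3)])
  also have "\<dots> = (\<Sum>a\<in>Basis. \<Sum>b\<in>Basis. LINT z|lborel. exp (- t * (z \<bullet> z)) * wderiv t a (wderiv t b (coef a b)) z * g (y - z))"
    by (intro sum.cong refl gaussian_convolution_by_parts_2 poly_coef)
  also have "\<dots> = (LINT z|lborel. (\<Sum>a\<in>Basis. \<Sum>b\<in>Basis. exp (- t * (z \<bullet> z)) * wderiv t a (wderiv t b (coef a b)) z * g (y - z)))"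
  proof -
    have int: "integrable lborel (\<lambda>z. exp (- t * (z \<bullet> z)) * wderiv t a (wderiv t b (coef a b)) z * g (y - z))" for a b
      by (intro integrable_locally_mult[OF loc cont0 supp(1)] real_polynomial_function_wderiv poly_coef)
    show ?thesis by (rule integral_double_sum[symmetric]) (rule int)
  qed
  also have "\<dots> = (LINT z|lborel. exp (- t * (z \<bullet> z)) * E t z * g (y - z))"
    unfolding sum_wderiv_coef[symmetric] by (simp only: sum_distrib_left sum_distrib_right)
  finally show ?thesis .
qed

section \<open>Integration over t and its two boundary terms\<close>

definition G :: "real \<Rightarrow> 'a \<Rightarrow> real" where
  "G t z = t powr (N / 2) * exp (- t * (z \<bullet> z)) * (B0 z + t * B1 z)"

lemma G_deriv:
  assumes t: "t > 0"
  shows "((\<lambda>t. G t z) has_real_derivative t powr (N / 2 - 1) * exp (- t * (z \<bullet> z)) * E t z) (at t)"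
proof -
  have "((\<lambda>t. G t z) has_real_derivative
      (N / 2 * t powr (N / 2 - 1) * exp (- t * (z \<bullet> z)) + t powr (N / 2) * (exp (- t * (z \<bullet> z)) * - (z \<bullet> z))) * (B0 z + t * B1 z)
       + t powr (N / 2) * exp (- t * (z \<bullet> z)) * B1 z) (at t)"
    unfolding G_def using t by (auto intro!: derivative_eq_intros simp: algebra_simps)
  also have "t powr (N / 2) = t * t powr (N / 2 - 1)"
    using t by (simp add: powr_diff)
  also have "(N / 2 * t powr (N / 2 - 1) * exp (- t * (z \<bullet> z)) + t * t powr (N / 2 - 1) * (exp (- t * (z \<bullet> z)) * - (z \<bullet> z))) * (B0 z + t * B1 z)
       + t * t powr (N / 2 - 1) * exp (- t * (z \<bullet> z)) * B1 z = t powr (N / 2 - 1) * exp (- t * (z \<bullet> z)) * E t z"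
    unfolding E_eq by (simp add: algebra_simps power2_eq_square)
  finally show ?thesis .
qed

text \<open>For t in a compact interval away from 0 all integrands are continuous and vanish outside
  a box in z. So the order of integration may be exchanged, \<open>gaussian_R\<close> applied for
  each t, and the order restored to integrate the exact t-derivative.\<close>

lemma time_integral:
  assumes ab: "0 < \<alpha>" "\<alpha> \<le> \<beta>"
  shows "(LINT z|lborel. integral {\<alpha>..\<beta>} (\<lambda>t. t powr (N / 2 - 1) * exp (- t * (z \<bullet> z))) * R y z)
    = (LINT z|lborel. (G \<beta> z - G \<alpha> z) * g (y - z))"
proof -
  define M where "M = norm y + \<bar>r\<bar>"
  have "bounded (cball (0::'a) M)" by simp
  from bounded_subset_cbox_symmetric[OF this] obtain u :: 'a where u: "cball 0 M \<subseteq> cbox (- u) u" by blast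
  have out: "norm (y - z) > r" if "z \<notin> cbox (- u) u" for z
  proof -
    have "z \<notin> cball 0 M" using that u by blast
    then have "norm z > M" by simp
    then show ?thesis using norm_triangle_ineq2[of z y] by (simp add: M_def norm_minus_commute)
  qed
  define ps where "ps t z = t powr (N / 2 - 1) * exp (- t * (z \<bullet> z))" for t and z :: 'a
  have R0: "R y z = 0" if "z \<notin> cbox (- u) u" for z using supp(3)[OF out[OF that]] by (simp add: R_def)
  have g0: "g (y - z) = 0" if "z \<notin> cbox (- u) u" for z using supp(1)[OF out[OF that]] .
  have contR: "continuous_on S (\<lambda>x. R y (f x))" if "continuous_on S f" for S and f :: "'b::topological_space \<Rightarrow> 'a"
    by (rule continuous_on_compose2[OF continuous_R that]) simp
  have contg: "continuous_on S (\<lambda>x. g (y - f x))" if "continuous_on S f" for S and f :: "'b::topological_space \<Rightarrow> 'a"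
    by (rule continuous_on_compose2[OF cont0]) (auto intro!: continuous_intros that)
  have contE: "continuous_on S (\<lambda>x. E (f x) (w x))" if "continuous_on S f" "continuous_on S w"
    for S and f :: "'b::topological_space \<Rightarrow> real" and w :: "'b \<Rightarrow> 'a"
    using that(1) continuous_on_compose2[OF continuous_on_real_polynomial_function[OF poly_B(1), of UNIV] that(2)]
      continuous_on_compose2[OF continuous_on_real_polynomial_function[OF poly_B(2), of UNIV] that(2)] that(2)
    unfolding E_eq by (intro continuous_intros) auto
  have contps: "continuous_on S (\<lambda>x. ps (f x) (w x))" if "continuous_on S f" "continuous_on S w" "\<And>x. x \<in> S \<Longrightarrow> f x > 0"
    for S and f :: "'b::topological_space \<Rightarrow> real" and w :: "'b \<Rightarrow> 'a"
    unfolding ps_def using that by (intro continuous_intros) (auto dest!: that(3))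
  have swap: "integral (cbox (- u) u) (\<lambda>z. integral {\<alpha>..\<beta>} (\<lambda>t. f z t)) = integral {\<alpha>..\<beta>} (\<lambda>t. integral (cbox (- u) u) (\<lambda>z. f z t))"
    if "continuous_on (cbox (- u, \<alpha>) (u, \<beta>)) (\<lambda>(z, t). f z t)" for f :: "'a \<Rightarrow> real \<Rightarrow> real"
    using integral_swap_continuous[OF that] by (simp add: cbox_interval)
  have pos: "x \<in> cbox (- u, \<alpha>) (u, \<beta>) \<Longrightarrow> snd x > 0" for x using ab by (cases x) (auto simp: cbox_Pair_eq)
  have contphi: "continuous_on UNIV (\<lambda>z. integral {\<alpha>..\<beta>} (\<lambda>t. ps t z))"
    unfolding continuous_on_eq_continuous_at[OF open_UNIV]
  proof
    fix z :: 'a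
    have "continuous_on (ball z 1) (\<lambda>z. integral (cbox \<alpha> \<beta>) (\<lambda>t. ps t z))"
      by (rule integral_continuous_on_param)
         (use ab in \<open>auto simp: case_prod_beta cbox_interval intro!: contps continuous_intros\<close>)
    then show "isCont (\<lambda>z. integral {\<alpha>..\<beta>} (\<lambda>t. ps t z)) z"
      by (simp add: cbox_interval continuous_on_eq_continuous_at)
  qed
  have "(LINT z|lborel. integral {\<alpha>..\<beta>} (\<lambda>t. ps t z) * R y z) = integral (cbox (- u) u) (\<lambda>z. integral {\<alpha>..\<beta>} (\<lambda>t. ps t z) * R y z)"
    by (rule integral_lborel_eq_integral_cbox) (auto intro!: continuous_intros contphi continuous_R simp: R0)
  also have "\<dots> = integral (cbox (- u) u) (\<lambda>z. integral {\<alpha>..\<beta>} (\<lambda>t. ps t z * R y z))"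
    by simp
  also have "\<dots> = integral {\<alpha>..\<beta>} (\<lambda>t. integral (cbox (- u) u) (\<lambda>z. ps t z * R y z))"
    by (rule swap) (auto simp: case_prod_beta intro!: continuous_intros contps contR pos)
  also have "\<dots> = integral {\<alpha>..\<beta>} (\<lambda>t. integral (cbox (- u) u) (\<lambda>z. ps t z * E t z * g (y - z)))"
  proof (rule Henstock_Kurzweil_Integration.integral_cong)
    fix t assume t: "t \<in> {\<alpha>..\<beta>}"
    have "integral (cbox (- u) u) (\<lambda>z. ps t z * R y z) = (LINT z|lborel. ps t z * R y z)"
      using t ab by (intro integral_lborel_eq_integral_cbox[symmetric]) (auto intro!: continuous_intros contps continuous_R simp: R0)
    also have "\<dots> = t powr (N / 2 - 1) * (LINT z|lborel. exp (- t * (z \<bullet> z)) * R y z)"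
      unfolding ps_def mult.assoc by (rule integral_mult_right_zero)
    also have "\<dots> = (LINT z|lborel. ps t z * E t z * g (y - z))"
      unfolding gaussian_R ps_def mult.assoc by (rule integral_mult_right_zero[symmetric])
    also have "\<dots> = integral (cbox (- u) u) (\<lambda>z. ps t z * E t z * g (y - z))"
      using t ab by (intro integral_lborel_eq_integral_cbox) (auto intro!: continuous_intros contps contE contg simp: g0)
    finally show "integral (cbox (- u) u) (\<lambda>z. ps t z * R y z) = integral (cbox (- u) u) (\<lambda>z. ps t z * E t z * g (y - z))" .
  qed
  also have "\<dots> = integral (cbox (- u) u) (\<lambda>z. integral {\<alpha>..\<beta>} (\<lambda>t. ps t z * E t z * g (y - z)))"
    by (rule swap[symmetric]) (auto simp: case_prod_beta intro!: continuous_intros contps contE contg pos)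
  also have "\<dots> = integral (cbox (- u) u) (\<lambda>z. (G \<beta> z - G \<alpha> z) * g (y - z))"
  proof (rule Henstock_Kurzweil_Integration.integral_cong)
    fix z
    have "((\<lambda>t. ps t z * E t z) has_integral (G \<beta> z - G \<alpha> z)) {\<alpha>..\<beta>}"
    proof (rule fundamental_theorem_of_calculus[OF ab(2)])
      fix t assume "t \<in> {\<alpha>..\<beta>}"
      then have "t > 0" using ab by simp
      from G_deriv[OF this, of z] show "((\<lambda>t. G t z) has_vector_derivative ps t z * E t z) (at t within {\<alpha>..\<beta>})"
        unfolding ps_def by (simp add: has_real_derivative_iff_has_vector_derivative has_vector_derivative_at_within)
    qed
    then show "integral {\<alpha>..\<beta>} (\<lambda>t. ps t z * E t z * g (y - z)) = (G \<beta> z - G \<alpha> z) * g (y - z)"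
      by (simp add: integral_unique)
  qed
  also have "\<dots> = (LINT z|lborel. (G \<beta> z - G \<alpha> z) * g (y - z))"
  proof (rule integral_lborel_eq_integral_cbox[symmetric])
    show "continuous_on UNIV (\<lambda>z. (G \<beta> z - G \<alpha> z) * g (y - z))"
      unfolding G_def by (intro continuous_intros contg continuous_on_real_polynomial_function poly_B)
  qed (simp add: g0)
  finally show ?thesis by (simp add: ps_def)
qed

text \<open>Substituting T^(-1/2) z for z shows that all \<open>G T\<close> are dilations of one
  Gaussian profile, with no remaining power of T.\<close>

lemma integral_G:
  assumes T: "T > 0"
  shows "(LINT z|lborel. G T z * g (y - z))
    = (LINT z|lborel. exp (- (z \<bullet> z)) * (B0 z + B1 z) * g (y - (T powr (- 1 / 2)) *\<^sub>R z))"
proof -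
  define c where "c = T powr (- 1 / 2)"
  have c: "c > 0" using T by (simp add: c_def)
  have c2: "c\<^sup>2 = 1 / T"
    using T by (simp add: c_def power2_eq_square powr_minus field_simps flip: powr_add)
  have "continuous_on UNIV (\<lambda>z. G T z * g (y - z))"
    unfolding G_def
    by (intro continuous_intros continuous_on_compose2[OF cont0] continuous_on_real_polynomial_function poly_B) auto
  then have "(LINT z|lborel. G T z * g (y - z)) = \<bar>c\<bar> ^ DIM('a) * (LINT z|lborel. G T (c *\<^sub>R z) * g (y - c *\<^sub>R z))"
    using c by (intro integral_lborel_scaleR borel_measurable_continuous_onI) auto
  also have "\<dots> = (LINT z|lborel. c ^ DIM('a) * (G T (c *\<^sub>R z) * g (y - c *\<^sub>R z)))"
    using c by simp
  also have "\<dots> = (LINT z|lborel. exp (- (z \<bullet> z)) * (B0 z + B1 z) * g (y - c *\<^sub>R z))"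
  proof (rule Bochner_Integration.integral_cong[OF refl])
    fix z :: 'a
    have "T * ((c *\<^sub>R z) \<bullet> (c *\<^sub>R z)) = z \<bullet> z" using c2 T by (simp add: power2_eq_square field_simps)
    moreover have "B0 (c *\<^sub>R z) + T * B1 (c *\<^sub>R z) = T * c ^ (2 * k) * (B0 z + B1 z)"
      using T by (simp add: B_scaled[OF c] c2 algebra_simps)
    ultimately have "c ^ DIM('a) * G T (c *\<^sub>R z) = (c ^ DIM('a) * c ^ (2 * k) * (T powr (N / 2) * T)) * (exp (- (z \<bullet> z)) * (B0 z + B1 z))"
      unfolding G_def by simp
    \<comment> \<open>The Jacobian c^m and the degree 2k give T^(-(m + 2k)/2), and N/2 + 1 = (m +
      2k)/2.\<close>
    also have "c ^ DIM('a) * c ^ (2 * k) * (T powr (N / 2) * T) = 1"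
    proof -
      have "c ^ DIM('a) * c ^ (2 * k) = T powr (- 1 / 2 * (real (DIM('a) + 2 * k)))"
        unfolding power_add[symmetric] using c T by (simp add: c_def powr_powr flip: powr_realpow)
      moreover have "T powr (N / 2) * T = T powr (N / 2 + 1)" using T by (simp add: powr_add)
      moreover have "- 1 / 2 * (real (DIM('a) + 2 * k)) + (N / 2 + 1) = 0" by (simp add: N field_simps)
      ultimately show ?thesis using T by (simp only: powr_add[symmetric]) simp
    qed
    finally show "c ^ DIM('a) * (G T (c *\<^sub>R z) * g (y - c *\<^sub>R z)) = exp (- (z \<bullet> z)) * (B0 z + B1 z) * g (y - c *\<^sub>R z)"
      by simp
  qed
  finally show ?thesis by (simp add: c_def)
qed

end

context bosonic_kernel
begin

text \<open>Serves both ends: T \<rightarrow> \<infinity> with L = g y, and T \<rightarrow> 0 with L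
  = 0. The point z = 0 is excluded because there the argument stays at y for every T.\<close>

lemma integral_G_tendsto:
  assumes T: "\<And>n. T n > 0" and lim: "\<And>z. z \<noteq> 0 \<Longrightarrow> (\<lambda>n. g (y - (T n powr (- 1 / 2)) *\<^sub>R z)) \<longlonglongrightarrow> L"
  shows "(\<lambda>n. LINT z|lborel. G (T n) z * g (y - z)) \<longlonglongrightarrow> L * gauss (\<lambda>z. B0 z + B1 z)"
proof -
  have poly: "real_polynomial_function (\<lambda>z. B0 z + B1 z)" by (intro poly_intros poly_B)
  obtain C where C: "C > 0" "\<And>x. \<bar>g x\<bar> \<le> C" using bounded_of_support[OF cont0 supp(1)] by metis
  have "(\<lambda>n. LINT z|lborel. exp (- (z \<bullet> z)) * (B0 z + B1 z) * g (y - (T n powr (- 1 / 2)) *\<^sub>R z))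
     \<longlonglongrightarrow> (LINT z|lborel. exp (- (z \<bullet> z)) * (B0 z + B1 z) * L)"
  proof (rule integral_dominated_convergence)
    show "integrable lborel (\<lambda>z. \<bar>exp (- (z \<bullet> z)) * (B0 z + B1 z)\<bar> * C)"
      by (intro integrable_mult_left integrable_abs integrable_gaussian_polynomial poly)
    show "(\<lambda>z. exp (- (z \<bullet> z)) * (B0 z + B1 z) * L) \<in> borel_measurable lborel"
      unfolding measurable_lborel2
      by (intro borel_measurable_continuous_onI continuous_intros continuous_on_real_polynomial_function poly_B)
    show "(\<lambda>z. exp (- (z \<bullet> z)) * (B0 z + B1 z) * g (y - (T n powr (- 1 / 2)) *\<^sub>R z)) \<in> borel_measurable lborel" for n
      unfolding measurable_lborel2
      by (intro borel_measurable_continuous_onI continuous_intros continuous_on_real_polynomial_function poly_B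
          continuous_on_compose2[OF cont0]) auto
    show "AE z in lborel. (\<lambda>n. exp (- (z \<bullet> z)) * (B0 z + B1 z) * g (y - (T n powr (- 1 / 2)) *\<^sub>R z))
        \<longlonglongrightarrow> exp (- (z \<bullet> z)) * (B0 z + B1 z) * L"
      using AE_lborel_singleton[of 0]
    proof eventually_elim
      case (elim z)
      then show ?case by (intro tendsto_mult tendsto_const lim)
    qed
    show "AE z in lborel. norm (exp (- (z \<bullet> z)) * (B0 z + B1 z) * g (y - (T n powr (- 1 / 2)) *\<^sub>R z))
        \<le> \<bar>exp (- (z \<bullet> z)) * (B0 z + B1 z)\<bar> * C" for n
      by (intro AE_I2) (simp only: real_norm_def abs_mult[of _ "g _"] mult_left_mono C(2) abs_ge_zero)
  qed
  moreover have "(LINT z|lborel. exp (- (z \<bullet> z)) * (B0 z + B1 z) * L) = L * gauss (\<lambda>z. B0 z + B1 z)"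
    by (simp add: gauss_def)
  ultimately show ?thesis by (simp only: integral_G[OF T])
qed

text \<open>The truncations converge to the Gamma integral of |z|^(-N). As the integrand is
  nonnegative they also stay below it, which gives the majorant for exchanging the limit with the
  z-integral.\<close>

lemma truncated_gamma_integral:
  fixes z :: 'a
  assumes z: "z \<noteq> 0"
  defines "J \<equiv> \<lambda>n. integral {1 / real (Suc n)..real (Suc n)} (\<lambda>t. t powr (N / 2 - 1) * exp (- t * (z \<bullet> z)))"
  shows "J \<longlonglongrightarrow> Gamma (N / 2) * norm z powr (- N)" and "\<bar>J n\<bar> \<le> Gamma (N / 2) * norm z powr (- N)"
proof -
  define f where "f t = indicator {0..} t * (t powr (N / 2 - 1) * exp (- t * (z \<bullet> z)))" for t
  have s: "z \<bullet> z > 0" using z by simp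
  have "(z \<bullet> z) powr (- (N / 2)) = norm z powr (- N)"
  proof -
    have "z \<bullet> z = norm z powr 2" using z by (simp add: dot_square_norm)
    then show ?thesis by (simp only: powr_powr) simp
  qed
  then have f: "has_bochner_integral lborel f (Gamma (N / 2) * norm z powr (- N))"
    using has_bochner_integral_powr_exp[of "N / 2" "z \<bullet> z"] N_pos s unfolding f_def by simp
  then have fint: "integrable lborel f" and fval: "(LINT t|lborel. f t) = Gamma (N / 2) * norm z powr (- N)"
    by (auto simp: has_bochner_integral_iff)
  have f0: "f t \<ge> 0" for t by (simp add: f_def)
  define I where "I n = {1 / real (Suc n)..real (Suc n)}" for n
  have le: "1 / real (Suc n) \<le> real (Suc n)" "1 / real (Suc n) > 0" for n
    by (auto simp: divide_le_eq intro: order_trans[of 1 "real (Suc n)"] mult_ge1_I)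
  have Jeq: "J n = (LINT t|lborel. indicator (I n) t * f t)" for n
  proof -
    have "continuous_on (I n) (\<lambda>t. t powr (N / 2 - 1) * exp (- t * (z \<bullet> z)))"
      using le(2)[of n] unfolding I_def by (intro continuous_intros) auto
    then have "set_integrable lborel (I n) (\<lambda>t. t powr (N / 2 - 1) * exp (- t * (z \<bullet> z)))"
      unfolding I_def by (rule borel_integrable_atLeastAtMost')
    then have "J n = (LINT t:I n|lborel. t powr (N / 2 - 1) * exp (- t * (z \<bullet> z)))"
      unfolding J_def I_def by (rule set_borel_integral_eq_integral(2)[symmetric])
    also have "\<dots> = (LINT t|lborel. indicator (I n) t * f t)"
    proof -
      have "t \<ge> 0" if "t \<in> I n" for t
        using that le(2)[of n] unfolding I_def atLeastAtMost_iff by linarith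
      then show ?thesis
        unfolding set_lebesgue_integral_def f_def
        by (intro Bochner_Integration.integral_cong) (auto simp: indicator_def)
    qed
    finally show ?thesis .
  qed
  have [measurable]: "f \<in> borel_measurable borel" "I n \<in> sets borel" for n using fint by (auto simp: I_def)
  have If: "integrable lborel (\<lambda>t. indicator (I n) t * f t)" for n
    using fint by (rule Bochner_Integration.integrable_bound) (auto simp: indicator_def f0)
  show "\<bar>J n\<bar> \<le> Gamma (N / 2) * norm z powr (- N)"
  proof -
    have "J n \<ge> 0" unfolding Jeq by (intro Bochner_Integration.integral_nonneg) (simp add: f0)
    moreover have "J n \<le> (LINT t|lborel. f t)"
      unfolding Jeq by (intro integral_mono If fint) (auto simp: indicator_def f0)
    ultimately show ?thesis by (simp add: fval)
  qed
  show "J \<longlonglongrightarrow> Gamma (N / 2) * norm z powr (- N)"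
    unfolding Jeq fval[symmetric]
  proof (rule integral_dominated_convergence[where w=f])
    show "AE t in lborel. (\<lambda>n. indicator (I n) t * f t) \<longlonglongrightarrow> f t"
      using AE_lborel_singleton[of "0::real"]
    proof eventually_elim
      case (elim t)
      show ?case
      proof (cases "t > 0")
        case True
        obtain n0 where n0: "real n0 \<ge> t" "real n0 \<ge> 1 / t" using real_arch_simple[of "max t (1 / t)"] by auto
        have "t \<in> I n" if "n \<ge> n0" for n
        proof -
          have "real (Suc n) \<ge> t" "real (Suc n) \<ge> 1 / t" using n0 that by auto
          then show ?thesis using True by (auto simp: I_def field_simps)
        qed
        then have "eventually (\<lambda>n. indicator (I n) t * f t = f t) sequentially"
          by (auto simp: eventually_sequentially intro!: exI[of _ n0])
        then show ?thesis by (rule tendsto_eventually)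
      next
        case False
        then show ?thesis using elim by (simp add: f_def)
      qed
    qed
  qed (auto simp: fint f0 indicator_def)
qed

text \<open>Two evaluations of the same limit: the truncated kernels converge to |z|^(-N), while
  \<open>time_integral\<close> turns their integrals into boundary terms.\<close>

lemma kernel_integral: "Gamma (N / 2) * (LINT z|lborel. norm z powr (- N) * R y z) = g y * gauss (\<lambda>z. B0 z + B1 z)"
proof -
  define J where "J n z = integral {1 / real (Suc n)..real (Suc n)} (\<lambda>t. t powr (N / 2 - 1) * exp (- t * (z \<bullet> z)))"
    for n and z :: 'a
  note J = truncated_gamma_integral[folded J_def]
  have contG: "continuous_on UNIV (\<lambda>z. G t z * g (y - z))" for t
    unfolding G_def
    by (intro continuous_intros continuous_on_compose2[OF cont0] continuous_on_real_polynomial_function poly_B) auto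
  have intG: "integrable lborel (\<lambda>z. G t z * g (y - z))" for t
    unfolding G_def
    by (intro integrable_locally_mult[OF locally_integrable_continuous cont0 supp(1)] continuous_intros
        continuous_on_real_polynomial_function poly_B)
  have le: "1 / real (Suc n) \<le> real (Suc n)" "1 / real (Suc n) > 0" for n
    by (auto simp: divide_le_eq intro: order_trans[of 1 "real (Suc n)"] mult_ge1_I)
  have eq: "(LINT z|lborel. J n z * R y z)
      = (LINT z|lborel. G (real (Suc n)) z * g (y - z)) - (LINT z|lborel. G (1 / real (Suc n)) z * g (y - z))" for n
    unfolding J_def time_integral[OF le(2) le(1)] left_diff_distrib
    by (rule Bochner_Integration.integral_diff[OF intG intG])
  have l1: "(\<lambda>n. LINT z|lborel. G (real (Suc n)) z * g (y - z)) \<longlonglongrightarrow> g y * gauss (\<lambda>z. B0 z + B1 z)"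
  proof (rule integral_G_tendsto)
    fix z
    have "(\<lambda>n. real (Suc n) powr (- 1 / 2)) \<longlonglongrightarrow> 0"
      by (rule tendsto_neg_powr[OF _ filterlim_compose[OF filterlim_real_sequentially filterlim_Suc]]) simp
    then have "(\<lambda>n. y - real (Suc n) powr (- 1 / 2) *\<^sub>R z) \<longlonglongrightarrow> y - 0 *\<^sub>R z"
      by (intro tendsto_intros)
    then show "(\<lambda>n. g (y - real (Suc n) powr (- 1 / 2) *\<^sub>R z)) \<longlonglongrightarrow> g y"
      using isCont_tendsto_compose[of y g] cont0 by (simp add: continuous_on_eq_continuous_at)
  qed simp
  have l2: "(\<lambda>n. LINT z|lborel. G (1 / real (Suc n)) z * g (y - z)) \<longlonglongrightarrow> 0 * gauss (\<lambda>z. B0 z + B1 z)"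
  proof (rule integral_G_tendsto)
    fix z :: 'a assume z: "z \<noteq> 0"
    \<comment> \<open>From n \<ge> K on, the scaled point has norm at least
      \<open>norm y + \<bar>r\<bar> + 1\<close>, so the argument of g has left the support.\<close>
    define K where "K = ((norm y + \<bar>r\<bar> + 1) / norm z)\<^sup>2"
    obtain n0 where n0: "real n0 \<ge> K" using real_arch_simple by blast
    have "g (y - (1 / real (Suc n)) powr (- 1 / 2) *\<^sub>R z) = 0" if n: "n \<ge> n0" for n
    proof -
      have "(1 / real (Suc n)) powr (- 1 / 2) = sqrt (real (Suc n))"
        by (simp add: powr_divide powr_minus powr_half_sqrt field_simps)
      moreover have "sqrt (real (Suc n)) \<ge> (norm y + \<bar>r\<bar> + 1) / norm z"
        using n n0 unfolding K_def by (intro real_le_rsqrt) simp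
      ultimately have "norm ((1 / real (Suc n)) powr (- 1 / 2) *\<^sub>R z) \<ge> norm y + \<bar>r\<bar> + 1"
        using z by (simp add: field_simps)
      then have "norm (y - (1 / real (Suc n)) powr (- 1 / 2) *\<^sub>R z) > r"
        using norm_triangle_ineq2[of "(1 / real (Suc n)) powr (- 1 / 2) *\<^sub>R z" y] by (simp only: norm_minus_commute)
      then show ?thesis by (rule supp(1))
    qed
    then have "eventually (\<lambda>n. g (y - (1 / real (Suc n)) powr (- 1 / 2) *\<^sub>R z) = 0) sequentially"
      by (auto simp: eventually_sequentially simp del: of_nat_Suc intro!: exI[of _ n0])
    then show "(\<lambda>n. g (y - (1 / real (Suc n)) powr (- 1 / 2) *\<^sub>R z)) \<longlonglongrightarrow> 0" by (rule tendsto_eventually)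
  qed simp
  have lim: "(\<lambda>n. LINT z|lborel. J n z * R y z) \<longlonglongrightarrow> g y * gauss (\<lambda>z. B0 z + B1 z)"
    unfolding eq using tendsto_diff[OF l1 l2] by simp
  have "(\<lambda>n. LINT z|lborel. J n z * R y z) \<longlonglongrightarrow> (LINT z|lborel. Gamma (N / 2) * norm z powr (- N) * R y z)"
  proof (rule integral_dominated_convergence)
    have int: "integrable lborel (\<lambda>z. Gamma (N / 2) * (norm z powr (- N) * R y z))"
      by (rule integrable_mult_right[OF integrable_kernel_R])
    then show "integrable lborel (\<lambda>z. \<bar>Gamma (N / 2) * (norm z powr (- N) * R y z)\<bar>)" by (rule integrable_abs)
    show "(\<lambda>z. Gamma (N / 2) * norm z powr (- N) * R y z) \<in> borel_measurable lborel"
      using borel_measurable_integrable[OF int] by (simp only: mult.assoc)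
    have lims: "AE z in lborel. (\<lambda>n. J n z * R y z) \<longlonglongrightarrow> Gamma (N / 2) * norm z powr (- N) * R y z"
      using AE_lborel_singleton[of 0] by eventually_elim (intro tendsto_mult tendsto_const J)
    show "AE z in lborel. (\<lambda>n. J n z * R y z) \<longlonglongrightarrow> Gamma (N / 2) * norm z powr (- N) * R y z" by (rule lims)
    show "AE z in lborel. norm (J n z * R y z) \<le> \<bar>Gamma (N / 2) * (norm z powr (- N) * R y z)\<bar>" for n
      using AE_lborel_singleton[of 0]
    proof eventually_elim
      case (elim z)
      have "\<bar>J n z\<bar> \<le> \<bar>Gamma (N / 2) * norm z powr (- N)\<bar>" using J(2)[OF elim, of n] by linarith
      then have "\<bar>J n z\<bar> * \<bar>R y z\<bar> \<le> \<bar>Gamma (N / 2) * norm z powr (- N)\<bar> * \<bar>R y z\<bar>" by (rule mult_right_mono) simp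
      then show ?case by (simp only: real_norm_def abs_mult mult.assoc)
    qed
    show "(\<lambda>z. J n z * R y z) \<in> borel_measurable lborel" for n
    proof -
      have "continuous_on UNIV (J n)"
        unfolding continuous_on_eq_continuous_at[OF open_UNIV]
      proof
        fix z :: 'a
        have "continuous_on (ball z 1) (\<lambda>z. integral (cbox (1 / real (Suc n)) (real (Suc n))) (\<lambda>t. t powr (N / 2 - 1) * exp (- t * (z \<bullet> z))))"
          by (rule integral_continuous_on_param)
             (use le(2)[of n] in \<open>auto simp: case_prod_beta cbox_interval intro!: continuous_intros\<close>)
        then show "isCont (J n) z"
          by (simp add: J_def[abs_def] cbox_interval continuous_on_eq_continuous_at)
      qed
      then show ?thesis unfolding measurable_lborel2
        by (intro borel_measurable_continuous_onI continuous_intros continuous_R)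
    qed
  qed
  from LIMSEQ_unique[OF this lim] show ?thesis by (simp add: mult.assoc)
qed

text \<open>The moments containing \<open>hzz\<close> are 0 and that of
  \<open>(z \<bullet> v) * hz z\<close> is half that of \<open>hv\<close>, so all terms with 1 / N
  cancel.\<close>

lemma gauss_B: "gauss (\<lambda>z. B0 z + B1 z) = 4 * gauss (\<lambda>z. hv z) - 4 * gauss (\<lambda>z. q z)"
proof -
  have B0: "gauss B0 = 4 * (N + 2) / N * gauss (\<lambda>z. hv z) + 8 * (N + 2) / (N * (N - 2)) * ((v \<bullet> v) * gauss (\<lambda>z. hzz z))"
  proof -
    have "gauss B0 = 4 * (N + 2) / N * gauss (\<lambda>z. hv z) + 8 * (N + 2) * (v \<bullet> v) / (N * (N - 2)) * gauss (\<lambda>z. hzz z)"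
      unfolding B0_def[abs_def]
      by (subst gauss_add, intro poly_kernel_intros, intro poly_kernel_intros, simp only: gauss_cmult)
    then show ?thesis by (simp add: mult_ac)
  qed
  have B1: "gauss B1 = - 4 * gauss (\<lambda>z. q z) + (- 16 / N) * gauss (\<lambda>z. (z \<bullet> v) * hz z)
      + (- 16 / (N * (N - 2))) * ((v \<bullet> v) * gauss (\<lambda>z. (z \<bullet> z) * hzz z))"
  proof -
    have "gauss B1 = - 4 * gauss (\<lambda>z. q z) + (- 16 / N) * gauss (\<lambda>z. (z \<bullet> v) * hz z)
      + (- 16 * (v \<bullet> v) / (N * (N - 2))) * gauss (\<lambda>z. (z \<bullet> z) * hzz z)"
      unfolding B1_def[abs_def]
      by (subst gauss_add, intro poly_kernel_intros, intro poly_kernel_intros,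
          subst gauss_add, intro poly_kernel_intros, intro poly_kernel_intros, simp only: gauss_cmult)
    then show ?thesis by (simp add: mult_ac)
  qed
  note rel = gauss_moment_relations[OF h, of v]
  have "gauss (\<lambda>z. B0 z + B1 z) = gauss B0 + gauss B1"
    by (rule gauss_add[OF poly_B])
  also have "\<dots> = 4 * gauss (\<lambda>z. hv z) - 4 * gauss (\<lambda>z. q z)"
    unfolding B0 B1 rel(2-4) using N_pos by (simp add: field_simps)
  finally show ?thesis .
qed

text \<open>The Pochhammer factor of the Gaussian mass is also Gamma (N/2) / Gamma (m/2 - 1), coming
  from the representation of |z|^(-N). Both cancel, and what remains is the reciprocal of
  \<open>fundamental_const\<close> times h v.\<close>

lemma fundamental_kernel_integral:
  "fundamental_const TYPE('a) k * (LINT z|lborel. norm z powr (- N) * R y z) = g y * h v"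
proof -
  define m where "m = real DIM('a)"
  define b where "b = unit_ball_vol m"
  define \<Gamma>1 where "\<Gamma>1 = Gamma (m / 2 - 1)"
  define P where "P = pochhammer (m / 2 - 1) k"
  define I where "I = (LINT z|lborel. norm z powr (- N) * R y z)"
  have m: "m \<ge> 3" using dim3 by (simp add: m_def)
  have b: "b > 0" using m by (simp add: b_def)
  have G1: "\<Gamma>1 > 0" using m by (simp add: \<Gamma>1_def Gamma_real_pos)
  have np: "m / 2 - 1 \<notin> \<int>\<^sub>\<le>\<^sub>0" "m / 2 \<notin> \<int>\<^sub>\<le>\<^sub>0" using m by (auto elim!: nonpos_Ints_cases)
  have "P = Gamma (m / 2 - 1 + real k) / \<Gamma>1" using np by (simp add: P_def \<Gamma>1_def pochhammer_Gamma)
  moreover have "m / 2 - 1 + real k = N / 2" by (simp add: N m_def field_simps)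
  ultimately have GN: "Gamma (N / 2) = P * \<Gamma>1" using G1 by simp
  have P: "P > 0" unfolding P_def using m by (intro pochhammer_pos) simp
  have "Gamma (m / 2 + 1) = m / 2 * (m / 2 - 1) * \<Gamma>1"
    using Gamma_plus1[OF np(1)] Gamma_plus1[OF np(2)] by (simp add: \<Gamma>1_def)
  then have q: "gauss (\<lambda>z. q z) = b * (m / 2 * (m / 2 - 1) * \<Gamma>1) * P * h v"
    using gauss_harmonic_refl[OF h, of v] by (simp add: b_def P_def m_def)
  have V: "2 * real k * gauss (\<lambda>z. q z) = (m + 2 * real k - 4) * gauss (\<lambda>z. hv z)"
    using gauss_moment_relations(1)[OF h, of v] by (simp add: m_def)
  have main: "P * \<Gamma>1 * I = g y * (4 * gauss (\<lambda>z. hv z) - 4 * gauss (\<lambda>z. q z))"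
    using kernel_integral[of y] unfolding gauss_B GN I_def .
  have \<omega>: "measure (surface_measure :: 'a measure) UNIV = m * b"
    by (simp add: measure_surface_measure m_def b_def)
  have key: "fundamental_const TYPE('a) k * (4 * gauss (\<lambda>z. hv z) - 4 * gauss (\<lambda>z. q z)) = P * \<Gamma>1 * h v"
  proof (cases "k = 0")
    \<comment> \<open>For k = 0 the gradient moment vanishes and the mass is -4 times that of
      \<open>q\<close>, whence the separate form and the sign of the constant.\<close>
    case True
    then have "dir_deriv c h x = 0" for c x using h dir_deriv_degree_0 by blast
    then have "gauss (\<lambda>z. hv z) = 0" by (simp add: grad_def gauss_def)
    then show ?thesis
      using True m b by (simp add: fundamental_const_def Let_def \<omega> q m_def[symmetric] field_simps)
  next
    case False
    then have m4: "m \<noteq> 4" using dim4 by (auto simp: m_def)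
    define M where "M = m + 2 * real k - 4"
    have M: "M > 0" using False m unfolding M_def by (cases k) auto
    have V': "gauss (\<lambda>z. hv z) = 2 * real k * gauss (\<lambda>z. q z) / M"
      using V M unfolding M_def[symmetric] by (simp add: field_simps)
    \<comment> \<open>Since 2 k - M = 4 - m, the difference of the two moments is (4 - m) / M times
      the second one.\<close>
    have "4 * gauss (\<lambda>z. hv z) - 4 * gauss (\<lambda>z. q z) = 4 * (4 - m) / M * gauss (\<lambda>z. q z)"
      unfolding V' using M by (simp add: field_simps) (simp add: M_def algebra_simps)
    moreover have "fundamental_const TYPE('a) k = M / ((m - 2) * (4 - m) * (m * b))"
      using False by (simp add: fundamental_const_def Let_def \<omega> M_def m_def[symmetric])
    moreover have "4 - m \<noteq> 0" using m4 by simp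
    moreover have "M / ((m - 2) * d * (m * b)) * (4 * d / M * x) = 4 / ((m - 2) * (m * b)) * x" if "d \<noteq> 0" for d x
      using that M by simp
    ultimately have "fundamental_const TYPE('a) k * (4 * gauss (\<lambda>z. hv z) - 4 * gauss (\<lambda>z. q z))
        = 4 / ((m - 2) * (m * b)) * gauss (\<lambda>z. q z)"
      by (simp only:)
    also have "\<dots> = P * \<Gamma>1 * h v" unfolding q using m b by (simp add: field_simps)
    finally show ?thesis .
  qed
  have "P * \<Gamma>1 * (fundamental_const TYPE('a) k * I) = fundamental_const TYPE('a) k * (P * \<Gamma>1 * I)" by (simp only: mult_ac)
  also have "\<dots> = g y * (fundamental_const TYPE('a) k * (4 * gauss (\<lambda>z. hv z) - 4 * gauss (\<lambda>z. q z)))"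
    unfolding main by (simp only: mult_ac)
  also have "\<dots> = P * \<Gamma>1 * (g y * h v)" unfolding key by (simp only: mult_ac)
  finally show ?thesis using P G1 by (simp add: I_def)
qed

end

section \<open>The potential\<close>

text \<open>A componentwise form of being C2, convenient for sums, products and substitutions, and
  the form in which convolution delivers derivatives.\<close>

definition twice_C1 :: "('b::euclidean_space \<Rightarrow> real) \<Rightarrow> bool" where
  "twice_C1 F \<longleftrightarrow> (\<exists>F' F''. (\<forall>x. (F has_derivative F' x) (at x)) \<and>
     (\<forall>d x. ((\<lambda>x. F' x d) has_derivative F'' d x) (at x)) \<and>
     (\<forall>d e. continuous_on UNIV (\<lambda>x. F'' d x e)))"

text \<open>In finite dimension the operator-valued derivatives are finite combinations of fixed
  functionals with real coefficients, so their differentiability and continuity reduce to those of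
  the components.\<close>

lemma C2_on_twice_C1:
  fixes F :: "'b::euclidean_space \<Rightarrow> real"
  assumes "twice_C1 F"
  shows "C2_on S F"
proof -
  obtain F' F'' where F: "\<And>x. (F has_derivative F' x) (at x)" "\<And>d x. ((\<lambda>x. F' x d) has_derivative F'' d x) (at x)"
    "\<And>d e. continuous_on UNIV (\<lambda>x. F'' d x e)"
    using assms unfolding twice_C1_def by blast
  define g' :: "'b \<Rightarrow> 'b \<Rightarrow>\<^sub>L real" where "g' x = (\<Sum>b\<in>Basis. F' x b *\<^sub>R blinfun_inner_left b)" for x
  define g'' :: "'b \<Rightarrow> 'b \<Rightarrow>\<^sub>L ('b \<Rightarrow>\<^sub>L real)" where
    "g'' x = (\<Sum>b\<in>Basis. \<Sum>c\<in>Basis. F'' b x c *\<^sub>R (blinfun_scaleR_left (blinfun_inner_left b) o\<^sub>L blinfun_inner_left c))" for x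
  have expand: "L d = (\<Sum>b\<in>Basis. L b * (d \<bullet> b))" if "linear L" for L :: "'b \<Rightarrow> real" and d
  proof -
    have "L d = L (\<Sum>b\<in>Basis. (d \<bullet> b) *\<^sub>R b)" by (simp only: euclidean_representation)
    also have "\<dots> = (\<Sum>b\<in>Basis. L b * (d \<bullet> b))"
      by (simp only: linear_sum[OF that] linear_scale[OF that] real_scaleR_def mult.commute)
    finally show ?thesis .
  qed
  have "blinfun_apply (g' x) = F' x" for x
  proof
    fix d
    show "blinfun_apply (g' x) d = F' x d"
      unfolding expand[OF has_derivative_linear[OF F(1)], of x d]
      by (simp add: g'_def blinfun.sum_left blinfun.scaleR_left)
  qed
  then have 1: "(F has_derivative blinfun_apply (g' x)) (at x)" for x using F(1) by simp
  have "(g' has_derivative (\<lambda>e. \<Sum>b\<in>Basis. F'' b x e *\<^sub>R blinfun_inner_left b)) (at x)" for x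
    unfolding g'_def[abs_def] by (intro has_derivative_sum has_derivative_scaleR_left F(2))
  moreover have "(\<lambda>e. \<Sum>b\<in>Basis. F'' b x e *\<^sub>R blinfun_inner_left b) = blinfun_apply (g'' x)" for x
  proof
    fix e
    have "F'' b x e *\<^sub>R blinfun_inner_left b = (\<Sum>c\<in>Basis. F'' b x c *\<^sub>R ((e \<bullet> c) *\<^sub>R (blinfun_inner_left b :: 'b \<Rightarrow>\<^sub>L real)))" for b
      by (subst expand[OF has_derivative_linear[OF F(2)], of b x e]) (simp add: scaleR_sum_left)
    then show "(\<Sum>b\<in>Basis. F'' b x e *\<^sub>R blinfun_inner_left b) = blinfun_apply (g'' x) e"
      by (simp add: g''_def blinfun.sum_left blinfun.scaleR_left)
  qed
  ultimately have 2: "(g' has_derivative blinfun_apply (g'' x)) (at x)" for x by simp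
  have "continuous_on UNIV g''"
    unfolding g''_def by (intro continuous_intros F(3))
  then have "continuous_on S g''" by (rule continuous_on_subset) simp
  with 1 2 show ?thesis unfolding C2_on_def by blast
qed

section \<open>Closure properties of componentwise C2 functions, and the slices of f\<close>

lemma twice_C1_mult:
  assumes "twice_C1 f" "twice_C1 g"
  shows "twice_C1 (\<lambda>x. f x * g x)"
proof -
  obtain f' f'' where f: "\<And>x. (f has_derivative f' x) (at x)" "\<And>d x. ((\<lambda>x. f' x d) has_derivative f'' d x) (at x)"
    "\<And>d e. continuous_on UNIV (\<lambda>x. f'' d x e)"
    using assms(1) unfolding twice_C1_def by blast
  obtain g' g'' where g: "\<And>x. (g has_derivative g' x) (at x)" "\<And>d x. ((\<lambda>x. g' x d) has_derivative g'' d x) (at x)"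
    "\<And>d e. continuous_on UNIV (\<lambda>x. g'' d x e)"
    using assms(2) unfolding twice_C1_def by blast
  have cont: "continuous_on UNIV f" "continuous_on UNIV (\<lambda>x. f' x d)" "continuous_on UNIV g" "continuous_on UNIV (\<lambda>x. g' x d)" for d
    using f g by (auto intro!: has_derivative_continuous_on)
  show ?thesis
    unfolding twice_C1_def
  proof (intro exI conjI allI)
    show "((\<lambda>x. f x * g x) has_derivative (\<lambda>d. f x * g' x d + f' x d * g x)) (at x)" for x
      by (rule has_derivative_mult[OF f(1) g(1)])
    show "((\<lambda>x. f x * g' x d + f' x d * g x) has_derivative
        (\<lambda>e. (f x * g'' d x e + f' x e * g' x d) + (f' x d * g' x e + f'' d x e * g x))) (at x)" for d x
      by (intro has_derivative_add has_derivative_mult f g)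
    show "continuous_on UNIV (\<lambda>x. (f x * g'' d x e + f' x e * g' x d) + (f' x d * g' x e + f'' d x e * g x))" for d e
      by (intro continuous_intros cont f(3) g(3))
  qed
qed

lemma twice_C1_add:
  assumes "twice_C1 f" "twice_C1 g"
  shows "twice_C1 (\<lambda>x. f x + g x)"
proof -
  obtain f' f'' where f: "\<And>x. (f has_derivative f' x) (at x)" "\<And>d x. ((\<lambda>x. f' x d) has_derivative f'' d x) (at x)"
    "\<And>d e. continuous_on UNIV (\<lambda>x. f'' d x e)"
    using assms(1) unfolding twice_C1_def by blast
  obtain g' g'' where g: "\<And>x. (g has_derivative g' x) (at x)" "\<And>d x. ((\<lambda>x. g' x d) has_derivative g'' d x) (at x)"
    "\<And>d e. continuous_on UNIV (\<lambda>x. g'' d x e)"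
    using assms(2) unfolding twice_C1_def by blast
  show ?thesis
    unfolding twice_C1_def
  proof (intro exI conjI allI)
    show "((\<lambda>x. f x + g x) has_derivative (\<lambda>d. f' x d + g' x d)) (at x)" for x
      by (rule has_derivative_add[OF f(1) g(1)])
    show "((\<lambda>x. f' x d + g' x d) has_derivative (\<lambda>e. f'' d x e + g'' d x e)) (at x)" for d x
      by (intro has_derivative_add f g)
    show "continuous_on UNIV (\<lambda>x. f'' d x e + g'' d x e)" for d e
      by (intro continuous_intros f(3) g(3))
  qed
qed

lemma twice_C1_zero: "twice_C1 (\<lambda>x. 0)"
  unfolding twice_C1_def by (intro exI[of _ "\<lambda>_ _. 0"] exI[of _ "\<lambda>_ _ _. 0"]) auto

lemma twice_C1_sum:
  "(\<And>i. i \<in> I \<Longrightarrow> twice_C1 (f i)) \<Longrightarrow> twice_C1 (\<lambda>x. \<Sum>i\<in>I. f i x)"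
  by (induction I rule: infinite_finite_induct) (auto intro: twice_C1_zero twice_C1_add)

lemma twice_C1_compose_linear:
  assumes f: "twice_C1 f" and L: "bounded_linear L"
  shows "twice_C1 (\<lambda>x. f (L x))"
proof -
  obtain f' f'' where f: "\<And>x. (f has_derivative f' x) (at x)" "\<And>d x. ((\<lambda>x. f' x d) has_derivative f'' d x) (at x)"
    "\<And>d e. continuous_on UNIV (\<lambda>x. f'' d x e)"
    using f unfolding twice_C1_def by blast
  have dL: "(L has_derivative L) (at x)" for x by (rule bounded_linear_imp_has_derivative[OF L])
  show ?thesis
    unfolding twice_C1_def
  proof (intro exI conjI allI)
    show "((\<lambda>x. f (L x)) has_derivative (\<lambda>d. f' (L x) (L d))) (at x)" for x
      by (rule has_derivative_compose[OF dL f(1)])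
    show "((\<lambda>x. f' (L x) (L d)) has_derivative (\<lambda>e. f'' (L d) (L x) (L e))) (at x)" for d x
      by (rule has_derivative_compose[OF dL f(2)])
    show "continuous_on UNIV (\<lambda>x. f'' (L d) (L x) (L e))" for d e
      by (rule continuous_on_compose2[OF f(3)]) (auto intro: linear_continuous_on L)
  qed
qed

lemma twice_C1_real_polynomial_function:
  assumes p: "real_polynomial_function p"
  shows "twice_C1 p"
  unfolding twice_C1_def
proof (intro exI conjI allI)
  show "(p has_derivative (\<lambda>d. dir_deriv d p x)) (at x)" for x by (rule has_derivative_dir_deriv[OF p])
  show "((\<lambda>x. dir_deriv d p x) has_derivative (\<lambda>e. dir_deriv e (dir_deriv d p) x)) (at x)" for d x
    by (intro has_derivative_dir_deriv real_polynomial_function_dir_deriv p)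
  show "continuous_on UNIV (\<lambda>x. dir_deriv e (dir_deriv d p) x)" for d e
    using continuous_on_real_polynomial_function[OF real_polynomial_function_dir_deriv[OF real_polynomial_function_dir_deriv[OF p]]] by blast
qed

lemma has_derivative_eq_0_on_open:
  assumes f: "(f has_derivative f') (at x)" and S: "open S" "x \<in> S" "\<And>y. y \<in> S \<Longrightarrow> f y = 0"
  shows "f' d = 0"
proof -
  have "(f has_derivative (\<lambda>d. 0)) (at x)"
    by (rule has_derivative_transform_within_open[OF has_derivative_const S(1,2)]) (simp add: S(3))
  from has_derivative_unique[OF f this] show ?thesis by simp
qed

text \<open>One radius r serves all u because the support is taken in x uniformly over the ball. The
  derivatives of a slice are the full ones restricted to directions (d, 0).\<close>

lemma C2c_harmonic_slices:
  fixes f :: "'a::euclidean_space \<Rightarrow> 'a \<Rightarrow> real"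
  assumes f: "f \<in> C2c_harmonic k"
  shows "\<exists>r. \<forall>u\<in>ball 0 1. \<exists>g1 g2. compactly_supported_C2 (\<lambda>x. f x u) g1 g2 r"
proof -
  have "C2_on (UNIV \<times> ball 0 1) (\<lambda>(x, u). f x u)" using f by (simp add: C2c_harmonic_def C2_harmonic_def)
  then obtain F' :: "'a \<times> 'a \<Rightarrow> ('a \<times> 'a) \<Rightarrow>\<^sub>L real" and F'' :: "'a \<times> 'a \<Rightarrow> ('a \<times> 'a) \<Rightarrow>\<^sub>L (('a \<times> 'a) \<Rightarrow>\<^sub>L real)" where
    F: "\<And>x u. u \<in> ball 0 1 \<Longrightarrow> ((\<lambda>(x, u). f x u) has_derivative blinfun_apply (F' (x, u))) (at (x, u))"
      "\<And>x u. u \<in> ball 0 1 \<Longrightarrow> (F' has_derivative blinfun_apply (F'' (x, u))) (at (x, u))"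
      "continuous_on (UNIV \<times> ball 0 1) F''"
    unfolding C2_on_def by (metis UNIV_I mem_Times_iff fst_conv snd_conv)
  have "bounded (closure {x. \<exists>u\<in>ball 0 1. f x u \<noteq> 0})"
    using f by (auto simp: C2c_harmonic_def compact_imp_bounded)
  then obtain r where r: "\<And>x. x \<in> closure {x. \<exists>u\<in>ball 0 1. f x u \<noteq> 0} \<Longrightarrow> norm x \<le> r"
    by (auto simp: bounded_iff)
  have f0: "f x u = 0" if "norm x > r" "u \<in> ball 0 1" for x u
  proof (rule ccontr)
    assume "f x u \<noteq> 0"
    then have "x \<in> {x. \<exists>u\<in>ball 0 1. f x u \<noteq> 0}" using that by blast
    then have "x \<in> closure {x. \<exists>u\<in>ball 0 1. f x u \<noteq> 0}" using closure_subset by (rule rev_subsetD)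
    then show False using r that by fastforce
  qed
  have "compactly_supported_C2 (\<lambda>x. f x u) (\<lambda>x d. F' (x, u) (d, 0)) (\<lambda>b x e. F'' (x, u) (e, 0) (b, 0)) r"
    if u: "u \<in> ball 0 1" for u
  proof
    have pair: "((\<lambda>x. (x, u)) has_derivative (\<lambda>d. (d, 0))) (at x)" for x :: 'a
      by (auto intro!: derivative_eq_intros)
    show d1: "((\<lambda>x. f x u) has_derivative (\<lambda>d. F' (x, u) (d, 0))) (at x)" for x
      using has_derivative_compose[OF pair F(1)[OF u]] by simp
    show d2: "((\<lambda>x. F' (x, u) (b, 0)) has_derivative (\<lambda>e. F'' (x, u) (e, 0) (b, 0))) (at x)" for b x
      by (rule bounded_linear.has_derivative[OF blinfun.bounded_linear_left has_derivative_compose[OF pair F(2)[OF u]]])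
    show "continuous_on UNIV (\<lambda>x. F'' (x, u) (a, 0) (b, 0))" for a b
    proof -
      have "continuous_on UNIV (\<lambda>x. F'' (x, u))"
        by (rule continuous_on_compose2[OF F(3)]) (use u in \<open>auto intro!: continuous_intros\<close>)
      then show ?thesis by (intro blinfun.continuous_on continuous_on_const)
    qed
    \<comment> \<open>On this open set f vanishes identically, so its derivatives vanish there
      too.\<close>
    have op: "open {x::'a. norm x > r}" by (intro open_Collect_less continuous_intros)
    show "f x u = 0" if "norm x > r" for x by (rule f0[OF that u])
    show F'0: "F' (x, u) (a, 0) = 0" if "norm x > r" for x a
      by (rule has_derivative_eq_0_on_open[OF d1 op]) (use that f0[OF _ u] in auto)
    show "F'' (x, u) (a, 0) (b, 0) = 0" if "norm x > r" for x a b
      by (rule has_derivative_eq_0_on_open[OF d2 op]) (use that F'0 in auto)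
  qed
  then show ?thesis by blast
qed

lemma sum_rotate:
  "(\<Sum>a\<in>A. \<Sum>b\<in>B. \<Sum>w\<in>C. \<Sum>u\<in>D. x a b w u) = (\<Sum>u\<in>D. \<Sum>a\<in>A. \<Sum>b\<in>B. \<Sum>w\<in>C. x a b w u)"
proof -
  have "(\<Sum>a\<in>A. \<Sum>b\<in>B. \<Sum>w\<in>C. \<Sum>u\<in>D. x a b w u) = (\<Sum>a\<in>A. \<Sum>b\<in>B. \<Sum>u\<in>D. \<Sum>w\<in>C. x a b w u)"
    by (rule sum.cong[OF refl], rule sum.cong[OF refl], rule sum.swap)
  also have "\<dots> = (\<Sum>a\<in>A. \<Sum>u\<in>D. \<Sum>b\<in>B. \<Sum>w\<in>C. x a b w u)"
    by (rule sum.cong[OF refl], rule sum.swap)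
  also have "\<dots> = (\<Sum>u\<in>D. \<Sum>a\<in>A. \<Sum>b\<in>B. \<Sum>w\<in>C. x a b w u)"
    by (rule sum.swap)
  finally show ?thesis .
qed

text \<open>On a sum of products each derivative acts on one factor. Collecting everything by
  coordinate pairs (a, b) yields the coefficients that reappear in \<open>coef\<close>.\<close>

lemma bosonic_laplacian_separable:
  fixes g :: "'i \<Rightarrow> 'a::euclidean_space \<Rightarrow> real"
  assumes g: "\<And>w x. w \<in> W \<Longrightarrow> (g w has_derivative g1 w x) (at x)"
      "\<And>w b x. w \<in> W \<Longrightarrow> ((\<lambda>x. g1 w x b) has_derivative g2 w b x) (at x)"
    and e: "\<And>w. w \<in> W \<Longrightarrow> real_polynomial_function (e w)"
    and N: "N = DIM('a) + 2 * real k - 2"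
  shows "bosonic_laplacian k (\<lambda>x u. \<Sum>w\<in>W. g w x * e w u) y v
    = (\<Sum>a\<in>Basis. \<Sum>b\<in>Basis. \<Sum>w\<in>W. g2 w b y a * ((a \<bullet> b) * e w v + (- 4 / N * (v \<bullet> a)) * (grad (e w) v \<bullet> b)
        + 4 * (v \<bullet> v) / (N * (N - 2)) * (hess (e w) v a \<bullet> b)))"
proof -
  define F where "F x u = (\<Sum>w\<in>W. g w x * e w u)" for x u
  have pd1: "partial_deriv b (\<lambda>x. F x u) x = (\<Sum>w\<in>W. g1 w x b * e w u)" for b u x
    unfolding F_def by (rule partial_deriv_eqI) (intro has_derivative_sum has_derivative_mult_left g)
  then have pd1': "partial_deriv b (\<lambda>x. F x u) = (\<lambda>x. \<Sum>w\<in>W. g1 w x b * e w u)" for b u by (rule ext)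
  have "partial_deriv a (\<lambda>x. \<Sum>w\<in>W. g1 w x b * e w u) x = (\<Sum>w\<in>W. g2 w b x a * e w u)" for a b u x
    by (rule partial_deriv_eqI) (intro has_derivative_sum has_derivative_mult_left g)
  then have lap: "laplacian (\<lambda>x. F x u) x = (\<Sum>b\<in>Basis. \<Sum>w\<in>W. g2 w b x b * e w u)" for u x
    by (simp add: laplacian_def pd1')
  have "partial_deriv b (\<lambda>u. \<Sum>w\<in>W. g1 w x b * e w u) u = (\<Sum>w\<in>W. g1 w x b * (grad (e w) u \<bullet> b))" for b u x
    by (rule partial_deriv_eqI) (intro has_derivative_sum has_derivative_mult_right has_derivative_grad_inner e)
  then have "Du_dot_Dx F x u = (\<Sum>b\<in>Basis. \<Sum>w\<in>W. g1 w x b * (grad (e w) u \<bullet> b))" for x u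
    by (simp add: Du_dot_Dx_def pd1)
  then have Du: "Du_dot_Dx F = (\<lambda>x u. \<Sum>b\<in>Basis. \<Sum>w\<in>W. g1 w x b * (grad (e w) u \<bullet> b))" by (intro ext)
  have pd2: "partial_deriv a (\<lambda>x. \<Sum>b\<in>Basis. \<Sum>w\<in>W. g1 w x b * (grad (e w) u \<bullet> b)) x
      = (\<Sum>b\<in>Basis. \<Sum>w\<in>W. g2 w b x a * (grad (e w) u \<bullet> b))" for a u x
    by (rule partial_deriv_eqI) (intro has_derivative_sum has_derivative_mult_left g)
  have pd3: "partial_deriv a (\<lambda>u. \<Sum>b\<in>Basis. \<Sum>w\<in>W. g2 w b x a * (grad (e w) u \<bullet> b)) u
      = (\<Sum>b\<in>Basis. \<Sum>w\<in>W. g2 w b x a * (hess (e w) u a \<bullet> b))" for a u x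
    by (rule partial_deriv_eqI)
       (intro has_derivative_sum has_derivative_mult_right has_derivative_inner_left has_derivative_grad e)
  have uD: "u_dot_Dx (Du_dot_Dx F) y v = (\<Sum>a\<in>Basis. \<Sum>b\<in>Basis. \<Sum>w\<in>W. g2 w b y a * ((v \<bullet> a) * (grad (e w) v \<bullet> b)))"
    unfolding u_dot_Dx_def Du pd2 by (simp add: sum_distrib_left mult_ac)
  have DD: "Du_dot_Dx (Du_dot_Dx F) y v = (\<Sum>a\<in>Basis. \<Sum>b\<in>Basis. \<Sum>w\<in>W. g2 w b y a * (hess (e w) v a \<bullet> b))"
    by (subst Du_dot_Dx_def) (simp only: Du pd2 pd3)
  have L: "laplacian (\<lambda>x. F x v) y = (\<Sum>a\<in>Basis. \<Sum>b\<in>Basis. \<Sum>w\<in>W. g2 w b y a * ((a \<bullet> b) * e w v))"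
    unfolding lap
  proof (rule sum.cong[OF refl])
    fix a :: 'a assume a: "a \<in> Basis"
    have "(\<Sum>b\<in>Basis. \<Sum>w\<in>W. g2 w b y a * ((a \<bullet> b) * e w v)) = (\<Sum>b\<in>Basis. if b = a then \<Sum>w\<in>W. g2 w b y a * e w v else 0)"
      using a by (intro sum.cong refl) (auto simp: inner_Basis)
    also have "\<dots> = (\<Sum>w\<in>W. g2 w a y a * e w v)" using a by (subst sum.delta) auto
    finally show "(\<Sum>w\<in>W. g2 w a y a * e w v) = (\<Sum>b\<in>Basis. \<Sum>w\<in>W. g2 w b y a * ((a \<bullet> b) * e w v))" by simp
  qed
  have "bosonic_laplacian k F y v = laplacian (\<lambda>x. F x v) y + (- 4 / N) * u_dot_Dx (Du_dot_Dx F) y v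
      + 4 * (v \<bullet> v) / (N * (N - 2)) * Du_dot_Dx (Du_dot_Dx F) y v"
    by (simp add: bosonic_laplacian_def Let_def N dot_square_norm algebra_simps)
  also have "\<dots> = (\<Sum>a\<in>Basis. \<Sum>b\<in>Basis. \<Sum>w\<in>W. g2 w b y a * ((a \<bullet> b) * e w v + (- 4 / N * (v \<bullet> a)) * (grad (e w) v \<bullet> b)
        + 4 * (v \<bullet> v) / (N * (N - 2)) * (hess (e w) v a \<bullet> b)))"
    unfolding L uD DD sum_distrib_left distrib_left sum.distrib[symmetric]
    by (intro sum.cong refl) (simp add: mult_ac)
  finally show ?thesis by (simp add: F_def[abs_def])
qed

theorem theorem3p3:
  fixes f :: "'a::euclidean_space \<Rightarrow> 'a \<Rightarrow> real" and k :: nat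
  assumes "DIM('a) \<ge> 3"
    and "DIM('a) \<noteq> 4 \<or> k = 0"
    and "f \<in> C2c_harmonic k"
  shows "bosonic_potential k f \<in> C2_harmonic k
    \<and> (\<forall>y. \<forall>v\<in>ball 0 1. bosonic_laplacian k (bosonic_potential k f) y v = f y v)"
proof -
  define N where "N = DIM('a) + 2 * real k - 2"
  define c where "c = fundamental_const TYPE('a) k"
  have fH: "f x \<in> harmonic_polys k" for x
    using assms(3) by (simp add: C2c_harmonic_def C2_harmonic_def)
  obtain U :: "'a set" and e where U: "finite U" "U \<subseteq> ball 0 1" and eH: "\<And>u. u \<in> U \<Longrightarrow> e u \<in> harmonic_polys k"
    and interp: "\<And>h x. h \<in> harmonic_polys k \<Longrightarrow> h x = (\<Sum>u\<in>U. h u * e u x)"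
    using harmonic_interpolation by metis
  note eP = harmonic_polys_poly[OF eH]
  obtain r where "\<forall>u\<in>ball 0 1. \<exists>g1 g2. compactly_supported_C2 (\<lambda>x. f x u) g1 g2 r"
    using C2c_harmonic_slices[OF assms(3)] by blast
  then obtain g1 g2 where slice: "\<And>u. u \<in> ball 0 1 \<Longrightarrow> compactly_supported_C2 (\<lambda>x. f x u) (g1 u) (g2 u) r"
    by metis
  have bk: "bosonic_kernel (e u) k N (\<lambda>x. f x u) (g1 u) (g2 u) r" if "u \<in> U" for u
    using that U(2) by (intro bosonic_kernel.intro harmonic_kernel.intro slice eH assms(1,2) N_def) auto
  \<comment> \<open>The index u comes from expanding f, the index w from expanding the reflected
    polynomial in v.\<close>
  define \<kappa> where "\<kappa> u w z = norm z powr (- N) * e u (srefl z w)" for u w z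
  have \<kappa>: "locally_integrable (\<kappa> u w)" if u: "u \<in> U" for u w
  proof -
    interpret bosonic_kernel "e u" k w N "\<lambda>x. f x u" "g1 u" "g2 u" r by (rule bk[OF u])
    show ?thesis
      unfolding \<kappa>_def by (rule locally_integrable_homogeneous_kernel[OF poly_q q_scaled N dim3])
  qed
  \<comment> \<open>The second interpolation separates v from z: the y-dependence goes into
    convolutions \<Phi> w, the v-dependence into fixed polynomials \<open>e w\<close>.\<close>
  have expand: "e u (srefl z v) = (\<Sum>w\<in>U. e u (srefl z w) * e w v)" if "u \<in> U" for u z v
    by (rule interp[OF harmonic_refl[OF eH[OF that]]])
  define \<Phi> where "\<Phi> w y = (\<Sum>u\<in>U. c * (LINT z|lborel. \<kappa> u w z * f (y - z) u))" for w y
  define \<Phi>1 where "\<Phi>1 w y d = (\<Sum>u\<in>U. c * (LINT z|lborel. \<kappa> u w z * g1 u (y - z) d))" for w y d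
  define \<Phi>2 where "\<Phi>2 w b y a = (\<Sum>u\<in>U. c * (LINT z|lborel. \<kappa> u w z * g2 u b (y - z) a))" for w b y a
  have facts: "integrable lborel (\<lambda>z. \<kappa> u w z * f (y - z) u)"
    "((\<lambda>y. LINT z|lborel. \<kappa> u w z * f (y - z) u) has_derivative (\<lambda>d. LINT z|lborel. \<kappa> u w z * g1 u (y - z) d)) (at y)"
    "((\<lambda>y. LINT z|lborel. \<kappa> u w z * g1 u (y - z) b) has_derivative (\<lambda>a. LINT z|lborel. \<kappa> u w z * g2 u b (y - z) a)) (at y)"
    "continuous_on UNIV (\<lambda>y. LINT z|lborel. \<kappa> u w z * g2 u b (y - z) a)"
    "integrable lborel (\<lambda>z. \<kappa> u w z * g2 u b (y - z) a)"
    if u: "u \<in> U" for u w y a b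
  proof -
    interpret compactly_supported_C2 "\<lambda>x. f x u" "g1 u" "g2 u" r by (rule slice) (use u U in blast)
    note k = \<kappa>[OF u, of w]
    show "integrable lborel (\<lambda>z. \<kappa> u w z * f (y - z) u)" by (rule integrable_locally_mult[OF k cont0 supp(1)])
    show "((\<lambda>y. LINT z|lborel. \<kappa> u w z * f (y - z) u) has_derivative (\<lambda>d. LINT z|lborel. \<kappa> u w z * g1 u (y - z) d)) (at y)"
      by (rule has_derivative_convolution[OF k deriv1 cont1 supp(1,2)])
    show "((\<lambda>y. LINT z|lborel. \<kappa> u w z * g1 u (y - z) b) has_derivative (\<lambda>a. LINT z|lborel. \<kappa> u w z * g2 u b (y - z) a)) (at y)"
      by (rule has_derivative_convolution[OF k deriv2 cont2 supp(2,3)])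
    show "continuous_on UNIV (\<lambda>y. LINT z|lborel. \<kappa> u w z * g2 u b (y - z) a)"
      by (rule continuous_on_convolution[OF k cont2 supp(3)])
    show "integrable lborel (\<lambda>z. \<kappa> u w z * g2 u b (y - z) a)" by (rule integrable_locally_mult[OF k cont2 supp(3)])
  qed
  have \<Phi>1: "(\<Phi> w has_derivative \<Phi>1 w y) (at y)" for w y
    unfolding \<Phi>_def[abs_def] \<Phi>1_def[abs_def] by (intro has_derivative_sum has_derivative_mult_right facts)
  have \<Phi>2: "((\<lambda>y. \<Phi>1 w y b) has_derivative \<Phi>2 w b y) (at y)" for w b y
    unfolding \<Phi>1_def \<Phi>2_def[abs_def] by (intro has_derivative_sum has_derivative_mult_right facts)
  have cont\<Phi>2: "continuous_on UNIV (\<lambda>y. \<Phi>2 w b y a)" for w b a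
    unfolding \<Phi>2_def by (intro continuous_intros facts)
  have pot: "bosonic_potential k f y v = (\<Sum>w\<in>U. \<Phi> w y * e w v)" for y v
  proof -
    have cont: "continuous_on UNIV (\<lambda>x. f x u)" if "u \<in> ball 0 1" for u
      by (rule compactly_supported_C2.cont0[OF slice[OF that]])
    have "bosonic_potential k f y v = c * (LINT z|lborel. norm z powr (2 - real DIM('a) - 2 * real k) * f (y - z) (srefl z v))"
      unfolding c_def by (rule bosonic_potential_eq_convolution[OF fH cont assms(1)])
    also have "\<dots> = c * (LINT z|lborel. (\<Sum>w\<in>U. \<Sum>u\<in>U. e w v * (\<kappa> u w z * f (y - z) u)))"
    proof -
      have "norm z powr (2 - real DIM('a) - 2 * real k) * f (y - z) (srefl z v) = (\<Sum>w\<in>U. \<Sum>u\<in>U. e w v * (\<kappa> u w z * f (y - z) u))" for z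
      proof -
        have "f (y - z) (srefl z v) = (\<Sum>u\<in>U. f (y - z) u * (\<Sum>w\<in>U. e u (srefl z w) * e w v))"
          by (subst interp[OF fH]) (intro sum.cong refl, simp only: expand[of _ z v])
        also have "\<dots> = (\<Sum>w\<in>U. \<Sum>u\<in>U. e w v * (e u (srefl z w) * f (y - z) u))"
          unfolding sum_distrib_left by (subst sum.swap) (simp only: mult_ac)
        finally have "norm z powr (- N) * f (y - z) (srefl z v) = norm z powr (- N) * (\<Sum>w\<in>U. \<Sum>u\<in>U. e w v * (e u (srefl z w) * f (y - z) u))"
          by (simp only:)
        moreover have "- N = 2 - real DIM('a) - 2 * real k" by (simp add: N_def)
        ultimately show ?thesis unfolding \<kappa>_def by (simp add: sum_distrib_left mult_ac)
      qed
      then show ?thesis by (simp only:)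
    qed
    also have "\<dots> = c * (\<Sum>w\<in>U. \<Sum>u\<in>U. LINT z|lborel. e w v * (\<kappa> u w z * f (y - z) u))"
    proof -
      have "(LINT z|lborel. (\<Sum>w\<in>U. \<Sum>u\<in>U. e w v * (\<kappa> u w z * f (y - z) u)))
          = (\<Sum>w\<in>U. LINT z|lborel. (\<Sum>u\<in>U. e w v * (\<kappa> u w z * f (y - z) u)))"
        by (intro Bochner_Integration.integral_sum Bochner_Integration.integrable_sum integrable_mult_right facts)
      also have "\<dots> = (\<Sum>w\<in>U. \<Sum>u\<in>U. LINT z|lborel. e w v * (\<kappa> u w z * f (y - z) u))"
        by (intro sum.cong refl Bochner_Integration.integral_sum integrable_mult_right facts)
      finally show ?thesis by (simp only:)
    qed
    also have "\<dots> = (\<Sum>w\<in>U. \<Phi> w y * e w v)"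
      by (simp add: \<Phi>_def sum_distrib_left sum_distrib_right mult_ac)
    finally show ?thesis .
  qed
  then have potfun: "bosonic_potential k f = (\<lambda>y v. \<Sum>w\<in>U. \<Phi> w y * e w v)" by (intro ext)
  have "bosonic_potential k f \<in> C2_harmonic k"
    unfolding C2_harmonic_def
  proof (intro CollectI conjI allI)
    have tw: "twice_C1 (\<Phi> w)" for w
      unfolding twice_C1_def using \<Phi>1 \<Phi>2 cont\<Phi>2 by blast
    have "twice_C1 (\<lambda>x. \<Phi> w (fst x) * e w (snd x))" if "w \<in> U" for w
      by (rule twice_C1_mult[OF twice_C1_compose_linear[OF tw bounded_linear_fst]
          twice_C1_compose_linear[OF twice_C1_real_polynomial_function[OF eP[OF that]] bounded_linear_snd]])
    then have "twice_C1 (\<lambda>x. \<Sum>w\<in>U. \<Phi> w (fst x) * e w (snd x))"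
      by (rule twice_C1_sum)
    from C2_on_twice_C1[OF this] show "C2_on (UNIV \<times> ball 0 1) (\<lambda>(x, u). bosonic_potential k f x u)"
      unfolding potfun case_prod_unfold .
    show "bosonic_potential k f x \<in> harmonic_polys k" for x
      unfolding potfun by (rule harmonic_polys_sum[OF eH])
  qed
  moreover have "bosonic_laplacian k (bosonic_potential k f) y v = f y v" for y v
  proof -
    \<comment> \<open>The (a, b) coefficient of the bosonic Laplacian applied to \<open>e w\<close>
      at v.\<close>
    define pc where "pc w a b = (a \<bullet> b) * e w v + (- 4 / N * (v \<bullet> a)) * (grad (e w) v \<bullet> b)
        + 4 * (v \<bullet> v) / (N * (N - 2)) * (hess (e w) v a \<bullet> b)" for w a b
    have "bosonic_laplacian k (bosonic_potential k f) y v = (\<Sum>a\<in>Basis. \<Sum>b\<in>Basis. \<Sum>w\<in>U. \<Phi>2 w b y a * pc w a b)"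
      unfolding potfun pc_def by (rule bosonic_laplacian_separable[OF \<Phi>1 \<Phi>2 eP N_def])
    also have "\<dots> = (\<Sum>a\<in>Basis. \<Sum>b\<in>Basis. \<Sum>w\<in>U. \<Sum>u\<in>U. c * (LINT z|lborel. \<kappa> u w z * g2 u b (y - z) a * pc w a b))"
      unfolding \<Phi>2_def by (simp only: sum_distrib_right integral_mult_left_zero) (simp only: mult.assoc)
    also have "\<dots> = (\<Sum>u\<in>U. \<Sum>a\<in>Basis. \<Sum>b\<in>Basis. \<Sum>w\<in>U. c * (LINT z|lborel. \<kappa> u w z * g2 u b (y - z) a * pc w a b))"
      by (rule sum_rotate)
    also have "\<dots> = (\<Sum>u\<in>U. f y u * e u v)"
    \<comment> \<open>For each node u the sum over w reassembles the kernel with h =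
      \<open>e u\<close> and g the slice of f at u, so \<open>fundamental_kernel_integral\<close>
      applies.\<close>
    proof (rule sum.cong[OF refl])
      fix u assume u: "u \<in> U"
      interpret bosonic_kernel "e u" k v N "\<lambda>x. f x u" "g1 u" "g2 u" r by (rule bk[OF u])
      have compose: "(\<lambda>x. e u (srefl z x)) = (\<lambda>x. \<Sum>w\<in>U. e u (srefl z w) * e w x)" for z
        by (rule ext) (rule expand[OF u])
      \<comment> \<open>The gradient of x \<mapsto> \<open>e u (srefl z x)\<close> is computed
        twice: by the chain rule, and from its expansion over the nodes. The Hessian below is
        treated in the same way.\<close>
      have gr: "srefl z (grad (e u) (srefl z v)) \<bullet> b = (\<Sum>w\<in>U. e u (srefl z w) * (grad (e w) v \<bullet> b))" for z b
      proof -
        have "srefl z (grad (e u) (srefl z v)) \<bullet> b = dir_deriv b (\<lambda>x. e u (srefl z x)) v"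
          by (simp add: inner_grad[OF real_polynomial_function_compose_linear[OF p linear_refl refl_adjoint], symmetric]
              grad_compose_selfadjoint[OF p linear_refl refl_adjoint])
        also have "\<dots> = (\<Sum>w\<in>U. e u (srefl z w) * (grad (e w) v \<bullet> b))"
          unfolding compose
          by (rule dir_deriv_eqI) (intro has_derivative_sum has_derivative_mult_right has_derivative_grad_inner eP)
        finally show ?thesis .
      qed
      have he: "srefl z (hess (e u) (srefl z v) (srefl z a)) \<bullet> b = (\<Sum>w\<in>U. e u (srefl z w) * (hess (e w) v a \<bullet> b))" for z a b
      proof -
        have A: "((\<lambda>x. \<Sum>w\<in>U. e u (srefl z w) *\<^sub>R grad (e w) x) has_derivative (\<lambda>d. \<Sum>w\<in>U. e u (srefl z w) *\<^sub>R hess (e w) v d)) (at v)"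
          by (intro has_derivative_sum has_derivative_scaleR_right has_derivative_grad eP)
        have B: "grad (\<lambda>x. e u (srefl z x)) = (\<lambda>x. \<Sum>w\<in>U. e u (srefl z w) *\<^sub>R grad (e w) x)"
        proof
          fix x
          have "grad (\<lambda>x. e u (srefl z x)) x \<bullet> d = (\<Sum>w\<in>U. e u (srefl z w) *\<^sub>R grad (e w) x) \<bullet> d" for d
          proof -
            have "grad (\<lambda>x. e u (srefl z x)) x \<bullet> d = dir_deriv d (\<lambda>x. e u (srefl z x)) x"
              by (rule inner_grad[OF real_polynomial_function_compose_linear[OF p linear_refl refl_adjoint]])
            also have "\<dots> = (\<Sum>w\<in>U. e u (srefl z w) * (grad (e w) x \<bullet> d))"
              unfolding compose
              by (rule dir_deriv_eqI) (intro has_derivative_sum has_derivative_mult_right has_derivative_grad_inner eP)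
            finally show ?thesis by (simp add: inner_sum_left)
          qed
          then show "grad (\<lambda>x. e u (srefl z x)) x = (\<Sum>w\<in>U. e u (srefl z w) *\<^sub>R grad (e w) x)" by (blast intro: euclidean_eqI)
        qed
        have C: "(grad (\<lambda>x. e u (srefl z x)) has_derivative hess (\<lambda>x. e u (srefl z x)) v) (at v)"
          by (rule has_derivative_grad[OF real_polynomial_function_compose_linear[OF p linear_refl refl_adjoint]])
        have "hess (\<lambda>x. e u (srefl z x)) v = (\<lambda>d. \<Sum>w\<in>U. e u (srefl z w) *\<^sub>R hess (e w) v d)"
          by (rule has_derivative_unique[OF C A[folded B]])
        then have "srefl z (hess (e u) (srefl z v) (srefl z a)) = (\<Sum>w\<in>U. e u (srefl z w) *\<^sub>R hess (e w) v a)"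
          unfolding hess_compose_selfadjoint[OF p linear_refl refl_adjoint, symmetric] by (rule fun_cong)
        then show ?thesis by (simp add: inner_sum_left)
      qed
      have coef: "(\<Sum>w\<in>U. e u (srefl z w) * pc w a b) = coef a b z" for a b z
        unfolding coef_def gr he expand[OF u, of z v] pc_def sum_distrib_left sum.distrib[symmetric] distrib_left
        by (intro sum.cong refl) (simp only: mult_ac)
      have "(\<Sum>a\<in>Basis. \<Sum>b\<in>Basis. \<Sum>w\<in>U. c * (LINT z|lborel. \<kappa> u w z * g2 u b (y - z) a * pc w a b))
        = c * (\<Sum>a\<in>Basis. \<Sum>b\<in>Basis. LINT z|lborel. (\<Sum>w\<in>U. \<kappa> u w z * g2 u b (y - z) a * pc w a b))"
        unfolding sum_distrib_left
        by (intro sum.cong refl) (subst Bochner_Integration.integral_sum, intro integrable_mult_left facts u, simp only: sum_distrib_left)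
      also have "\<dots> = c * (\<Sum>a\<in>Basis. \<Sum>b\<in>Basis. LINT z|lborel. norm z powr (- N) * coef a b z * g2 u b (y - z) a)"
        unfolding coef[symmetric] \<kappa>_def by (simp add: sum_distrib_left sum_distrib_right mult_ac)
      also have "\<dots> = c * (LINT z|lborel. norm z powr (- N) * R y z)"
      proof -
        have "(LINT z|lborel. norm z powr (- N) * R y z)
            = (LINT z|lborel. (\<Sum>a\<in>Basis. \<Sum>b\<in>Basis. norm z powr (- N) * coef a b z * g2 u b (y - z) a))"
          unfolding R_def by (simp only: sum_distrib_left mult.assoc)
        also have "\<dots> = (\<Sum>a\<in>Basis. \<Sum>b\<in>Basis. LINT z|lborel. norm z powr (- N) * coef a b z * g2 u b (y - z) a)"
          by (rule integral_double_sum) (rule integrable_locally_mult[OF locally_integrable_coef cont2 supp(3)])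
        finally show ?thesis by (simp only:)
      qed
      also have "\<dots> = f y u * e u v"
        unfolding c_def by (rule fundamental_kernel_integral)
      finally show "(\<Sum>a\<in>Basis. \<Sum>b\<in>Basis. \<Sum>w\<in>U. c * (LINT z|lborel. \<kappa> u w z * g2 u b (y - z) a * pc w a b)) = f y u * e u v" .
    qed
    \<comment> \<open>Interpolation read backwards: the slices at the nodes determine
      \<open>f y\<close> at every v.\<close>
    also have "\<dots> = f y v" by (rule interp[OF fH, symmetric])
    finally show ?thesis .
  qed
  ultimately show ?thesis by blast
qed

end
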